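(* Let $n\ge2$ and $s>0$ with $s-\frac n2\in(0,1)$. Then $c_{BE}(s)<\frac{4s}{n+2s+2}$.
   Context: Set $p=\frac{2n}{n-2s}$ (so $p<0$). $\mathbb S^n\subset\mathbb R^{n+1}$ carries its standard surface measure $d\omega$. For $q\in\mathbb R\setminus\{0\}$ and a positive function $v$, $\|v\|_q:=(\int_{\mathbb S^n}v^q\,d\omega)^{1/q}$. Since $s>n/2$, $H^s(\mathbb S^n)\subset C(\mathbb S^n)$. For $\ell\ge0$ let $P_\ell$ be the $L^2$-orthogonal projection onto spherical harmonics of degree $\ell$. Put $\alpha_{2s}(\ell)=\frac{\Gamma(\ell+\frac n2+s)}{\Gamma(\ell+\frac n2-s)}$ (value $0$ when $\ell+\frac n2-s\in\mathbb Z_{\le0}$), $a_{2s}[u,v]=\sum_{\ell}\alpha_{2s}(\ell)(P_\ell u,P_\ell v)_{L^2}$, $a_{2s}[u]=a_{2s}[u,u]$. Let $\mathcal S_s=(4\pi)^s\frac{\Gamma(\frac{n+2s}{2})}{\Gamma(\frac{n-2s}{2})}\big(\frac{\Gamma(n/2)}{\Gamma(n)}\big)^{2s/n}$. Let $\mathcal M=\{c(1-\zeta\cdot\omega)^{\frac{2s-n}{2}}: c>0,\ \zeta\in\mathbb R^{n+1},\ |\zeta|<1\}$, with tangent space $T_h\mathcal M$ at $h$ and $(T_h\mathcal M)^\perp=\{\rho\in H^s: a_{2s}[\rho,\varphi]=0\ \forall\varphi\in T_h\mathcal M\}$. For $0<u\in H^s$: $\mathsf d(u)=\inf\{a_{2s}[\rho]: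 u=h+\rho,\ h\in\mathcal M,\ \rho\in(T_h\mathcal M)^\perp\}$; for $0<u\in H^s\setminus\mathcal M$: $\mathcal E(u)=\frac{a_{2s}[u]-\mathcal S_s\|u\|_p^2}{\mathsf d(u)}$; and $c_{BE}(s)=\inf\{\mathcal E(u):0<u\in H^s(\mathbb S^n)\setminus\mathcal M\}$. *)

theory Defs
  imports "HOL-Analysis.Analysis"
begin

text \<open>The unit sphere S^n is realised as sphere 0 1 in a Euclidean space 'a of
  dimension n+1 = DIM('a).  Real numbers n below stand for DIM('a) - 1.\<close>

definition sph_dim :: "'a::euclidean_space itself \<Rightarrow> real" where
  "sph_dim _ = real DIM('a) - 1"

text \<open>Standard surface measure on the unit sphere, via the cone construction:
  sigma(A) = (n+1) * Lebesgue({t x. x in A, 0 < t < 1}).\<close>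
definition sph_measure :: "'a::euclidean_space measure" where
  "sph_measure = density
     (distr (restrict_space lborel (ball 0 1 - {0})) borel (\<lambda>x. x /\<^sub>R norm x))
     (\<lambda>_. ennreal (real DIM('a)))"

definition sph_int :: "('a::euclidean_space \<Rightarrow> real) \<Rightarrow> real" where
  "sph_int f = integral\<^sup>L sph_measure f"

text \<open>Homogeneous harmonic polynomials of degree l (their restrictions to the sphere
  are the spherical harmonics of degree l).\<close>
definition hom_harm_poly :: "nat \<Rightarrow> ('a::euclidean_space \<Rightarrow> real) \<Rightarrow> bool" where
  "hom_harm_poly l f \<longleftrightarrow>
     (\<exists>A c. finite A \<and> (\<forall>\<alpha>\<in>A. (\<Sum>b\<in>Basis. \<alpha> b) = l) \<and>
        f = (\<lambda>x. \<Sum>\<alpha>\<in>A. c \<alpha> * (\<Prod>b\<in>Basis. (x \<bullet> b) ^ (\<alpha> b)))) \<and>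
     (\<forall>x. (\<Sum>b\<in>Basis. deriv (deriv (\<lambda>t. f (x + t *\<^sub>R b))) 0) = 0)"

definition sph_harm_proj :: "nat \<Rightarrow> ('a::euclidean_space \<Rightarrow> real) \<Rightarrow> ('a \<Rightarrow> real)" where
  "sph_harm_proj l u = (THE f. hom_harm_poly l f \<and>
      (\<forall>g. hom_harm_poly l g \<longrightarrow> sph_int (\<lambda>x. (u x - f x) * g x) = 0))"

definition alpha2s :: "'a::euclidean_space itself \<Rightarrow> real \<Rightarrow> nat \<Rightarrow> real" where
  "alpha2s T s l = (let n = sph_dim T in
     if real l + n / 2 - s \<in> \<int>\<^sub>\<le>\<^sub>0 then 0
     else Gamma (real l + n / 2 + s) / Gamma (real l + n / 2 - s))"

definition a2s :: "real \<Rightarrow> ('a::euclidean_space \<Rightarrow> real) \<Rightarrow> ('a \<Rightarrow> real) \<Rightarrow> real" where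
  "a2s s u v = (\<Sum>l. alpha2s TYPE('a) s l *
      sph_int (\<lambda>x. sph_harm_proj l u x * sph_harm_proj l v x))"

definition Hs :: "real \<Rightarrow> ('a::euclidean_space \<Rightarrow> real) set" where
  "Hs s = {u. u \<in> borel_measurable sph_measure \<and> integrable sph_measure (\<lambda>x. (u x)\<^sup>2) \<and>
      summable (\<lambda>l. (1 + real l) powr (2 * s) * sph_int (\<lambda>x. (sph_harm_proj l u x)\<^sup>2))}"

definition sph_qnorm :: "real \<Rightarrow> ('a::euclidean_space \<Rightarrow> real) \<Rightarrow> real" where
  "sph_qnorm q v = (sph_int (\<lambda>x. v x powr q)) powr (1 / q)"

definition crit_exp :: "'a::euclidean_space itself \<Rightarrow> real \<Rightarrow> real" where
  "crit_exp T s = 2 * sph_dim T / (sph_dim T - 2 * s)"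

definition Sconst :: "'a::euclidean_space itself \<Rightarrow> real \<Rightarrow> real" where
  "Sconst T s = (let n = sph_dim T in
     (4 * pi) powr s * Gamma ((n + 2 * s) / 2) / Gamma ((n - 2 * s) / 2) *
     (Gamma (n / 2) / Gamma n) powr (2 * s / n))"

definition bubble :: "real \<Rightarrow> real \<Rightarrow> 'a::euclidean_space \<Rightarrow> 'a \<Rightarrow> real" where
  "bubble s c \<zeta> x = c * (1 - \<zeta> \<bullet> x) powr ((2 * s - sph_dim TYPE('a)) / 2)"

definition in_M :: "real \<Rightarrow> ('a::euclidean_space \<Rightarrow> real) \<Rightarrow> bool" where
  "in_M s h \<longleftrightarrow> (\<exists>c \<zeta>. c > 0 \<and> norm \<zeta> < 1 \<and> (\<forall>x\<in>sphere 0 1. h x = bubble s c \<zeta> x))"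

text \<open>rho in (T_h M)^perp for h = bubble s c zeta: rho in H^s and a_2s-orthogonal to
  every element of the tangent space, i.e. the span of the partial derivatives of the
  parametrisation (c, zeta) |-> bubble s c zeta.\<close>
definition tangent_orth :: "real \<Rightarrow> real \<Rightarrow> 'a::euclidean_space \<Rightarrow> ('a \<Rightarrow> real) \<Rightarrow> bool" where
  "tangent_orth s c \<zeta> \<rho> \<longleftrightarrow> \<rho> \<in> Hs s \<and>
     (\<forall>k0 k. a2s s \<rho> (\<lambda>x. k0 * deriv (\<lambda>t. bubble s (c + t) \<zeta> x) 0 +
        (\<Sum>b\<in>Basis. k b * deriv (\<lambda>t. bubble s c (\<zeta> + t *\<^sub>R b) x) 0)) = 0)"

definition dist_M :: "real \<Rightarrow> ('a::euclidean_space \<Rightarrow> real) \<Rightarrow> real" where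
  "dist_M s u = Inf {a2s s \<rho> \<rho> | \<rho> c \<zeta>. c > 0 \<and> norm \<zeta> < 1 \<and> tangent_orth s c \<zeta> \<rho> \<and>
       (\<forall>x\<in>sphere 0 1. u x = bubble s c \<zeta> x + \<rho> x)}"

definition energy_BE :: "real \<Rightarrow> ('a::euclidean_space \<Rightarrow> real) \<Rightarrow> real" where
  "energy_BE s u = (a2s s u u - Sconst TYPE('a) s * (sph_qnorm (crit_exp TYPE('a) s) u)\<^sup>2)
      / dist_M s u"

text \<open>Admissible u: positive element of H^s (taken as its continuous representative)
  not in M.\<close>
definition admissible_BE :: "real \<Rightarrow> ('a::euclidean_space \<Rightarrow> real) \<Rightarrow> bool" where
  "admissible_BE s u \<longleftrightarrow> u \<in> Hs s \<and> continuous_on (sphere 0 1) u \<and>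
     (\<forall>x\<in>sphere 0 1. u x > 0) \<and> \<not> in_M s u"

definition cBE :: "'a::euclidean_space itself \<Rightarrow> real \<Rightarrow> ereal" where
  "cBE T s = (INF u \<in> {u :: 'a \<Rightarrow> real. admissible_BE s u}. ereal (energy_BE s u))"

end

theory Submission
  imports Defs "HOL-Probability.Distributions" "HOL-Real_Asymp.Real_Asymp"
begin

text \<open>
  Near the constant bubble, a perturbation \<open>u = 1 - e \<phi>\<close> by a spherical harmonic \<open>\<phi>\<close> of degree two gives to second
  order exactly the quotient \<open>1 - \<alpha>(1)/\<alpha>(2) = 4s/(n + 2s + 2)\<close>, and the next term is a negative multiple of
  \<open>e \<integral> \<phi>\<^sup>3\<close>. Choosing \<open>\<phi> = x y + y z + z x\<close>, which needs \<open>n \<ge> 2\<close>, makes this cubic moment positive.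
  The distance of \<open>u\<close> to the bubbles is bounded below without computing \<open>a\<close> on bubbles: for \<open>u = h + \<rho>\<close> with
  \<open>\<rho>\<close> orthogonal to \<open>h\<close>, the identity \<open>a[\<rho>, h] = 0\<close> forces \<open>a[\<rho>] \<ge> a[e \<phi>]\<close> for small \<open>e\<close>, because the
  degree-one part of \<open>h\<close> has norm of order \<open>|\<zeta>|\<close> whereas its \<open>\<phi>\<close>-component is only of order \<open>|\<zeta>|\<^sup>2\<close>.
\<close>

section \<open>The surface integral on the sphere\<close>

text \<open>The signs shape the argument. \<open>alpha2s\<close> is negative at degree 0 and only
  there, and \<open>Sconst\<close> and the exponent p are negative as well. So the form a is
  indefinite, \<open>dist_M\<close> is not a squared distance, and a priori its infimum could fall
  below a[e \<phi>] or even below 0. The competitor \<rho> = - e \<phi> at h = 1 bounds it only from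
  above, which says nothing about a quotient with \<open>dist_M\<close> in the denominator. The
  lower bound must be uniform over all c > 0 and |\<zeta>| < 1, so an expansion near h = 1 would not
  do. It rests on three integrals of h: against 1, against \<zeta> \<bullet> x and against \<phi>.
  The norm enters through a decreasing power, and multiplication by \<open>Sconst\<close> reverses
  the inequality once more; hence a lower bound for the integral of u^p is the useful one. Moments
  on the sphere come from Gaussian moments of the ambient space, with one unevaluated positive
  constant per degree; only the total area is computed.\<close>

lemma ball_minus_zero_measurable [measurable]: "ball 0 1 - {0} \<in> sets (borel :: 'a::euclidean_space measure)"
  by simp

lemma normalise_measurable [measurable]:
  "(\<lambda>x::'a::euclidean_space. x /\<^sub>R norm x) \<in> borel \<rightarrow>\<^sub>M borel"
  by measurable

lemma sets_sph_measure [simp, measurable_cong]: "sets (sph_measure :: 'a::euclidean_space measure) = sets borel"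
  by (simp add: sph_measure_def)

lemma sph_int_eq:
  fixes f :: "'a::euclidean_space \<Rightarrow> real"
  assumes [measurable]: "f \<in> borel_measurable borel"
  shows "sph_int f = real DIM('a) * (LINT x|lborel. indicator (ball 0 1 - {0}) x * f (x /\<^sub>R norm x))"
proof -
  have [measurable]: "(\<lambda>x::'a. x /\<^sub>R norm x) \<in> restrict_space lborel (ball 0 1 - {0}) \<rightarrow>\<^sub>M borel"
    by (intro measurable_restrict_space1) simp
  have "sph_int f = (LINT x|distr (restrict_space lborel (ball 0 1 - {0})) borel (\<lambda>x. x /\<^sub>R norm x).
      real DIM('a) *\<^sub>R f x)"
    unfolding sph_int_def sph_measure_def by (subst integral_density) auto
  also have "\<dots> = (LINT x|restrict_space lborel (ball 0 1 - {0}). real DIM('a) *\<^sub>R f (x /\<^sub>R norm x))"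
    by (subst integral_distr) auto
  also have "\<dots> = (LINT x|lborel. indicator (ball 0 1 - {0}) x * (real DIM('a) * f (x /\<^sub>R norm x)))"
    by (subst integral_restrict_space) auto
  also have "\<dots> = (LINT x|lborel. real DIM('a) * (indicator (ball 0 1 - {0}) x * f (x /\<^sub>R norm x)))"
    by (simp add: mult_ac)
  finally show ?thesis by simp
qed

lemma finite_measure_sph: "finite_measure (sph_measure :: 'a::euclidean_space measure)"
proof
  have [measurable]: "(\<lambda>x::'a. x /\<^sub>R norm x) \<in> restrict_space lborel (ball 0 1 - {0}) \<rightarrow>\<^sub>M borel"
    by (intro measurable_restrict_space1) simp
  have "emeasure (sph_measure :: 'a measure) UNIV
      = (\<integral>\<^sup>+ x. ennreal (real DIM('a)) \<partial>distr (restrict_space lborel (ball 0 1 - {0})) borel (\<lambda>x::'a. x /\<^sub>R norm x))"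
    unfolding sph_measure_def by (subst emeasure_density) auto
  also have "\<dots> = ennreal (real DIM('a)) * emeasure lborel (ball 0 1 - {0::'a})"
    by (simp add: emeasure_distr space_restrict_space emeasure_restrict_space)
  also have "\<dots> \<le> ennreal (real DIM('a)) * emeasure lborel (ball (0::'a) 1)"
    by (intro mult_left_mono emeasure_mono) auto
  also have "\<dots> < \<infinity>"
    by (auto simp: ennreal_mult_less_top emeasure_ball)
  finally show "emeasure (sph_measure :: 'a measure) (space sph_measure) \<noteq> \<infinity>"
    by (simp add: sph_measure_def)
qed

text \<open>The measure is defined on the Borel sets of the ambient space but is an image under
  normalisation, so it is carried by the unit sphere and values off the sphere can be
  ignored.\<close>

lemma AE_sph_measure:
  assumes "\<And>x. norm x = 1 \<Longrightarrow> P x" and [measurable]: "Measurable.pred borel P"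
  shows "AE x in (sph_measure :: 'a::euclidean_space measure). P x"
proof -
  have [measurable]: "(\<lambda>x::'a. x /\<^sub>R norm x) \<in> restrict_space lborel (ball 0 1 - {0}) \<rightarrow>\<^sub>M borel"
    by (intro measurable_restrict_space1) simp
  have "AE x in restrict_space lborel (ball 0 1 - {0::'a}). P (x /\<^sub>R norm x)"
    by (subst AE_restrict_space_iff) (auto intro!: AE_I2 assms(1))
  hence "AE x in distr (restrict_space lborel (ball 0 1 - {0})) borel (\<lambda>x::'a. x /\<^sub>R norm x). P x"
    by (subst AE_distr_iff) auto
  thus ?thesis unfolding sph_measure_def by (subst AE_density) auto
qed

text \<open>Boundedness is asked for on the sphere only: the remainder \<rho> in
  \<open>dist_M\<close> is determined by an equation there and may be any Borel function elsewhere,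
  so continuity cannot be required.\<close>

definition sph_bdd :: "('a::euclidean_space \<Rightarrow> real) \<Rightarrow> bool" where
  "sph_bdd v \<longleftrightarrow> v \<in> borel_measurable borel \<and> (\<exists>C. \<forall>x. norm x = 1 \<longrightarrow> \<bar>v x\<bar> \<le> C)"

lemma sph_bdd_measurable: "sph_bdd v \<Longrightarrow> v \<in> borel_measurable borel"
  by (simp add: sph_bdd_def)

lemma sph_bdd_integrable: "sph_bdd v \<Longrightarrow> integrable sph_measure v"
proof -
  assume v: "sph_bdd v"
  then obtain C where [measurable]: "v \<in> borel_measurable borel" and C: "\<forall>x. norm x = 1 \<longrightarrow> \<bar>v x\<bar> \<le> C"
    by (auto simp: sph_bdd_def)
  have "AE x in sph_measure. norm (v x) \<le> C"
    by (rule AE_sph_measure) (use C in auto)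
  then show ?thesis
    by (intro finite_measure.integrable_const_bound[OF finite_measure_sph]) auto
qed

lemma continuous_sph_bdd:
  fixes v :: "'a::euclidean_space \<Rightarrow> real"
  assumes "continuous_on UNIV v"
  shows "sph_bdd v"
proof -
  have "compact (v ` sphere 0 1)"
    by (intro compact_continuous_image continuous_on_subset[OF assms]) auto
  then obtain C where "\<forall>y\<in>v ` sphere 0 1. norm y \<le> C"
    using compact_imp_bounded bounded_iff by blast
  then show ?thesis
    unfolding sph_bdd_def using borel_measurable_continuous_onI[OF assms] by (auto intro!: exI[of _ C])
qed

lemma sph_bdd_const [intro, simp]: "sph_bdd (\<lambda>x. c)"
  by (auto simp: sph_bdd_def)

lemma sph_bdd_add [intro]: "sph_bdd f \<Longrightarrow> sph_bdd g \<Longrightarrow> sph_bdd (\<lambda>x. f x + g x)"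
  unfolding sph_bdd_def by (auto, meson abs_triangle_ineq add_mono order_trans)

lemma sph_bdd_mult [intro]: assumes "sph_bdd f" "sph_bdd g" shows "sph_bdd (\<lambda>x. f x * g x)"
proof -
  obtain C D where "\<forall>x. norm x = 1 \<longrightarrow> \<bar>f x\<bar> \<le> C" "\<forall>x. norm x = 1 \<longrightarrow> \<bar>g x\<bar> \<le> D"
    using assms by (auto simp: sph_bdd_def)
  then have "\<forall>x. norm x = 1 \<longrightarrow> \<bar>f x * g x\<bar> \<le> C * D"
    by (auto simp: abs_mult intro!: mult_mono)
  then show ?thesis using assms by (auto simp: sph_bdd_def)
qed

lemma sph_bdd_minus [intro]: "sph_bdd f \<Longrightarrow> sph_bdd (\<lambda>x. - f x)"
  using sph_bdd_mult[of "\<lambda>_. -1" f] by simp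

lemma sph_bdd_diff [intro]: "sph_bdd f \<Longrightarrow> sph_bdd g \<Longrightarrow> sph_bdd (\<lambda>x. f x - g x)"
  using sph_bdd_add[of f "\<lambda>x. - g x"] by (auto)

lemma sph_bdd_power [intro]: "sph_bdd f \<Longrightarrow> sph_bdd (\<lambda>x. f x ^ k)"
  by (induction k) auto

lemma sph_bdd_sum [intro]: "(\<And>i. i \<in> I \<Longrightarrow> sph_bdd (f i)) \<Longrightarrow> sph_bdd (\<lambda>x. \<Sum>i\<in>I. f i x)"
  by (induction I rule: infinite_finite_induct) auto

lemma sph_bdd_inner [intro, simp]: "sph_bdd (\<lambda>x. x \<bullet> b)" "sph_bdd (\<lambda>x. b \<bullet> x)"
  by (auto intro!: continuous_sph_bdd continuous_intros)

lemma sph_int_add: "sph_bdd f \<Longrightarrow> sph_bdd g \<Longrightarrow> sph_int (\<lambda>x. f x + g x) = sph_int f + sph_int g"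
  unfolding sph_int_def by (intro Bochner_Integration.integral_add sph_bdd_integrable)

lemma sph_int_diff: "sph_bdd f \<Longrightarrow> sph_bdd g \<Longrightarrow> sph_int (\<lambda>x. f x - g x) = sph_int f - sph_int g"
  unfolding sph_int_def by (intro Bochner_Integration.integral_diff sph_bdd_integrable)

lemma sph_int_cmult: "sph_int (\<lambda>x. c * f x) = c * sph_int f"
  unfolding sph_int_def by simp

lemma sph_int_uminus: "sph_int (\<lambda>x. - f x) = - sph_int f"
  unfolding sph_int_def by simp

lemma sph_int_sum: "(\<And>i. i \<in> I \<Longrightarrow> sph_bdd (f i)) \<Longrightarrow> sph_int (\<lambda>x. \<Sum>i\<in>I. f i x) = (\<Sum>i\<in>I. sph_int (f i))"
  unfolding sph_int_def by (intro Bochner_Integration.integral_sum sph_bdd_integrable)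

lemma sph_int_cong:
  fixes f g :: "'a::euclidean_space \<Rightarrow> real"
  assumes "f \<in> borel_measurable borel" "g \<in> borel_measurable borel"
    and "\<And>x. norm x = 1 \<Longrightarrow> f x = g x"
  shows "sph_int f = sph_int g"
  unfolding sph_int_def
  by (intro integral_cong_AE) (use assms AE_sph_measure[of "\<lambda>x. f x = g x"] in auto)

lemma sph_int_mono:
  fixes f g :: "'a::euclidean_space \<Rightarrow> real"
  assumes "sph_bdd f" "sph_bdd g" and "\<And>x. norm x = 1 \<Longrightarrow> f x \<le> g x"
  shows "sph_int f \<le> sph_int g"
proof -
  have [measurable]: "f \<in> borel_measurable borel" "g \<in> borel_measurable borel"
    using assms sph_bdd_measurable by auto
  show ?thesis
    unfolding sph_int_def
    by (intro integral_mono_AE sph_bdd_integrable assms)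
      (use assms AE_sph_measure[of "\<lambda>x. f x \<le> g x"] in auto)
qed

lemma sph_int_nonneg: "(\<And>x. norm x = 1 \<Longrightarrow> 0 \<le> f x) \<Longrightarrow> sph_bdd f \<Longrightarrow> 0 \<le> sph_int f"
  using sph_int_mono[of "\<lambda>_. 0" f] by (simp add: sph_int_def)

text \<open>If f were nonzero at x, the cone over {f \<noteq> 0} in the punctured ball would be open
  and nonempty, hence not negligible, although the vanishing integral of a nonnegative function
  makes it a null set.\<close>

lemma sph_int_eq_0_imp:
  fixes f :: "'a::euclidean_space \<Rightarrow> real"
  assumes cont: "continuous_on UNIV f" and nn: "\<And>x. 0 \<le> f x" and 0: "sph_int f = 0" and x: "norm x = 1"
  shows "f x = 0"
proof (rule ccontr)
  assume "f x \<noteq> 0"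
  define U where "U = (ball 0 1 - {0::'a}) \<inter> (\<lambda>x. f (x /\<^sub>R norm x)) -` (- {0})"
  have [measurable]: "f \<in> borel_measurable borel" by (rule borel_measurable_continuous_onI[OF cont])
  have "continuous_on (ball 0 1 - {0::'a}) (\<lambda>x. f (x /\<^sub>R norm x))"
    by (intro continuous_on_compose2[OF cont] continuous_intros) auto
  then have U: "open U"
    unfolding U_def by (intro continuous_open_preimage) (auto simp: open_delete)
  have "(1/2) *\<^sub>R x \<in> U"
    using x \<open>f x \<noteq> 0\<close> by (auto simp: U_def)
  then have "U \<noteq> {}" by auto
  have b: "sph_bdd f" by (rule continuous_sph_bdd[OF cont])
  have "AE x in sph_measure. f x = 0"
    using 0 integral_nonneg_eq_0_iff_AE[OF sph_bdd_integrable[OF b]] nn by (auto simp: sph_int_def)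
  moreover have [measurable]: "(\<lambda>x::'a. x /\<^sub>R norm x) \<in> restrict_space lborel (ball 0 1 - {0}) \<rightarrow>\<^sub>M borel"
    by (intro measurable_restrict_space1) simp
  ultimately have "AE x in lborel. x \<in> ball 0 1 - {0::'a} \<longrightarrow> f (x /\<^sub>R norm x) = 0"
    unfolding sph_measure_def by (subst (asm) AE_density) (auto simp: AE_distr_iff AE_restrict_space_iff)
  then have "AE x in lborel. x \<notin> U" by (auto simp: U_def elim: eventually_mono)
  then have "U \<in> null_sets lborel"
    using U by (subst AE_iff_null_sets) auto
  then have "negligible U" by (simp add: negligible_iff_null_sets null_sets_completionI)
  then show False using open_not_negligible U \<open>U \<noteq> {}\<close> by blast
qed

section \<open>Gaussian moments and moments on the sphere\<close>

lemma lborel_integral_scale: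
  fixes g :: "'a::euclidean_space \<Rightarrow> real"
  assumes [measurable]: "g \<in> borel_measurable borel" and r: "r > 0"
  shows "(LINT x|lborel. g x) = r ^ DIM('a) * (LINT x|lborel. g (r *\<^sub>R x))" (is ?A)
    and "integrable lborel g \<longleftrightarrow> integrable lborel (\<lambda>x. g (r *\<^sub>R x))" (is ?B)
proof -
  have e: "lborel = density (distr lborel borel (\<lambda>x::'a. r *\<^sub>R x)) (\<lambda>_. ennreal (r ^ DIM('a)))"
    using lborel_affine[of r "0::'a"] r by simp
  show ?A using r by (subst e, subst integral_density) (auto simp: integral_distr)
  show ?B using r by (subst e, subst integrable_density) (auto simp: integrable_distr_eq)
qed

text \<open>For x \<noteq> 0, F(x) W(|x|) is the integral of w(r) F(x) over r > |x|. Fubini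
  exchanges r and x, and scaling the ball of radius r to the unit ball pulls out r^(DIM + k). This
  replaces polar coordinates; it is used with a Gaussian weight and with a truncated power.\<close>

lemma layer_cake_homogeneous:
  fixes F :: "'a::euclidean_space \<Rightarrow> real"
  assumes [measurable]: "F \<in> borel_measurable borel" "w \<in> borel_measurable borel"
    and hom: "\<And>r x. r > 0 \<Longrightarrow> F (r *\<^sub>R x) = r ^ k * F x"
    and bF: "\<And>x. norm x < 1 \<Longrightarrow> x \<noteq> 0 \<Longrightarrow> \<bar>F x\<bar> \<le> C"
    and nn: "\<And>r. r > 0 \<Longrightarrow> 0 \<le> w r"
    and W: "\<And>a. a > 0 \<Longrightarrow> (LINT r|lborel. indicator {a<..} r * w r) = W a"
    and wint: "integrable lborel (\<lambda>r. indicator {0<..} r * w r * r ^ (DIM('a) + k))"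
  shows "(LINT x|lborel. F x * W (norm x)) =
     (LINT r|lborel. indicator {0<..} r * w r * r ^ (DIM('a) + k)) *
     (LINT x|lborel. indicator (ball 0 1 - {0}) x * F x)"
proof -
  define J where "J = (\<lambda>(r::real) (x::'a). (if 0 < r \<and> x \<noteq> 0 \<and> norm x < r then w r * F x else 0))"
  have [measurable]: "case_prod J \<in> borel_measurable (lborel \<Otimes>\<^sub>M lborel)"
    unfolding J_def by measurable
  have [measurable]: "J r \<in> borel_measurable borel" for r
    unfolding J_def by measurable
  have iF: "integrable lborel (\<lambda>x. indicator (ball 0 1 - {0}) x * F x)"
  proof (rule Bochner_Integration.integrable_bound)
    show "integrable lborel (\<lambda>x::'a. C * indicator (ball 0 1) x)"
      by (intro integrable_mult_right integrable_real_indicator) (auto simp: emeasure_ball)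
    show "AE x in lborel. norm (indicator (ball 0 1 - {0}) x * F x) \<le> norm (C * indicator (ball 0 1) x)"
      by (intro AE_I2) (auto simp: indicator_def intro: order_trans[OF bF abs_ge_self])
  qed measurable
  have Jscale: "J r (r *\<^sub>R x) = r ^ k * w r * (indicator (ball 0 1 - {0}) x * F x)" if "r > 0" for r x
    using that by (auto simp: J_def indicator_def hom)
  have Jint: "integrable lborel (J r)" for r
  proof (cases "r > 0")
    case True
    then show ?thesis
      using iF by (subst lborel_integral_scale(2)[of _ r]) (auto simp: Jscale)
  next
    case False
    then have "J r = (\<lambda>_. 0)" by (auto simp: J_def)
    then show ?thesis by simp
  qed
  have J1: "(LINT x|lborel. J r x) =
      indicator {0<..} r * w r * r ^ (DIM('a) + k) * (LINT x|lborel. indicator (ball 0 1 - {0}) x * F x)" for r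
  proof (cases "r > 0")
    case True
    then show ?thesis
      by (subst lborel_integral_scale(1)[of _ r]) (auto simp: Jscale power_add)
  next
    case False
    then have "J r = (\<lambda>_. 0)" by (auto simp: J_def)
    then show ?thesis using False by simp
  qed
  have J1': "(LINT x|lborel. norm (J r x)) =
      indicator {0<..} r * w r * r ^ (DIM('a) + k) * (LINT x|lborel. indicator (ball 0 1 - {0}) x * \<bar>F x\<bar>)" for r
  proof (cases "r > 0")
    case True
    have n: "norm (J r (r *\<^sub>R x)) = r ^ k * w r * (indicator (ball 0 1 - {0}) x * \<bar>F x\<bar>)" for x
      using True nn[OF True] by (simp add: Jscale abs_mult)
    then show ?thesis
      using True by (subst lborel_integral_scale(1)[of _ r]) (simp_all only: n, simp_all add: power_add)
  next
    case False
    then have "J r = (\<lambda>_. 0)" by (auto simp: J_def)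
    then show ?thesis using False by simp
  qed
  have "integrable (lborel \<Otimes>\<^sub>M lborel) (case_prod J)"
  proof (rule lborel_pair.Fubini_integrable)
    show "integrable lborel (\<lambda>x. LINT y|lborel. norm (case (x, y) of (x, xa) \<Rightarrow> J x xa))"
      using wint by (simp add: J1'[simplified])
  qed (auto simp: Jint)
  from lborel_pair.Fubini_integral[OF this]
  have "(LINT x|lborel. LINT r|lborel. J r x) = (LINT r|lborel. LINT x|lborel. J r x)" .
  also have "\<dots> = (LINT r|lborel. indicator {0<..} r * w r * r ^ (DIM('a) + k)) *
     (LINT x|lborel. indicator (ball 0 1 - {0}) x * F x)"
    unfolding J1 by simp
  also have "(LINT x|lborel. LINT r|lborel. J r x) = (LINT x|lborel. F x * W (norm x))"
  proof (rule integral_cong_AE)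
    have e: "(LINT r|lborel. J r x) = F x * W (norm x)" if "x \<noteq> 0" for x
    proof -
      have "(LINT r|lborel. J r x) = (LINT r|lborel. F x * (indicator {norm x<..} r * w r))"
        by (intro Bochner_Integration.integral_cong)
          (use that in \<open>auto simp: J_def indicator_def dest: le_less_trans[OF norm_ge_zero]\<close>)
      then show ?thesis using W[of "norm x"] that by simp
    qed
    show "AE x in lborel. (LINT r|lborel. J r x) = F x * W (norm x)"
      by (rule eventually_mono[OF AE_lborel_singleton[of 0] e])
    show "(\<lambda>x. LINT r|lborel. J r x) \<in> borel_measurable lborel" by measurable
    \<comment> \<open>\<open>W\<close> is not assumed measurable. Away from 0 it agrees with the
      tail integral \<open>W'\<close>, which is measurable, and at 0 it contributes a single
      value.\<close>
    define W' where "W' a = (LINT r|lborel. indicator {a<..} r * w r)" for a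
    have "(\<lambda>x::real. LINT r|lborel. (if x < r then 1 else 0) * w r) \<in> borel_measurable lborel"
      by measurable
    also have "(\<lambda>x::real. LINT r|lborel. (if x < r then 1 else 0) * w r) = W'"
      unfolding W'_def by (intro ext Bochner_Integration.integral_cong) (auto simp: indicator_def)
    finally have [measurable]: "W' \<in> borel_measurable borel" by simp
    have "(\<lambda>x. F x * (if x = 0 then W 0 else W' (norm x))) \<in> borel_measurable lborel" by measurable
    also have "(\<lambda>x. F x * (if x = 0 then W 0 else W' (norm x))) = (\<lambda>x. F x * W (norm x))"
      using W by (auto simp: W'_def fun_eq_iff)
    finally show "(\<lambda>x. F x * W (norm x)) \<in> borel_measurable lborel" .
  qed
  finally show ?thesis by simp
qed

section \<open>Monomials and their Gaussian moments\<close>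

definition mon :: "('a \<Rightarrow> nat) \<Rightarrow> 'a::euclidean_space \<Rightarrow> real" where
  "mon \<alpha> x = (\<Prod>b\<in>Basis. (x \<bullet> b) ^ \<alpha> b)"

definition gmom :: "nat \<Rightarrow> real" where
  "gmom k = (LINT t|lborel. std_normal_density t * t ^ k)"

lemma gmom_odd: "odd k \<Longrightarrow> gmom k = 0"
  unfolding gmom_def using integral_std_normal_moment_odd by (auto elim!: oddE)

lemma gmom_even: "gmom (2 * k) = fact (2 * k) / (2 ^ k * fact k)"
  unfolding gmom_def by (rule integral_std_normal_moment_even)

lemma gmom_0: "gmom 0 = 1" and gmom_1: "gmom (Suc 0) = 0" and gmom_2: "gmom 2 = 1"
  using gmom_even[of 0] gmom_even[of 1] gmom_odd[of 1] by (auto simp: numeral_2_eq_2)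

text \<open>This is integration by parts against the Gaussian, read off the closed form of the even
  moments; for odd k both sides vanish. It takes the place of Green's formula in the orthogonality
  of harmonics.\<close>

lemma gmom_Suc_Suc: "gmom (Suc (Suc k)) = real (Suc k) * gmom k"
proof (cases "even k")
  case True
  then obtain j where k: "k = 2 * j" by auto
  have "fact (2 * Suc j) = real (2 * j + 2) * (real (2 * j + 1) * fact (2 * j))"
    by (simp add: algebra_simps)
  then have "gmom (2 * Suc j) = real (2 * j + 2) * (real (2 * j + 1) * fact (2 * j)) / (2 ^ Suc j * (real (Suc j) * fact j))"
    unfolding gmom_even by (simp only: fact_Suc)
  also have "\<dots> = real (2 * j + 1) * (fact (2 * j) / (2 ^ j * fact j))"
    by (simp add: divide_simps)
  also have "fact (2 * j) / (2 ^ j * fact j) = gmom (2 * j)" by (rule gmom_even[symmetric])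
  finally show ?thesis by (simp add: k)
next
  case False
  then show ?thesis by (simp add: gmom_odd)
qed

lemma mon_scale: "mon \<alpha> (r *\<^sub>R x) = r ^ (\<Sum>b\<in>Basis. \<alpha> b) * mon \<alpha> x"
  by (simp add: mon_def power_mult_distrib prod.distrib power_sum)

lemma continuous_mon [continuous_intros]: "continuous_on S (mon \<alpha>)"
  unfolding mon_def by (intro continuous_intros)

lemma mon_measurable [measurable]: "mon \<alpha> \<in> borel_measurable borel"
  by (intro borel_measurable_continuous_onI continuous_mon)

lemma sph_bdd_mon [intro, simp]: "sph_bdd (mon \<alpha>)"
  by (intro continuous_sph_bdd continuous_mon)

lemma abs_mon_le: assumes "norm x \<le> 1" shows "\<bar>mon \<alpha> x\<bar> \<le> 1"
proof -
  have "\<bar>(x \<bullet> b) ^ \<alpha> b\<bar> \<le> 1" if "b \<in> Basis" for b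
    using Basis_le_norm[OF that, of x] assms by (simp add: power_abs power_le_one)
  then show ?thesis unfolding mon_def abs_prod by (intro prod_le_1) auto
qed

lemma prod_std_normal_density:
  "(\<Prod>b\<in>Basis. std_normal_density ((x::'a::euclidean_space) \<bullet> b)) =
     (1 / sqrt (2 * pi)) ^ DIM('a) * exp (- (norm x)\<^sup>2 / 2)"
proof -
  have "(\<Prod>b\<in>Basis. std_normal_density (x \<bullet> b)) =
      (1 / sqrt (2 * pi)) ^ DIM('a) * (\<Prod>b\<in>Basis. exp (- (x \<bullet> b)\<^sup>2 / 2))"
    unfolding std_normal_density_def prod.distrib by simp
  also have "(\<Prod>b\<in>Basis. exp (- (x \<bullet> b)\<^sup>2 / 2)) = exp (\<Sum>b\<in>Basis. - (x \<bullet> b)\<^sup>2 / 2)"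
    by (simp add: exp_sum)
  also have "(\<Sum>b\<in>Basis. - (x \<bullet> b)\<^sup>2 / 2) = - (norm x)\<^sup>2 / 2"
    unfolding power2_norm_eq_inner euclidean_inner[of x x]
    by (simp add: sum_negf sum_divide_distrib power2_eq_square)
  finally show ?thesis .
qed

lemma gaussian_mon:
  "(LINT x|lborel. mon \<alpha> x * exp (- (norm (x::'a::euclidean_space))\<^sup>2 / 2)) =
     sqrt (2 * pi) ^ DIM('a) * (\<Prod>b\<in>Basis. gmom (\<alpha> b))"
proof -
  interpret P: product_sigma_finite "\<lambda>_::'a. lborel :: real measure" ..
  have "(LINT x|lborel. (\<Prod>b\<in>Basis. std_normal_density ((x::'a) \<bullet> b) * (x \<bullet> b) ^ \<alpha> b)) =
     (LINT f|(\<Pi>\<^sub>M b\<in>Basis. lborel). (\<Prod>b\<in>Basis. std_normal_density (f b) * (f b) ^ \<alpha> b))"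
  proof (subst lborel_eq, subst integral_distr)
    show "(LINT f|(\<Pi>\<^sub>M b\<in>Basis. lborel). (\<Prod>b\<in>Basis. std_normal_density ((\<Sum>b\<in>Basis. f b *\<^sub>R b) \<bullet> (b::'a)) * ((\<Sum>b\<in>Basis. f b *\<^sub>R b) \<bullet> b) ^ \<alpha> b)) =
     (LINT f|(\<Pi>\<^sub>M b\<in>Basis. lborel). (\<Prod>b\<in>Basis. std_normal_density (f b) * (f b) ^ \<alpha> b))"
      by (intro Bochner_Integration.integral_cong prod.cong refl) simp
  qed measurable
  also have "\<dots> = (\<Prod>b\<in>Basis. gmom (\<alpha> b))"
    unfolding gmom_def
    by (rule P.product_integral_prod) (auto intro: integrable_std_normal_moment)
  also have "(\<lambda>x::'a. \<Prod>b\<in>Basis. std_normal_density (x \<bullet> b) * (x \<bullet> b) ^ \<alpha> b) =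
      (\<lambda>x. (1 / sqrt (2 * pi)) ^ DIM('a) * (mon \<alpha> x * exp (- (norm x)\<^sup>2 / 2)))"
    by (simp only: prod.distrib prod_std_normal_density mon_def[symmetric] mult_ac)
  finally show ?thesis by (simp add: field_simps)
qed

lemma lint_gauss_tail:
  fixes a :: real
  assumes "a > 0"
  shows "(LINT r|lborel. indicator {a<..} r * (r * exp (- r\<^sup>2 / 2))) = exp (- a\<^sup>2 / 2)"
proof -
  have "(\<integral>\<^sup>+ r. ennreal (r * exp (- r\<^sup>2 / 2)) * indicator {a..} r \<partial>lborel)
      = ennreal (0 - (- exp (- a\<^sup>2 / 2)))"
  proof (rule nn_integral_FTC_atLeast[where F = "\<lambda>r. - exp (- r\<^sup>2 / 2)"])
    show "((\<lambda>r::real. - exp (- r\<^sup>2 / 2)) \<longlongrightarrow> 0) at_top"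
      by real_asymp
  qed (use assms in \<open>auto intro!: derivative_eq_intros\<close>)
  also have "(\<integral>\<^sup>+ r. ennreal (r * exp (- r\<^sup>2 / 2)) * indicator {a..} r \<partial>lborel) =
      (\<integral>\<^sup>+ r. ennreal (indicator {a<..} r * (r * exp (- r\<^sup>2 / 2))) \<partial>lborel)"
    using AE_lborel_singleton[of a]
    by (intro nn_integral_cong_AE) (auto elim!: eventually_mono simp: indicator_def)
  finally show ?thesis
    using assms by (subst integral_eq_nn_integral) (auto simp: indicator_def intro!: AE_I2)
qed

lemma gauss_radial:
  "integrable lborel (\<lambda>r::real. indicator {0<..} r * (r * exp (- r\<^sup>2 / 2)) * r ^ m)" (is "integrable _ ?f")
  "0 < (LINT r|lborel. indicator {0<..} r * ((r::real) * exp (- r\<^sup>2 / 2)) * r ^ m)"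
proof -
  show i: "integrable lborel ?f"
  proof (rule Bochner_Integration.integrable_bound)
    show "integrable lborel (\<lambda>r. sqrt (2 * pi) * (std_normal_density r * \<bar>r\<bar> ^ Suc m))"
      by (intro integrable_mult_right integrable_std_normal_moment_abs)
    show "AE r in lborel. norm (?f r) \<le> norm (sqrt (2 * pi) * (std_normal_density r * \<bar>r\<bar> ^ Suc m))"
      by (rule AE_I2) (auto simp: std_normal_density_def indicator_def abs_mult power_abs mult_ac
          intro!: mult_nonpos_nonneg)
  qed measurable
  \<comment> \<open>On [1, 2] the integrand is at least exp(-2), since r^2 \<le> 4 and r * r^m \<ge>
    1.\<close>
  have "0 < exp (-2::real) * measure lborel {1..2::real}" by simp
  also have "\<dots> = (LINT r|lborel. exp (-2::real) * indicator {1..2::real} r)" by simp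
  also have "\<dots> \<le> integral\<^sup>L lborel ?f"
  proof (rule integral_mono)
    show "integrable lborel (\<lambda>r. exp (-2::real) * indicator {1..2::real} r)" by simp
    fix r :: real
    show "exp (-2) * indicator {1..2} r \<le> ?f r"
    proof (cases "r \<in> {1..2}")
      case True
      then have "r * r \<le> 2 * 2" by (intro mult_mono) auto
      then have "exp (-2) \<le> exp (- r\<^sup>2 / 2)" by (simp add: power2_eq_square)
      moreover have "1 * 1 \<le> r * r ^ m" using True by (intro mult_mono one_le_power) auto
      ultimately have "exp (-2) * 1 \<le> exp (- r\<^sup>2 / 2) * (r * r ^ m)" by (intro mult_mono) auto
      then show ?thesis using True by (simp add: mult_ac)
    qed (auto simp: indicator_def)
  qed (rule i)
  finally show "0 < integral\<^sup>L lborel ?f" .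
qed

lemma lint_power_FTC:
  fixes a :: real
  assumes "a \<le> 1"
  shows "(LINT r|lborel. indicator {a..1} r * (c * real m * r ^ (m - 1))) = c * (1 - a ^ m)"
proof -
  have "(LINT r|lborel. indicator {a..1} r *\<^sub>R (c * real m * r ^ (m - 1))) = c * 1 ^ m - c * a ^ m"
  proof (rule integral_FTC_atLeastAtMost[OF assms])
    show "((\<lambda>r. c * r ^ m) has_vector_derivative c * real m * x ^ (m - 1)) (at x within {a..1})" for x
      unfolding has_real_derivative_iff_has_vector_derivative[symmetric]
      by (auto intro!: derivative_eq_intros)
  qed (intro continuous_intros)
  then show ?thesis by (simp add: algebra_simps)
qed

text \<open>\<open>sph_int\<close> sees the monomial through its degree-zero extension F(x) = mon(x
  / |x|), while the Gaussian integral leads to the monomial itself. The weight k r^(k-1) on (0, 1]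
  has tail 1 - a^k, so \<open>layer_cake_homogeneous\<close> applied to F gives the ball integral of
  F - |x|^k F, that is of F minus the monomial, as k / (DIM + k) times that of F.\<close>

lemma ball_mon_radial:
  fixes \<alpha> :: "'a::euclidean_space \<Rightarrow> nat"
  assumes k: "(\<Sum>b\<in>Basis. \<alpha> b) = k"
  shows "sph_int (mon \<alpha>) = (real DIM('a) + real k) * (LINT x|lborel. indicator (ball 0 1 - {0}) x * mon \<alpha> x)"
proof (cases "k = 0")
  case True
  then have "mon \<alpha> = (\<lambda>_. 1)" using k by (auto simp: mon_def)
  then show ?thesis using True by (simp add: sph_int_eq)
next
  case False
  define F where "F x = mon \<alpha> (x /\<^sub>R norm x)" for x :: 'a
  have [measurable]: "F \<in> borel_measurable borel" unfolding F_def by measurable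
  define w where "w r = real k * r ^ (k - 1) * indicator {..1} r" for r :: real
  have [measurable]: "w \<in> borel_measurable borel" unfolding w_def by measurable
  define W :: "real \<Rightarrow> real" where "W a = (if a \<le> 1 then 1 - a ^ k else 0)" for a
  have Fle: "\<bar>F x\<bar> \<le> 1" for x unfolding F_def by (rule abs_mon_le) (cases "x = 0", auto)
  have dk: "Suc 0 < DIM('a) + k" using DIM_positive[where 'a='a] \<open>k \<noteq> 0\<close> by linarith
  have *: "indicator {0<..} r * w r * r ^ (DIM('a) + 0) =
     indicator {0..1} r * (real k / real (DIM('a) + k) * real (DIM('a) + k) * r ^ (DIM('a) + k - 1))" for r
  proof (cases "r = 0")
    case False
    have "DIM('a) + k - 1 = (k - 1) + DIM('a)" using \<open>k \<noteq> 0\<close> by simp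
    then have "r ^ (DIM('a) + k - 1) = r ^ (k - 1) * r ^ DIM('a)" by (simp add: power_add)
    then show ?thesis using False by (auto simp: w_def indicator_def)
  qed (use \<open>k \<noteq> 0\<close> dk in \<open>auto simp: w_def indicator_def\<close>)
  have K: "(LINT r|lborel. indicator {0<..} r * w r * r ^ (DIM('a) + 0)) = real k / real (DIM('a) + k)"
    unfolding * by (subst lint_power_FTC) (use \<open>k \<noteq> 0\<close> in auto)
  have "(LINT x|lborel. F x * W (norm x)) =
     (LINT r|lborel. indicator {0<..} r * w r * r ^ (DIM('a) + 0)) *
     (LINT x|lborel. indicator (ball 0 1 - {0}) x * F x)"
  proof (rule layer_cake_homogeneous)
    show "\<bar>F x\<bar> \<le> 1" for x by (rule Fle)
    show "F (r *\<^sub>R x) = r ^ 0 * F x" if "r > 0" for r x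
      using that by (simp add: F_def field_simps)
    show "(LINT r|lborel. indicator {a<..} r * w r) = W a" if "a > 0" for a
    proof (cases "a \<le> 1")
      case True
      have "(LINT r|lborel. indicator {a<..} r * w r) = (LINT r|lborel. indicator {a..1} r * (1 * real k * r ^ (k - 1)))"
        by (intro integral_cong_AE eventually_mono[OF AE_lborel_singleton[of a]])
          (auto simp: indicator_def w_def)
      then show ?thesis using lint_power_FTC[OF True, of 1 k] True by (simp add: W_def)
    next
      case False
      then have "(\<lambda>r. indicator {a<..} r * w r) = (\<lambda>_. 0)" by (auto simp: w_def indicator_def fun_eq_iff)
      then show ?thesis using False by (simp add: W_def)
    qed
    \<comment> \<open>A non-integrable function has Bochner integral 0, so the nonzero value in
      \<open>K\<close> already certifies integrability.\<close>
    show "integrable lborel (\<lambda>r. indicator {0<..} r * w r * r ^ (DIM('a) + 0))"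
      using K \<open>k \<noteq> 0\<close> not_integrable_integral_eq by fastforce
  qed (auto simp: w_def)
  also have "(LINT x|lborel. F x * W (norm x)) =
      (LINT x|lborel. indicator (ball 0 1 - {0}) x * F x - indicator (ball 0 1 - {0}) x * mon \<alpha> x)"
  proof (intro integral_cong_AE)
    have e: "F x * W (norm x) = indicator (ball 0 1 - {0}) x * F x - indicator (ball 0 1 - {0}) x * mon \<alpha> x"
      if "x \<noteq> 0" for x
    proof -
      have m: "mon \<alpha> x = norm x ^ k * F x"
        using mon_scale[of \<alpha> "norm x" "x /\<^sub>R norm x"] that k by (simp add: F_def)
      show ?thesis using that unfolding m W_def
        by (auto simp: indicator_def algebra_simps)
    qed
    show "AE x in lborel. F x * W (norm x) = indicator (ball 0 1 - {0}) x * F x - indicator (ball 0 1 - {0}) x * mon \<alpha> x"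
      by (rule eventually_mono[OF AE_lborel_singleton[of 0] e])
  qed (auto simp: W_def)
  also have "\<dots> = (LINT x|lborel. indicator (ball 0 1 - {0}) x * F x) - (LINT x|lborel. indicator (ball 0 1 - {0}) x * mon \<alpha> x)"
  proof (intro Bochner_Integration.integral_diff)
    have *: "integrable lborel (\<lambda>x. indicator (ball 0 1 - {0}) x * f x)"
      if [measurable]: "f \<in> borel_measurable borel" and "\<And>x. norm x < 1 \<Longrightarrow> \<bar>f x\<bar> \<le> 1" for f :: "'a \<Rightarrow> real"
    proof (rule Bochner_Integration.integrable_bound)
      show "integrable lborel (indicat_real (ball (0::'a) 1))"
        by (intro integrable_real_indicator) (auto simp: emeasure_ball)
    qed (use that in \<open>auto simp: indicator_def intro!: AE_I2\<close>)
    show "integrable lborel (\<lambda>x. indicator (ball 0 1 - {0}) x * F x)"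
      "integrable lborel (\<lambda>x. indicator (ball 0 1 - {0}) x * mon \<alpha> x)"
      by (rule *; use Fle in \<open>simp add: less_imp_le abs_mon_le\<close>)+
  qed
  finally have "real DIM('a) * (LINT x|lborel. indicator (ball 0 1 - {0}) x * F x)
      = (real DIM('a) + real k) * (LINT x|lborel. indicator (ball 0 1 - {0}) x * mon \<alpha> x)"
    using dk unfolding K by (simp add: field_simps)
  then show ?thesis
    by (simp add: sph_int_eq F_def)
qed

text \<open>The radial part of the Gaussian integral depends on the degree only, so spherical and
  Gaussian moments of all monomials of degree k are proportional with one constant. Later uses rely
  on its positivity, not on its value.\<close>

lemma sph_int_mon:
  "\<exists>C>0. \<forall>\<alpha>::'a::euclidean_space \<Rightarrow> nat. (\<Sum>b\<in>Basis. \<alpha> b) = k \<longrightarrow> sph_int (mon \<alpha>) = C * (\<Prod>b\<in>Basis. gmom (\<alpha> b))"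
proof -
  define K :: real where "K = (LINT r|lborel. indicator {0<..} r * (r * exp (- r\<^sup>2 / 2)) * r ^ (DIM('a) + k))"
  have K: "K > 0" unfolding K_def by (rule gauss_radial)
  show ?thesis
  proof (intro exI[of _ "(real DIM('a) + real k) * sqrt (2 * pi) ^ DIM('a) / K"] conjI allI impI)
    fix \<alpha> :: "'a \<Rightarrow> nat" assume k: "(\<Sum>b\<in>Basis. \<alpha> b) = k"
    have "(LINT x|lborel. mon \<alpha> x * exp (- (norm x)\<^sup>2 / 2)) =
      K * (LINT x|lborel. indicator (ball 0 1 - {0}) x * mon \<alpha> x)"
      unfolding K_def
      by (rule layer_cake_homogeneous[where C = 1])
        (use lint_gauss_tail gauss_radial in \<open>auto intro!: abs_mon_le simp: mon_scale k\<close>)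
    then have "(LINT x|lborel. indicator (ball 0 1 - {0}) x * mon \<alpha> x) = sqrt (2 * pi) ^ DIM('a) * (\<Prod>b\<in>Basis. gmom (\<alpha> b)) / K"
      using K unfolding gaussian_mon by (simp add: field_simps)
    then show "sph_int (mon \<alpha>) = (real DIM('a) + real k) * sqrt (2 * pi) ^ DIM('a) / K * (\<Prod>b\<in>Basis. gmom (\<alpha> b))"
      unfolding ball_mon_radial[OF k] by simp
  qed (use K in \<open>auto intro!: divide_pos_pos mult_pos_pos add_pos_nonneg\<close>)
qed

section \<open>Homogeneous harmonic polynomials\<close>

text \<open>The second derivative of a monomial in direction b. Truncated subtraction does no harm:
  for the exponents 0 and 1 the numerical factor is zero.\<close>

definition mon_dd :: "'a \<Rightarrow> ('a \<Rightarrow> nat) \<Rightarrow> 'a::euclidean_space \<Rightarrow> real" where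
  "mon_dd b \<alpha> x = real (\<alpha> b) * real (\<alpha> b - 1) * mon (\<alpha>(b := \<alpha> b - 2)) x"

lemma mon_split:
  assumes "b \<in> Basis"
  shows "mon \<alpha> x = (x \<bullet> b) ^ \<alpha> b * (\<Prod>b'\<in>Basis - {b}. (x \<bullet> b') ^ \<alpha> b')"
  unfolding mon_def using assms by (simp add: prod.remove)

lemma mon_line:
  assumes "b \<in> Basis"
  shows "mon \<alpha> (x + t *\<^sub>R b) = (x \<bullet> b + t) ^ \<alpha> b * (\<Prod>b'\<in>Basis - {b}. (x \<bullet> b') ^ \<alpha> b')"
proof -
  have "((x + t *\<^sub>R b) \<bullet> b') ^ \<alpha> b' = (x \<bullet> b') ^ \<alpha> b'" if "b' \<in> Basis - {b}" for b'
    using that assms by (auto simp: inner_simps inner_Basis)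
  then show ?thesis
    using assms unfolding mon_split[OF assms, of \<alpha>] by (simp add: inner_simps)
qed

lemma deriv2_sum_mon:
  fixes x b :: "'a::euclidean_space"
  assumes b: "b \<in> Basis"
  shows "deriv (deriv (\<lambda>t. \<Sum>\<alpha>\<in>A. c \<alpha> * mon \<alpha> (x + t *\<^sub>R b))) 0 = (\<Sum>\<alpha>\<in>A. c \<alpha> * mon_dd b \<alpha> x)"
proof -
  define R where "R \<alpha> = (\<Prod>b'\<in>Basis - {b}. (x \<bullet> b') ^ \<alpha> b')" for \<alpha> :: "'a \<Rightarrow> nat"
  have "deriv (\<lambda>t. \<Sum>\<alpha>\<in>A. c \<alpha> * mon \<alpha> (x + t *\<^sub>R b)) =
      (\<lambda>t. \<Sum>\<alpha>\<in>A. c \<alpha> * (real (\<alpha> b) * (x \<bullet> b + t) ^ (\<alpha> b - 1) * R \<alpha>))"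
  proof
    fix t
    show "deriv (\<lambda>t. \<Sum>\<alpha>\<in>A. c \<alpha> * mon \<alpha> (x + t *\<^sub>R b)) t =
        (\<Sum>\<alpha>\<in>A. c \<alpha> * (real (\<alpha> b) * (x \<bullet> b + t) ^ (\<alpha> b - 1) * R \<alpha>))"
      unfolding mon_line[OF b] R_def[symmetric]
      by (rule DERIV_imp_deriv) (auto intro!: derivative_eq_intros sum.cong)
  qed
  moreover have "deriv (\<lambda>t. \<Sum>\<alpha>\<in>A. c \<alpha> * (real (\<alpha> b) * (x \<bullet> b + t) ^ (\<alpha> b - 1) * R \<alpha>)) 0 =
      (\<Sum>\<alpha>\<in>A. c \<alpha> * (real (\<alpha> b) * (real (\<alpha> b - 1) * (x \<bullet> b) ^ (\<alpha> b - 1 - 1)) * R \<alpha>))"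
    by (rule DERIV_imp_deriv) (auto intro!: derivative_eq_intros sum.cong)
  moreover have "mon (\<alpha>(b := \<alpha> b - 2)) x = (x \<bullet> b) ^ (\<alpha> b - 2) * R \<alpha>" for \<alpha>
    unfolding mon_split[OF b] R_def by simp
  ultimately show ?thesis
    by (simp add: mon_dd_def mult_ac numeral_2_eq_2)
qed

text \<open>Trades the iterated \<open>deriv\<close> for explicit monomials with the same index set
  and coefficients, so that the Laplace equation becomes an identity that can be integrated
  termwise.\<close>

lemma hom_harm_poly_iff:
  "hom_harm_poly l (f :: 'a::euclidean_space \<Rightarrow> real) \<longleftrightarrow>
    (\<exists>A c. finite A \<and> (\<forall>\<alpha>\<in>A. (\<Sum>b\<in>Basis. \<alpha> b) = l) \<and> f = (\<lambda>x. \<Sum>\<alpha>\<in>A. c \<alpha> * mon \<alpha> x) \<and>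
       (\<forall>x. (\<Sum>b\<in>Basis. \<Sum>\<alpha>\<in>A. c \<alpha> * mon_dd b \<alpha> x) = 0))" (is "_ \<longleftrightarrow> ?R")
proof -
  have *: "(\<Sum>b\<in>Basis. deriv (deriv (\<lambda>t. f (x + t *\<^sub>R b))) 0) = (\<Sum>b\<in>Basis. \<Sum>\<alpha>\<in>A. c \<alpha> * mon_dd b \<alpha> x)"
    if "f = (\<lambda>x. \<Sum>\<alpha>\<in>A. c \<alpha> * mon \<alpha> x)" for A c x
    unfolding that by (intro sum.cong refl deriv2_sum_mon)
  show ?thesis
  proof
    assume "hom_harm_poly l f"
    then obtain A c where "finite A" "\<forall>\<alpha>\<in>A. (\<Sum>b\<in>Basis. \<alpha> b) = l" and f: "f = (\<lambda>x. \<Sum>\<alpha>\<in>A. c \<alpha> * mon \<alpha> x)"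
      and "\<And>x. (\<Sum>b\<in>Basis. deriv (deriv (\<lambda>t. f (x + t *\<^sub>R b))) 0) = 0"
      unfolding hom_harm_poly_def mon_def[symmetric] by blast
    then show "?R" unfolding *[OF f] by blast
  next
    assume ?R
    then obtain A c where A: "finite A" "\<forall>\<alpha>\<in>A. (\<Sum>b\<in>Basis. \<alpha> b) = l" and f: "f = (\<lambda>x. \<Sum>\<alpha>\<in>A. c \<alpha> * mon \<alpha> x)"
      and L: "\<And>x. (\<Sum>b\<in>Basis. \<Sum>\<alpha>\<in>A. c \<alpha> * mon_dd b \<alpha> x) = 0"
      by blast
    show "hom_harm_poly l f"
      unfolding hom_harm_poly_def mon_def[symmetric] *[OF f] L
      using A f by blast
  qed
qed

lemma hom_harm_poly_lincomb:
  assumes "hom_harm_poly l f" "hom_harm_poly l g"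
  shows "hom_harm_poly l (\<lambda>x::'a::euclidean_space. r * f x + g x)"
proof -
  obtain A c where A: "finite A" "\<forall>\<alpha>\<in>A. (\<Sum>b\<in>Basis. \<alpha> b) = l" "f = (\<lambda>x. \<Sum>\<alpha>\<in>A. c \<alpha> * mon \<alpha> x)"
      "\<forall>x. (\<Sum>b\<in>Basis. \<Sum>\<alpha>\<in>A. c \<alpha> * mon_dd b \<alpha> x) = 0"
    using assms(1) unfolding hom_harm_poly_iff by blast
  obtain B e where B: "finite B" "\<forall>\<alpha>\<in>B. (\<Sum>b\<in>Basis. \<alpha> b) = l" "g = (\<lambda>x. \<Sum>\<alpha>\<in>B. e \<alpha> * mon \<alpha> x)"
      "\<forall>x. (\<Sum>b\<in>Basis. \<Sum>\<alpha>\<in>B. e \<alpha> * mon_dd b \<alpha> x) = 0"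
    using assms(2) unfolding hom_harm_poly_iff by blast
  define d where "d \<alpha> = r * (if \<alpha> \<in> A then c \<alpha> else 0) + (if \<alpha> \<in> B then e \<alpha> else 0)" for \<alpha>
  have d: "(\<Sum>\<alpha>\<in>A \<union> B. d \<alpha> * h \<alpha>) = r * (\<Sum>\<alpha>\<in>A. c \<alpha> * h \<alpha>) + (\<Sum>\<alpha>\<in>B. e \<alpha> * h \<alpha>)" for h
  proof -
    have "(\<Sum>\<alpha>\<in>A \<union> B. d \<alpha> * h \<alpha>) =
      (\<Sum>\<alpha>\<in>A \<union> B. r * (if \<alpha> \<in> A then c \<alpha> * h \<alpha> else 0)) + (\<Sum>\<alpha>\<in>A \<union> B. if \<alpha> \<in> B then e \<alpha> * h \<alpha> else 0)"
      unfolding d_def sum.distrib[symmetric] by (intro sum.cong) (auto simp: algebra_simps)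
    also have "\<dots> = r * (\<Sum>\<alpha>\<in>A. c \<alpha> * h \<alpha>) + (\<Sum>\<alpha>\<in>B. e \<alpha> * h \<alpha>)"
      using A(1) B(1) by (simp add: sum_distrib_left[symmetric] sum.If_cases Int_absorb1)
    finally show ?thesis .
  qed
  show ?thesis
    unfolding hom_harm_poly_iff
  proof (intro exI[of _ "A \<union> B"] exI[of _ d] conjI allI)
    fix x
    show "(\<Sum>b\<in>Basis. \<Sum>\<alpha>\<in>A \<union> B. d \<alpha> * mon_dd b \<alpha> x) = 0"
      unfolding d sum.distrib sum_distrib_left[symmetric] using A(4) B(4) by simp
  qed (use A B in \<open>auto simp: d fun_eq_iff\<close>)
qed

lemma hom_harm_poly_zero: "hom_harm_poly l (\<lambda>_. 0)"
  unfolding hom_harm_poly_iff by (rule exI[of _ "{}"]) auto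

lemma hom_harm_poly_cmult: "hom_harm_poly l f \<Longrightarrow> hom_harm_poly l (\<lambda>x. r * f x)"
  using hom_harm_poly_lincomb[OF _ hom_harm_poly_zero, of l f r] by simp

lemma hom_harm_poly_add: "hom_harm_poly l f \<Longrightarrow> hom_harm_poly l g \<Longrightarrow> hom_harm_poly l (\<lambda>x. f x + g x)"
  using hom_harm_poly_lincomb[of l f g 1] by simp

lemma hom_harm_poly_diff: "hom_harm_poly l f \<Longrightarrow> hom_harm_poly l g \<Longrightarrow> hom_harm_poly l (\<lambda>x. f x - g x)"
  using hom_harm_poly_lincomb[of l g f "-1"] by simp

lemma hom_harm_poly_sum:
  "(\<And>i. i \<in> I \<Longrightarrow> hom_harm_poly l (f i)) \<Longrightarrow> hom_harm_poly l (\<lambda>x. \<Sum>i\<in>I. f i x)"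
  by (induction I rule: infinite_finite_induct) (auto intro: hom_harm_poly_add hom_harm_poly_zero)

lemma continuous_hom_harm_poly: "hom_harm_poly l f \<Longrightarrow> continuous_on UNIV f"
  unfolding hom_harm_poly_iff by (auto intro!: continuous_intros)

lemma sph_bdd_hom_harm_poly: "hom_harm_poly l f \<Longrightarrow> sph_bdd f"
  by (intro continuous_sph_bdd continuous_hom_harm_poly)

lemma hom_harm_poly_scale:
  assumes "hom_harm_poly l f"
  shows "f (r *\<^sub>R x) = r ^ l * f x"
proof -
  obtain A c where "\<forall>\<alpha>\<in>A. (\<Sum>b\<in>Basis. \<alpha> b) = l" "f = (\<lambda>x. \<Sum>\<alpha>\<in>A. c \<alpha> * mon \<alpha> x)"
    using assms unfolding hom_harm_poly_iff by blast
  then show ?thesis by (auto simp: sum_distrib_left mon_scale intro!: sum.cong)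
qed

text \<open>All second coordinate derivatives of a multilinear monomial vanish. These monomials
  supply every explicit nonzero harmonic used below: constants, linear functions and the test
  function.\<close>

lemma hom_harm_poly_mon:
  assumes "\<And>b. b \<in> Basis \<Longrightarrow> \<beta> b \<le> 1"
  shows "hom_harm_poly (\<Sum>b\<in>Basis. \<beta> b) (mon \<beta> :: 'a::euclidean_space \<Rightarrow> real)"
  unfolding hom_harm_poly_iff
  by (rule exI[of _ "{\<beta>}"], rule exI[of _ "\<lambda>_. 1"]) (use assms in \<open>auto simp: mon_dd_def intro!: sum.neutral\<close>)

lemma mon_mult: "mon \<alpha> x * mon \<beta> x = mon (\<lambda>b. \<alpha> b + \<beta> b) x"
  by (simp add: mon_def power_add prod.distrib)

text \<open>Under the Gaussian, t^b times the second derivative of t^a has the integral of (a - b)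
  t^(a+b). For b \<ge> 2 a further term with factor b(b-1) would appear, hence the restriction to
  multilinear \<beta> in the orthogonality lemma.\<close>

lemma gmom_shift:
  assumes "b \<le> (1::nat)"
  shows "real a * real (a - 1) * gmom (a - 2 + b) = (real a - real b) * gmom (a + b)"
proof (cases "a \<ge> 2")
  case True
  then obtain k where a: "a = Suc (Suc k)" by (metis Suc_le_D Suc_le_mono numeral_2_eq_2)
  from assms consider "b = 0" | "b = 1" by linarith
  then show ?thesis by cases (auto simp: a gmom_Suc_Suc algebra_simps)
next
  case False
  then have "a = 0 \<or> a = 1" by linarith
  moreover from assms have "b = 0 \<or> b = 1" by linarith
  ultimately show ?thesis by (elim disjE) (simp_all add: gmom_1)
qed

text \<open>Multiplying the Laplace equation of \<open>f\<close> by the multilinear monomial \<open>x\<^sup>\<beta>\<close> and integrating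
  gives \<open>(l - |\<beta>|) \<integral> f x\<^sup>\<beta> = 0\<close>, by the two-step recursion of the Gaussian moments.\<close>
lemma hom_harm_poly_orth_mon:
  fixes f :: "'a::euclidean_space \<Rightarrow> real"
  assumes f: "hom_harm_poly l f" and \<beta>: "\<And>b. b \<in> Basis \<Longrightarrow> \<beta> b \<le> 1" and ne: "(\<Sum>b\<in>Basis. \<beta> b) \<noteq> l"
  shows "sph_int (\<lambda>x. f x * mon \<beta> x) = 0"
proof -
  define m where "m = (\<Sum>b\<in>Basis. \<beta> b)"
  obtain A c where A: "finite A" "\<forall>\<alpha>\<in>A. (\<Sum>b\<in>Basis. \<alpha> b) = l" "f = (\<lambda>x. \<Sum>\<alpha>\<in>A. c \<alpha> * mon \<alpha> x)"
      "\<forall>x. (\<Sum>b\<in>Basis. \<Sum>\<alpha>\<in>A. c \<alpha> * mon_dd b \<alpha> x) = 0"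
    using f unfolding hom_harm_poly_iff by blast
  obtain C where C: "C > 0" "\<And>\<alpha>::'a \<Rightarrow> nat. (\<Sum>b\<in>Basis. \<alpha> b) = l + m \<Longrightarrow> sph_int (mon \<alpha>) = C * (\<Prod>b\<in>Basis. gmom (\<alpha> b))"
    using sph_int_mon by blast
  obtain C' where C': "C' > 0" "\<And>\<alpha>::'a \<Rightarrow> nat. (\<Sum>b\<in>Basis. \<alpha> b) = l + m - 2 \<Longrightarrow> sph_int (mon \<alpha>) = C' * (\<Prod>b\<in>Basis. gmom (\<alpha> b))"
    using sph_int_mon by blast
  define P where "P \<alpha> = (\<Prod>b\<in>Basis. gmom (\<alpha> b + \<beta> b))" for \<alpha>
  have dd: "sph_int (\<lambda>x. mon_dd b \<alpha> x * mon \<beta> x) = C' * ((real (\<alpha> b) - real (\<beta> b)) * P \<alpha>)"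
    if b: "b \<in> Basis" and \<alpha>: "\<alpha> \<in> A" for b \<alpha>
  proof -
    define \<gamma> where "\<gamma> b' = (\<alpha>(b := \<alpha> b - 2)) b' + \<beta> b'" for b'
    have "(\<Prod>b'\<in>Basis. gmom (\<gamma> b')) = gmom (\<alpha> b - 2 + \<beta> b) * (\<Prod>b'\<in>Basis - {b}. gmom (\<alpha> b' + \<beta> b'))"
      using b by (subst prod.remove[of _ b]) (auto simp: \<gamma>_def)
    moreover have "P \<alpha> = gmom (\<alpha> b + \<beta> b) * (\<Prod>b'\<in>Basis - {b}. gmom (\<alpha> b' + \<beta> b'))"
      unfolding P_def using b by (subst prod.remove[of _ b]) auto
    ultimately have e: "real (\<alpha> b) * real (\<alpha> b - 1) * (\<Prod>b'\<in>Basis. gmom (\<gamma> b')) = (real (\<alpha> b) - real (\<beta> b)) * P \<alpha>"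
      using gmom_shift[OF \<beta>[OF b], of "\<alpha> b"] by simp
    have "sph_int (\<lambda>x. mon_dd b \<alpha> x * mon \<beta> x) = real (\<alpha> b) * real (\<alpha> b - 1) * sph_int (mon \<gamma>)"
      unfolding mon_dd_def mult.assoc mon_mult sph_int_cmult \<gamma>_def ..
    also have "\<dots> = C' * (real (\<alpha> b) * real (\<alpha> b - 1) * (\<Prod>b'\<in>Basis. gmom (\<gamma> b')))"
    \<comment> \<open>\<open>C'\<close> belongs to degree l + m - 2, which is the degree of
      \<open>\<gamma>\<close> only if \<alpha> b \<ge> 2; otherwise both sides vanish through the
      factor in front.\<close>
    proof (cases "\<alpha> b \<ge> 2")
      case True
      have "(\<Sum>b'\<in>Basis. \<gamma> b') = l + m - 2"
      proof -
        have "(\<Sum>b'\<in>Basis. \<gamma> b') = (\<Sum>b'\<in>Basis. (\<alpha>(b := \<alpha> b - 2)) b') + m"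
          unfolding \<gamma>_def m_def by (simp add: sum.distrib)
        moreover have "(\<Sum>b'\<in>Basis. (\<alpha>(b := \<alpha> b - 2)) b') = \<alpha> b - 2 + (\<Sum>b'\<in>Basis - {b}. \<alpha> b')"
          using b by (subst sum.remove[of _ b]) auto
        moreover have "(\<Sum>b'\<in>Basis. \<alpha> b') = \<alpha> b + (\<Sum>b'\<in>Basis - {b}. \<alpha> b')"
          using b by (subst sum.remove[of _ b]) auto
        moreover have "(\<Sum>b'\<in>Basis. \<alpha> b') = l" using A \<alpha> by auto
        ultimately show ?thesis using True by linarith
      qed
      from C'(2)[OF this] show ?thesis by simp
    next
      case False
      then have "\<alpha> b = 0 \<or> \<alpha> b = 1" by auto
      then show ?thesis by auto
    qed
    finally show ?thesis unfolding e .
  qed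
  have "0 = sph_int (\<lambda>x. (\<Sum>b\<in>Basis. \<Sum>\<alpha>\<in>A. c \<alpha> * mon_dd b \<alpha> x) * mon \<beta> x)"
    using A(4) by (simp add: sph_int_def)
  also have "\<dots> = sph_int (\<lambda>x. \<Sum>b\<in>Basis. \<Sum>\<alpha>\<in>A. c \<alpha> * (mon_dd b \<alpha> x * mon \<beta> x))"
    by (simp add: sum_distrib_right mult.assoc)
  also have "\<dots> = (\<Sum>b\<in>Basis. \<Sum>\<alpha>\<in>A. c \<alpha> * sph_int (\<lambda>x. mon_dd b \<alpha> x * mon \<beta> x))"
  proof -
    have *: "sph_bdd (\<lambda>x. c \<alpha> * (mon_dd b \<alpha> x * mon \<beta> x))" for b \<alpha>
      unfolding mon_dd_def by (intro sph_bdd_mult sph_bdd_const sph_bdd_mon)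
    show ?thesis
      by (subst sph_int_sum sph_int_sum, intro sph_bdd_sum *, intro sum.cong refl, subst sph_int_sum)
        (auto intro!: * simp: sph_int_cmult)
  qed
  also have "\<dots> = (\<Sum>b\<in>Basis. \<Sum>\<alpha>\<in>A. c \<alpha> * (C' * ((real (\<alpha> b) - real (\<beta> b)) * P \<alpha>)))"
    by (intro sum.cong refl) (simp add: dd)
  also have "\<dots> = (\<Sum>\<alpha>\<in>A. C' * (c \<alpha> * P \<alpha>) * (\<Sum>b\<in>Basis. real (\<alpha> b) - real (\<beta> b)))"
    by (subst sum.swap) (simp add: sum_distrib_left mult_ac)
  also have "\<dots> = (\<Sum>\<alpha>\<in>A. C' * (real l - real m) * (c \<alpha> * P \<alpha>))"
  proof (intro sum.cong refl)
    fix \<alpha> assume "\<alpha> \<in> A"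
    then have "(\<Sum>b\<in>Basis. real (\<alpha> b) - real (\<beta> b)) = real l - real m"
      using A(2) unfolding m_def by (auto simp: sum_subtractf of_nat_sum[symmetric] simp del: of_nat_sum)
    then show "C' * (c \<alpha> * P \<alpha>) * (\<Sum>b\<in>Basis. real (\<alpha> b) - real (\<beta> b)) = C' * (real l - real m) * (c \<alpha> * P \<alpha>)"
      by simp
  qed
  also have "\<dots> = C' * (real l - real m) * (\<Sum>\<alpha>\<in>A. c \<alpha> * P \<alpha>)"
    by (simp add: sum_distrib_left)
  finally have S: "(\<Sum>\<alpha>\<in>A. c \<alpha> * P \<alpha>) = 0" using C'(1) ne unfolding m_def[symmetric] by simp
  have "sph_int (\<lambda>x. f x * mon \<beta> x) = sph_int (\<lambda>x. \<Sum>\<alpha>\<in>A. c \<alpha> * mon (\<lambda>b. \<alpha> b + \<beta> b) x)"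
    unfolding A(3) by (simp add: sum_distrib_right mult.assoc mon_mult)
  also have "\<dots> = (\<Sum>\<alpha>\<in>A. c \<alpha> * sph_int (mon (\<lambda>b. \<alpha> b + \<beta> b)))"
    by (subst sph_int_sum) (auto simp: sph_int_cmult)
  also have "\<dots> = (\<Sum>\<alpha>\<in>A. c \<alpha> * (C * P \<alpha>))"
    using A(2) by (intro sum.cong refl) (auto simp: C(2) sum.distrib m_def P_def)
  also have "\<dots> = C * (\<Sum>\<alpha>\<in>A. c \<alpha> * P \<alpha>)" by (simp add: sum_distrib_left mult_ac)
  finally show ?thesis using S by simp
qed

section \<open>Projection onto spherical harmonics\<close>

text \<open>Riesz representation by Gram-Schmidt, by induction over the spanning set. F need not lie
  in V: later V consists of harmonic polynomials and F of monomials. Removing m from F leaves a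
  subspace V'. If V is larger, some v outside V' minus its projection onto V' (the induction
  hypothesis for the functional "integrate against v") is a vector w orthogonal to V', and V is
  spanned by w and V'.\<close>

lemma finite_dim_representation:
  fixes V :: "('a::euclidean_space \<Rightarrow> real) set" and L :: "('a \<Rightarrow> real) \<Rightarrow> real"
  assumes "finite F"
    and "\<forall>f\<in>V. \<forall>g\<in>V. \<forall>r. (\<lambda>x. r * f x + g x) \<in> V"
    and "(\<lambda>_. 0) \<in> V"
    and "\<forall>f\<in>V. \<exists>c. f = (\<lambda>x. \<Sum>\<phi>\<in>F. c \<phi> * \<phi> x)"
    and "\<forall>f\<in>V. sph_bdd f"
    and "\<forall>f\<in>V. sph_int (\<lambda>x. f x * f x) = 0 \<longrightarrow> f = (\<lambda>_. 0)"
    and "\<forall>f\<in>V. \<forall>g\<in>V. \<forall>r. L (\<lambda>x. r * f x + g x) = r * L f + L g"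
  shows "\<exists>f\<in>V. \<forall>g\<in>V. sph_int (\<lambda>x. f x * g x) = L g"
  using assms
proof (induction F arbitrary: V L rule: finite_induct)
  case empty
  have "L (\<lambda>x. 1 * 0 + 0) = 1 * L (\<lambda>_. 0) + L (\<lambda>_. 0)"
    using empty.prems(6)[rule_format, OF empty.prems(2) empty.prems(2), of 1] by simp
  then have "L (\<lambda>_. 0) = 0" by simp
  moreover have "g = (\<lambda>_. 0)" if "g \<in> V" for g
    using bspec[OF empty.prems(3) that] by simp
  ultimately have "sph_int (\<lambda>x. 0 * g x) = L g" if "g \<in> V" for g
    using that by (metis mult_zero_left sph_int_cmult)
  then show ?case using empty.prems(2) by (intro bexI[of _ "\<lambda>_. 0"]) auto
next
  case (insert m F)
  note lin = insert.prems(1)[rule_format] and zero = insert.prems(2) and span = insert.prems(3)[rule_format]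
    and bdd = insert.prems(4)[rule_format] and def = insert.prems(5)[rule_format] and L = insert.prems(6)[rule_format]
  define V' where "V' = {f \<in> V. \<exists>c. f = (\<lambda>x. \<Sum>\<phi>\<in>F. c \<phi> * \<phi> x)}"
  have V'lin: "(\<lambda>x. r * f x + g x) \<in> V'" if "f \<in> V'" "g \<in> V'" for f g r
  proof -
    from that obtain c d where "f = (\<lambda>x. \<Sum>\<phi>\<in>F. c \<phi> * \<phi> x)" "g = (\<lambda>x. \<Sum>\<phi>\<in>F. d \<phi> * \<phi> x)"
      by (auto simp: V'_def)
    then have "(\<lambda>x. r * f x + g x) = (\<lambda>x. \<Sum>\<phi>\<in>F. (r * c \<phi> + d \<phi>) * \<phi> x)"
      by (simp add: sum_distrib_left sum.distrib algebra_simps)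
    moreover have "(\<lambda>x. r * f x + g x) \<in> V" using that by (intro lin) (simp_all add: V'_def)
    ultimately show ?thesis unfolding V'_def mem_Collect_eq
      by (intro conjI exI[of _ "\<lambda>\<phi>. r * c \<phi> + d \<phi>"])
  qed
  have V'zero: "(\<lambda>_. 0) \<in> V'"
    using zero by (auto simp: V'_def intro!: exI[of _ "\<lambda>_. 0"])
  have IH: "\<exists>f\<in>V'. \<forall>g\<in>V'. sph_int (\<lambda>x. f x * g x) = L' g"
    if "\<forall>f\<in>V'. \<forall>g\<in>V'. \<forall>r. L' (\<lambda>x. r * f x + g x) = r * L' f + L' g" for L'
  proof (rule insert.IH)
    show "\<forall>f\<in>V'. \<forall>g\<in>V'. \<forall>r. (\<lambda>x. r * f x + g x) \<in> V'" by (intro ballI allI V'lin)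
    show "\<forall>f\<in>V'. \<exists>c. f = (\<lambda>x. \<Sum>\<phi>\<in>F. c \<phi> * \<phi> x)" by (simp add: V'_def)
    show "\<forall>f\<in>V'. sph_bdd f" using bdd by (simp add: V'_def)
    show "\<forall>f\<in>V'. sph_int (\<lambda>x. f x * f x) = 0 \<longrightarrow> f = (\<lambda>_. 0)" using def by (simp add: V'_def)
  qed (fact V'zero that)+
  show ?case
  proof (cases "V \<subseteq> V'")
    case True
    then have "V' = V" by (auto simp: V'_def)
    have "\<exists>f\<in>V'. \<forall>g\<in>V'. sph_int (\<lambda>x. f x * g x) = L g"
      by (intro IH ballI allI L) (use \<open>V' = V\<close> in auto)
    with \<open>V' = V\<close> show ?thesis by blast
  next
    case False
    then obtain v where v: "v \<in> V" "v \<notin> V'" by auto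
    have ip_lin: "sph_int (\<lambda>x. f x * (r * g x + h x)) = r * sph_int (\<lambda>x. f x * g x) + sph_int (\<lambda>x. f x * h x)"
      if "f \<in> V" "g \<in> V" "h \<in> V" for f g h r
    proof -
      have "sph_int (\<lambda>x. f x * (r * g x + h x)) = sph_int (\<lambda>x. r * (f x * g x) + f x * h x)"
        by (simp add: algebra_simps)
      also have "\<dots> = sph_int (\<lambda>x. r * (f x * g x)) + sph_int (\<lambda>x. f x * h x)"
        by (intro sph_int_add sph_bdd_mult sph_bdd_const bdd that)
      finally show ?thesis by (simp add: sph_int_cmult)
    qed
    have sub: "f \<in> V" if "f \<in> V'" for f using that by (simp add: V'_def)
    have "\<exists>f\<in>V'. \<forall>g\<in>V'. sph_int (\<lambda>x. f x * g x) = sph_int (\<lambda>x. v x * g x)"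
      by (intro IH ballI allI ip_lin sub v(1))
    then obtain v' where v': "v' \<in> V'" "\<And>g. g \<in> V' \<Longrightarrow> sph_int (\<lambda>x. v' x * g x) = sph_int (\<lambda>x. v x * g x)"
      by blast
    have "\<exists>f\<in>V'. \<forall>g\<in>V'. sph_int (\<lambda>x. f x * g x) = L g"
      by (intro IH ballI allI L sub)
    then obtain f' where f': "f' \<in> V'" "\<And>g. g \<in> V' \<Longrightarrow> sph_int (\<lambda>x. f' x * g x) = L g"
      by blast
    define w where "w = (\<lambda>x. (-1) * v' x + v x)"
    have wV: "w \<in> V" unfolding w_def by (rule lin[OF sub[OF v'(1)] v(1)])
    have wV': "w \<notin> V'"
    proof
      assume "w \<in> V'"
      from V'lin[OF v'(1) this, of 1] have "v \<in> V'" by (simp add: w_def)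
      with v show False by simp
    qed
    define W where "W = sph_int (\<lambda>x. w x * w x)"
    have W: "W \<noteq> 0" using def[OF wV] wV' V'zero unfolding W_def by auto
    have wg: "sph_int (\<lambda>x. g x * w x) = 0" if "g \<in> V'" for g
      unfolding w_def using ip_lin[OF sub[OF that] sub[OF v'(1)] v(1), of "-1"] v'(2)[OF that]
      by (simp add: mult.commute)
    obtain c where c: "w = (\<lambda>x. \<Sum>\<phi>\<in>insert m F. c \<phi> * \<phi> x)" using span[OF wV] by blast
    \<comment> \<open>The nonzero coefficient of m in w lets a multiple of w cancel the m-term of
      any g in V, which puts the rest into V'.\<close>
    have cm: "c m \<noteq> 0"
    proof
      assume "c m = 0"
      then have "w = (\<lambda>x. \<Sum>\<phi>\<in>F. c \<phi> * \<phi> x)" using c insert.hyps by simp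
      then have "w \<in> V'" using wV unfolding V'_def mem_Collect_eq by (intro conjI exI[of _ c])
      with wV' show False ..
    qed
    define f where "f = (\<lambda>x. (L w / W) * w x + f' x)"
    show ?thesis
    proof (intro bexI[of _ f] ballI)
      show fV: "f \<in> V" unfolding f_def by (rule lin[OF wV sub[OF f'(1)]])
      fix g assume g: "g \<in> V"
      obtain d where d: "g = (\<lambda>x. \<Sum>\<phi>\<in>insert m F. d \<phi> * \<phi> x)" using span[OF g] by blast
      define t where "t = d m / c m"
      define g' where "g' = (\<lambda>x. (-t) * w x + g x)"
      have "g' = (\<lambda>x. \<Sum>\<phi>\<in>F. (d \<phi> - t * c \<phi>) * \<phi> x)"
      proof
        fix x
        have "g' x = (d m - t * c m) * m x + (\<Sum>\<phi>\<in>F. (d \<phi> - t * c \<phi>) * \<phi> x)"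
          unfolding g'_def c d using insert.hyps
          by (simp add: algebra_simps sum_distrib_left sum_subtractf sum_negf)
        then show "g' x = (\<Sum>\<phi>\<in>F. (d \<phi> - t * c \<phi>) * \<phi> x)" using cm by (simp add: t_def)
      qed
      moreover have "g' \<in> V" unfolding g'_def by (rule lin[OF wV g])
      ultimately have g': "g' \<in> V'"
        unfolding V'_def mem_Collect_eq by (intro conjI exI[of _ "\<lambda>\<phi>. d \<phi> - t * c \<phi>"])
      have geq: "g = (\<lambda>x. t * w x + g' x)" by (simp add: g'_def)
      have "sph_int (\<lambda>x. f x * w x) = L w"
        using ip_lin[OF wV wV sub[OF f'(1)], of "L w / W"] W wg[OF f'(1)]
        by (simp add: f_def W_def[symmetric] mult.commute)
      moreover have "sph_int (\<lambda>x. f x * g' x) = L g'"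
        using ip_lin[OF sub[OF g'] wV sub[OF f'(1)], of "L w / W"] wg[OF g'] f'(2)[OF g']
        by (simp add: f_def mult.commute)
      moreover have "sph_int (\<lambda>x. f x * g x) = t * sph_int (\<lambda>x. f x * w x) + sph_int (\<lambda>x. f x * g' x)"
        unfolding geq by (rule ip_lin[OF fV wV sub[OF g']])
      moreover have "L g = t * L w + L g'" unfolding geq by (rule L[OF wV sub[OF g']])
      ultimately show "sph_int (\<lambda>x. f x * g x) = L g" by simp
    qed
  qed
qed

text \<open>A zero norm gives vanishing on the sphere, and homogeneity spreads it to all x; at the
  origin, f(0) = 0^l f(e) covers l = 0 too. Equality on the whole space is what the definite
  description in \<open>sph_harm_proj\<close> demands.\<close>

lemma hom_harm_poly_eq_zeroI:
  fixes f :: "'a::euclidean_space \<Rightarrow> real"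
  assumes f: "hom_harm_poly l f" and "sph_int (\<lambda>x. f x * f x) = 0"
  shows "f = (\<lambda>_. 0)"
proof
  fix x :: 'a
  have 1: "f y = 0" if "norm y = 1" for y
    using sph_int_eq_0_imp[OF _ _ assms(2) that] continuous_hom_harm_poly[OF f]
    by (auto intro!: continuous_intros)
  obtain e :: 'a where e: "norm e = 1" using vector_choose_size[of 1] by auto
  show "f x = 0"
  proof (cases "x = 0")
    case True
    then show ?thesis using hom_harm_poly_scale[OF f, of 0 e] 1[OF e] by simp
  next
    case False
    then show ?thesis using hom_harm_poly_scale[OF f, of "norm x" "x /\<^sub>R norm x"] 1[of "x /\<^sub>R norm x"] by simp
  qed
qed

text \<open>Multi-indices are functions on the whole type and their values off \<open>Basis\<close>
  are free, so different indices can give the same monomial. Those that vanish off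
  \<open>Basis\<close> are finite in number for bounded entries, and coefficients are collected per
  monomial function, not per index.\<close>

lemma hom_harm_poly_finite_dim:
  "\<exists>F. finite F \<and> (\<forall>f. hom_harm_poly l f \<longrightarrow> (\<exists>c. f = (\<lambda>x::'a::euclidean_space. \<Sum>\<phi>\<in>F. c \<phi> * \<phi> x)))"
proof -
  define I where "I = {\<alpha>::'a \<Rightarrow> nat. \<forall>b. (b \<in> Basis \<longrightarrow> \<alpha> b \<in> {..l}) \<and> (b \<notin> Basis \<longrightarrow> \<alpha> b = 0)}"
  have fin: "finite (mon ` I)" unfolding I_def by (intro finite_imageI finite_set_of_finite_funs) auto
  show ?thesis
  proof (intro exI[of _ "mon ` I"] conjI fin allI impI)
    fix f :: "'a \<Rightarrow> real" assume "hom_harm_poly l f"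
    then obtain A c where A: "finite A" "\<forall>\<alpha>\<in>A. (\<Sum>b\<in>Basis. \<alpha> b) = l" "f = (\<lambda>x. \<Sum>\<alpha>\<in>A. c \<alpha> * mon \<alpha> x)"
      unfolding hom_harm_poly_iff by blast
    have "mon ` A \<subseteq> mon ` I"
    proof
      fix \<phi> :: "'a \<Rightarrow> real" assume "\<phi> \<in> mon ` A"
      then obtain \<alpha> where \<alpha>: "\<alpha> \<in> A" "\<phi> = mon \<alpha>" by auto
      have "mon \<alpha> = mon (\<lambda>b. if b \<in> Basis then \<alpha> b else 0)" by (auto simp: mon_def)
      moreover have "(\<lambda>b. if b \<in> Basis then \<alpha> b else 0) \<in> I"
        using A(2) \<alpha>(1) member_le_sum[of _ Basis \<alpha>] by (fastforce simp: I_def)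
      ultimately show "\<phi> \<in> mon ` I" using \<alpha> by blast
    qed
    then have g: "(\<Sum>\<phi>\<in>mon ` I. \<Sum>\<alpha> | \<alpha> \<in> A \<and> mon \<alpha> = \<phi>. c \<alpha> * mon \<alpha> x) = f x" for x
      unfolding A(3) by (intro sum.group[OF A(1) fin])
    show "\<exists>c. f = (\<lambda>x. \<Sum>\<phi>\<in>mon ` I. c \<phi> * \<phi> x)"
    proof (intro exI[of _ "\<lambda>\<phi>. \<Sum>\<alpha> | \<alpha> \<in> A \<and> mon \<alpha> = \<phi>. c \<alpha>"] ext)
      fix x
      show "f x = (\<Sum>\<phi>\<in>mon ` I. (\<Sum>\<alpha> | \<alpha> \<in> A \<and> mon \<alpha> = \<phi>. c \<alpha>) * \<phi> x)"
        unfolding g[symmetric] sum_distrib_right by (intro sum.cong refl) auto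
    qed
  qed
qed

text \<open>The difference of two candidates is a harmonic polynomial orthogonal to itself. This
  identifies the definite description and is also the means to compute concrete projections.\<close>

lemma sph_harm_proj_eqI:
  assumes v: "sph_bdd v" and f: "hom_harm_poly l f"
    and orth: "\<And>g. hom_harm_poly l g \<Longrightarrow> sph_int (\<lambda>x. (v x - f x) * g x) = 0"
  shows "sph_harm_proj l v = f"
  unfolding sph_harm_proj_def
proof (rule the_equality)
  fix f' assume f': "hom_harm_poly l f' \<and> (\<forall>g. hom_harm_poly l g \<longrightarrow> sph_int (\<lambda>x. (v x - f' x) * g x) = 0)"
  define h where "h = (\<lambda>x. f' x - f x)"
  have h: "hom_harm_poly l h" unfolding h_def using f f' by (intro hom_harm_poly_diff) auto
  note b = v sph_bdd_hom_harm_poly[OF f] sph_bdd_hom_harm_poly[OF h] sph_bdd_hom_harm_poly[OF conjunct1[OF f']]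
  have "sph_int (\<lambda>x. h x * h x) = sph_int (\<lambda>x. (v x - f x) * h x - (v x - f' x) * h x)"
    by (simp add: h_def algebra_simps)
  also have "\<dots> = sph_int (\<lambda>x. (v x - f x) * h x) - sph_int (\<lambda>x. (v x - f' x) * h x)"
    by (intro sph_int_diff sph_bdd_mult sph_bdd_diff b)
  also have "\<dots> = 0" using orth[OF h] f' h by simp
  finally have "h = (\<lambda>_. 0)" by (rule hom_harm_poly_eq_zeroI[OF h])
  then show "f' = f" by (auto simp: h_def fun_eq_iff)
qed (use f orth in auto)

text \<open>Existence is \<open>finite_dim_representation\<close> for the functional that integrates
  against v; the representing harmonic is the projection.\<close>

lemma sph_harm_proj:
  assumes v: "sph_bdd v"
  shows "hom_harm_poly l (sph_harm_proj l v)" (is ?A)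
    and "hom_harm_poly l g \<Longrightarrow> sph_int (\<lambda>x. sph_harm_proj l v x * g x) = sph_int (\<lambda>x. v x * g x)"
proof -
  obtain F where F: "finite F" "\<And>f::'a \<Rightarrow> real. hom_harm_poly l f \<Longrightarrow> \<exists>c. f = (\<lambda>x. \<Sum>\<phi>\<in>F. c \<phi> * \<phi> x)"
    using hom_harm_poly_finite_dim by blast
  have "\<exists>f\<in>Collect (hom_harm_poly l). \<forall>g\<in>Collect (hom_harm_poly l). sph_int (\<lambda>x. f x * g x) = sph_int (\<lambda>x. v x * g x)"
  proof (rule finite_dim_representation[OF F(1)])
    have "sph_int (\<lambda>x. v x * (r * f x + g x)) = r * sph_int (\<lambda>x. v x * f x) + sph_int (\<lambda>x. v x * g x)"
      if "hom_harm_poly l f" "hom_harm_poly l g" for f g :: "'a \<Rightarrow> real" and r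
    proof -
      have b: "sph_bdd f" "sph_bdd g" using that by (auto intro: sph_bdd_hom_harm_poly)
      have "sph_int (\<lambda>x. v x * (r * f x + g x)) = sph_int (\<lambda>x. r * (v x * f x) + v x * g x)"
        by (simp add: algebra_simps)
      also have "\<dots> = sph_int (\<lambda>x. r * (v x * f x)) + sph_int (\<lambda>x. v x * g x)"
        by (intro sph_int_add sph_bdd_mult sph_bdd_const b v)
      finally show ?thesis by (simp add: sph_int_cmult)
    qed
    then show "\<forall>f\<in>Collect (hom_harm_poly l). \<forall>g\<in>Collect (hom_harm_poly l). \<forall>r.
        sph_int (\<lambda>x. v x * (r * f x + g x)) = r * sph_int (\<lambda>x. v x * f x) + sph_int (\<lambda>x. v x * g x)"
      by simp
    show "\<forall>f\<in>Collect (hom_harm_poly l). \<exists>c. f = (\<lambda>x. \<Sum>\<phi>\<in>F. c \<phi> * \<phi> x)" using F(2) by simp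
  qed (auto intro: hom_harm_poly_lincomb hom_harm_poly_zero sph_bdd_hom_harm_poly hom_harm_poly_eq_zeroI)
  then obtain f where f: "hom_harm_poly l f" "\<And>g. hom_harm_poly l g \<Longrightarrow> sph_int (\<lambda>x. f x * g x) = sph_int (\<lambda>x. v x * g x)"
    by auto
  have e: "sph_harm_proj l v = f"
  proof (rule sph_harm_proj_eqI[OF v f(1)])
    fix g :: "'a \<Rightarrow> real" assume g: "hom_harm_poly l g"
    have "sph_int (\<lambda>x. (v x - f x) * g x) = sph_int (\<lambda>x. v x * g x - f x * g x)" by (simp add: algebra_simps)
    also have "\<dots> = sph_int (\<lambda>x. v x * g x) - sph_int (\<lambda>x. f x * g x)"
      by (intro sph_int_diff sph_bdd_mult v sph_bdd_hom_harm_poly[OF g] sph_bdd_hom_harm_poly[OF f(1)])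
    finally show "sph_int (\<lambda>x. (v x - f x) * g x) = 0" using f(2)[OF g] by simp
  qed
  show ?A and "hom_harm_poly l g \<Longrightarrow> sph_int (\<lambda>x. sph_harm_proj l v x * g x) = sph_int (\<lambda>x. v x * g x)"
    unfolding e using f by auto
qed

text \<open>The decomposition u = h + \<rho> is known on the sphere only, so linearity is stated
  with a pointwise equation there.\<close>

lemma sph_harm_proj_diff:
  assumes "sph_bdd u" "sph_bdd h" "sph_bdd \<rho>" and "\<And>x. norm x = 1 \<Longrightarrow> \<rho> x = u x - h x"
  shows "sph_harm_proj l \<rho> = (\<lambda>x. sph_harm_proj l u x - sph_harm_proj l h x)"
proof (rule sph_harm_proj_eqI[OF assms(3)])
  show "hom_harm_poly l (\<lambda>x. sph_harm_proj l u x - sph_harm_proj l h x)"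
    using assms by (intro hom_harm_poly_diff sph_harm_proj)
  fix g :: "'a \<Rightarrow> real" assume g: "hom_harm_poly l g"
  note b = assms(1-3) sph_bdd_hom_harm_poly[OF g] sph_bdd_hom_harm_poly[OF sph_harm_proj(1)[OF assms(1)]]
    sph_bdd_hom_harm_poly[OF sph_harm_proj(1)[OF assms(2)]]
  have "sph_int (\<lambda>x. (\<rho> x - (sph_harm_proj l u x - sph_harm_proj l h x)) * g x) =
    sph_int (\<lambda>x. (u x * g x - sph_harm_proj l u x * g x) - (h x * g x - sph_harm_proj l h x * g x))"
    by (intro sph_int_cong sph_bdd_measurable sph_bdd_mult sph_bdd_diff b) (simp add: assms(4) algebra_simps)
  also have "\<dots> = 0"
  proof -
    have "sph_int (\<lambda>x. v x * g x - sph_harm_proj l v x * g x) = 0" if "sph_bdd v" for v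
      using that sph_bdd_hom_harm_poly[OF sph_harm_proj(1)[OF that]] b sph_harm_proj(2)[OF that g]
      by (subst sph_int_diff) (auto intro!: sph_bdd_mult)
    with assms(1,2) show ?thesis
      by (subst sph_int_diff) (auto intro!: sph_bdd_diff sph_bdd_mult b)
  qed
  finally show "sph_int (\<lambda>x. (\<rho> x - (sph_harm_proj l u x - sph_harm_proj l h x)) * g x) = 0" .
qed

section \<open>Scalar estimates and the symbol of the operator\<close>

lemma powr_le_linear:
  assumes "0 < \<delta>" "\<delta> < 1" "(t::real) < 1"
  shows "(1 - t) powr \<delta> \<le> 1 - \<delta> * t"
  using Youngs_inequality_0[of \<delta> "1 - \<delta>" "1 - t" 1] assms by (simp add: algebra_simps)

text \<open>The upper bound is concavity. For the lower one, (1-t)^\<delta> is (1-t) divided by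
  (1-t)^(1-\<delta>), and concavity bounds that denominator by D; the product (1 - \<delta> t) D
  exceeds 1 - t only by \<delta> (1-\<delta>) t^2, which is at most t^2 D.\<close>

lemma powr_linear_approx:
  assumes \<delta>: "0 < \<delta>" "\<delta> < 1" and t: "\<bar>t::real\<bar> < 1"
  shows "\<bar>(1 - t) powr \<delta> - 1 + \<delta> * t\<bar> \<le> t\<^sup>2"
proof -
  define D where "D = 1 - (1 - \<delta>) * t"
  have "(1 - \<delta>) * t \<le> (1 - \<delta>) * 1" using assms by (intro mult_left_mono) auto
  then have D: "D \<ge> \<delta>" by (simp add: D_def)
  have "(1 - t) powr (1 - \<delta>) \<le> D" using powr_le_linear[of "1 - \<delta>" t] assms by (simp add: D_def)
  moreover have "(1 - t) powr \<delta> * (1 - t) powr (1 - \<delta>) = 1 - t"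
    using t by (simp flip: powr_add)
  ultimately have *: "1 - t \<le> (1 - t) powr \<delta> * D"
    by (metis mult_left_mono powr_ge_zero)
  have "(1 - \<delta> * t - t\<^sup>2) * D = 1 - t + \<delta> * (1 - \<delta>) * t\<^sup>2 - t\<^sup>2 * D"
    unfolding D_def by (simp add: algebra_simps power2_eq_square)
  also have "\<delta> * (1 - \<delta>) * t\<^sup>2 \<le> t\<^sup>2 * D"
  proof -
    have "\<delta> * (1 - \<delta>) \<le> D" using D \<delta> mult_left_le[of "1 - \<delta>" \<delta>] by linarith
    from mult_left_mono[OF this, of "t\<^sup>2"] show ?thesis by (simp add: mult_ac)
  qed
  finally have "(1 - \<delta> * t - t\<^sup>2) * D \<le> (1 - t) powr \<delta> * D" using * by linarith
  then have "1 - \<delta> * t - t\<^sup>2 \<le> (1 - t) powr \<delta>" using D \<delta> by simp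
  moreover have "(1 - t) powr \<delta> \<le> 1 - \<delta> * t" using powr_le_linear[of \<delta> t] assms by simp
  ultimately show ?thesis using zero_le_power2[of t] by linarith
qed

text \<open>For t \<ge> 0 combine (1+t)^\<delta> \<ge> 1 with (1-t)^\<delta> \<le> 1 - \<delta> t;
  the right side is even in t. After averaging over antipodes this controls the first moment of the
  bubbles.\<close>

lemma powr_odd_part:
  assumes \<delta>: "0 < \<delta>" "\<delta> < 1" and t: "\<bar>t::real\<bar> < 1"
  shows "\<delta> * t\<^sup>2 \<le> t * ((1 + t) powr \<delta> - (1 - t) powr \<delta>)"
proof -
  have pos: "\<delta> * t\<^sup>2 \<le> t * ((1 + t) powr \<delta> - (1 - t) powr \<delta>)" if "0 \<le> t" "t < 1" for t
  proof -
    have "1 \<le> (1 + t) powr \<delta>" using that \<delta> by (simp add: ge_one_powr_ge_zero)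
    then have "\<delta> * t \<le> (1 + t) powr \<delta> - (1 - t) powr \<delta>" using powr_le_linear[of \<delta> t] that \<delta> by linarith
    from mult_left_mono[OF this that(1)] show ?thesis by (simp add: power2_eq_square mult_ac)
  qed
  show ?thesis
  proof (cases "t \<ge> 0")
    case True
    then show ?thesis using pos[of t] t by simp
  next
    case False
    then show ?thesis using pos[of "-t"] t by (simp add: algebra_simps)
  qed
qed

lemma powr_even_part:
  assumes \<delta>: "0 < \<delta>" and t: "\<bar>t::real\<bar> < 1"
  shows "1 \<le> (1 + t) powr \<delta> + (1 - t) powr \<delta>"
proof (cases "t \<ge> 0")
  case True
  then have "1 \<le> (1 + t) powr \<delta>" using \<delta> by (simp add: ge_one_powr_ge_zero)
  then show ?thesis using powr_ge_zero[of "1 - t" \<delta>] by linarith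
next
  case False
  then have "1 \<le> (1 - t) powr \<delta>" using \<delta> by (simp add: ge_one_powr_ge_zero)
  then show ?thesis using powr_ge_zero[of "1 + t" \<delta>] by linarith
qed

text \<open>The fourth derivative p(p-1)(p-2)(p-3) (1+t)^(p-4) is nonnegative for p < 0, so the
  cubic Taylor polynomial is a lower bound on all of y > -1 and leaves no remainder to
  control.\<close>

lemma powr_ge_cubic_Taylor:
  fixes p y :: real
  assumes p: "p < 0" and y: "y > -1"
  shows "1 + p * y + p * (p - 1) / 2 * y\<^sup>2 + p * (p - 1) * (p - 2) / 6 * y ^ 3 \<le> (1 + y) powr p"
proof (cases "y = 0")
  case False
  define f where "f m t = (\<Prod>i<m. p - real i) * (1 + t) powr (p - real m)" for m :: nat and t
  have der: "DERIV (f m) t :> f (Suc m) t" if "t > -1" for m t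
  proof -
    have "((\<lambda>t. (1 + t) powr (p - real m)) has_real_derivative (p - real m) * (1 + t) powr (p - real m - of_nat 1) * 1) (at t)"
      using that by (intro DERIV_fun_powr) (auto intro!: derivative_eq_intros)
    from DERIV_cmult[OF this, of "\<Prod>i<m. p - real i"] show ?thesis
      unfolding f_def by (simp add: mult_ac algebra_simps)
  qed
  have "\<exists>t. (if y < 0 then y < t \<and> t < 0 else 0 < t \<and> t < y) \<and>
      (1 + y) powr p = (\<Sum>m<4. f m 0 / fact m * (y - 0) ^ m) + f 4 t / fact 4 * (y - 0) ^ 4"
  proof (rule Taylor[where diff = f and f = "\<lambda>y. (1 + y) powr p" and a = "min y 0" and b = "max y 0"])
    show "\<forall>m t. m < 4 \<and> min y 0 \<le> t \<and> t \<le> max y 0 \<longrightarrow> DERIV (f m) t :> f (Suc m) t"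
      using y by (intro allI impI der) auto
  qed (use False in \<open>auto simp: f_def\<close>)
  then obtain t where t: "if y < 0 then y < t \<and> t < 0 else 0 < t \<and> t < y"
    and e: "(1 + y) powr p = (\<Sum>m<4. f m 0 / fact m * (y - 0) ^ m) + f 4 t / fact 4 * (y - 0) ^ 4"
    by blast
  have "0 \<le> f 4 t / fact 4 * (y - 0) ^ 4"
  proof -
    have "f 4 t = (p * (p - 1)) * ((p - 2) * (p - 3)) * (1 + t) powr (p - 4)"
      unfolding f_def by (simp add: numeral_eq_Suc)
    also have "\<dots> \<ge> 0"
      using p by (intro mult_nonneg_nonneg mult_nonpos_nonpos) auto
    finally have "0 \<le> f 4 t" .
    then show ?thesis by simp
  qed
  moreover have "(\<Sum>m<4. f m 0 / fact m * (y - 0) ^ m) =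
     1 + p * y + p * (p - 1) / 2 * y\<^sup>2 + p * (p - 1) * (p - 2) / 6 * y ^ 3"
    by (simp add: f_def eval_nat_numeral field_simps)
  ultimately show ?thesis unfolding e by linarith
qed simp

text \<open>The left side depends on e^2 only, so its expansion has no cubic term and any \<kappa> >
  0 wins.\<close>

lemma eventually_powr_less_cubic:
  fixes c r \<kappa> :: real
  assumes "\<kappa> > 0"
  shows "eventually (\<lambda>e. (1 + c * e\<^sup>2) powr r < 1 + r * c * e\<^sup>2 + \<kappa> * e ^ 3) (at_right 0)"
proof -
  have "((\<lambda>e. ((1 + c * e\<^sup>2) powr r - 1 - r * c * e\<^sup>2) / e ^ 3) \<longlongrightarrow> 0) (at_right 0)"
    by real_asymp
  then have "eventually (\<lambda>e. ((1 + c * e\<^sup>2) powr r - 1 - r * c * e\<^sup>2) / e ^ 3 < \<kappa>) (at_right 0)"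
    using assms by (rule order_tendstoD)
  moreover have "eventually (\<lambda>e::real. e > 0) (at_right 0)"
    by (simp add: eventually_at_right_less)
  ultimately show ?thesis
  proof eventually_elim
    case (elim e)
    then show ?case by (simp add: field_simps)
  qed
qed

section \<open>Sign, recursion and growth of the symbol; the sharp constant\<close>

context
  fixes s :: real
  assumes dim: "DIM('a::euclidean_space) \<ge> 3" and s: "s - sph_dim TYPE('a) / 2 \<in> {0<..<1}"
begin

lemma sph_dim_ge_2: "sph_dim TYPE('a) \<ge> 2"
  using dim by (simp add: sph_dim_def)

lemma alpha2s_arg_pos: "l \<ge> 1 \<Longrightarrow> 0 < real l + sph_dim TYPE('a) / 2 - s"
  using s by auto

text \<open>For l \<ge> 1 the argument is positive; for l = 0 it lies strictly between -1 and 0 by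
  the range of s. So the exceptional value 0 of \<open>alpha2s\<close> never occurs.\<close>

lemma alpha2s_arg_notin: "real l + sph_dim TYPE('a) / 2 - s \<notin> \<int>\<^sub>\<le>\<^sub>0"
proof (cases "l \<ge> 1")
  case True
  then show ?thesis using alpha2s_arg_pos nonpos_Ints_nonpos by fastforce
next
  case False
  show ?thesis
  proof
    assume "real l + sph_dim TYPE('a) / 2 - s \<in> \<int>\<^sub>\<le>\<^sub>0"
    then obtain k :: int where "sph_dim TYPE('a) / 2 - s = of_int k" using False
      by (elim nonpos_Ints_cases) (simp add: not_le)
    with s have "real_of_int (-1) < of_int k" "real_of_int k < of_int 0" by auto
    then show False unfolding of_int_less_iff by linarith
  qed
qed

lemma alpha2s_eq: "alpha2s TYPE('a) s l =
    Gamma (real l + sph_dim TYPE('a) / 2 + s) / Gamma (real l + sph_dim TYPE('a) / 2 - s)"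
  using alpha2s_arg_notin[of l] by (simp add: alpha2s_def Let_def)

lemma alpha2s_Suc: "alpha2s TYPE('a) s (Suc l) * (real l + sph_dim TYPE('a) / 2 - s) =
    alpha2s TYPE('a) s l * (real l + sph_dim TYPE('a) / 2 + s)"
proof -
  define a where "a = real l + sph_dim TYPE('a) / 2 - s"
  define b where "b = real l + sph_dim TYPE('a) / 2 + s"
  have a: "a \<notin> \<int>\<^sub>\<le>\<^sub>0" unfolding a_def by (rule alpha2s_arg_notin)
  have b: "b > 0" using s sph_dim_ge_2 by (auto simp: b_def)
  then have b': "b \<notin> \<int>\<^sub>\<le>\<^sub>0" using nonpos_Ints_nonpos[of b] by auto
  have "Gamma (a + 1) = a * Gamma a" "Gamma (b + 1) = b * Gamma b"
    using Gamma_plus1 a b' by blast+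
  moreover have "a \<noteq> 0" using a by auto
  moreover have "alpha2s TYPE('a) s (Suc l) = Gamma (b + 1) / Gamma (a + 1)" "alpha2s TYPE('a) s l = Gamma b / Gamma a"
    unfolding alpha2s_eq a_def b_def by (simp_all add: algebra_simps)
  ultimately have "alpha2s TYPE('a) s (Suc l) * a = alpha2s TYPE('a) s l * b"
    using Gamma_eq_zero_iff[of a] a by simp
  then show ?thesis by (simp add: a_def b_def)
qed

lemma alpha2s_pos: "l \<ge> 1 \<Longrightarrow> alpha2s TYPE('a) s l > 0"
  unfolding alpha2s_eq using alpha2s_arg_pos[of l] s sph_dim_ge_2
  by (intro divide_pos_pos Gamma_real_pos) auto

text \<open>In the recursion at l = 0 the factor n/2 - s is negative, while n/2 + s and the symbol
  at degree 1 are positive.\<close>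

lemma alpha2s_0_neg: "alpha2s TYPE('a) s 0 < 0"
proof -
  have "alpha2s TYPE('a) s (Suc 0) * (sph_dim TYPE('a) / 2 - s) = alpha2s TYPE('a) s 0 * (sph_dim TYPE('a) / 2 + s)"
    using alpha2s_Suc[of 0] by simp
  moreover have "alpha2s TYPE('a) s (Suc 0) * (sph_dim TYPE('a) / 2 - s) < 0"
    using alpha2s_pos[of 1] s by (intro mult_pos_neg) auto
  moreover have "sph_dim TYPE('a) / 2 + s > 0" using s sph_dim_ge_2 by auto
  ultimately show ?thesis by (metis mult_neg_pos mult_less_0_iff order_less_asym)
qed

text \<open>Carries the Sobolev summability in \<open>Hs\<close> over to the series for a[\<rho>].
  The quotient X of two \<open>Gamma_series\<close> converges, hence is bounded, and X m is the
  symbol at degree m + 1 up to a constant and the factor m^(2s).\<close>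

lemma alpha2s_bound: "\<exists>K. \<forall>l. \<bar>alpha2s TYPE('a) s l\<bar> \<le> K * (1 + real l) powr (2 * s)"
proof -
  define a where "a = sph_dim TYPE('a) / 2 - s"
  define b where "b = sph_dim TYPE('a) / 2 + s"
  have a: "a \<notin> \<int>\<^sub>\<le>\<^sub>0" using alpha2s_arg_notin[of 0] by (simp add: a_def)
  have b0: "b > 0" and s0: "s > 0" using s sph_dim_ge_2 by (auto simp: b_def)
  then have b: "b \<notin> \<int>\<^sub>\<le>\<^sub>0" using nonpos_Ints_nonpos[of b] by auto
  define X where "X m = Gamma_series a m / Gamma_series b m" for m
  have "X \<longlonglongrightarrow> Gamma a / Gamma b"
    unfolding X_def using Gamma_eq_zero_iff[of b] b by (intro tendsto_divide Gamma_series_LIMSEQ) auto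
  then have "Bseq X" by (intro convergent_imp_Bseq) (auto simp: convergent_def)
  then obtain B where B: "B > 0" "\<And>m. norm (X m) \<le> B" by (auto elim!: BseqE)
  define G where "G = \<bar>Gamma b / Gamma a\<bar>"
  have alpha: "alpha2s TYPE('a) s (Suc m) = Gamma b / Gamma a * X m * exp (2 * s * ln (real m))" for m
  proof -
    have pa: "pochhammer a (Suc m) = Gamma (a + real (Suc m)) / Gamma a"
      and pb: "pochhammer b (Suc m) = Gamma (b + real (Suc m)) / Gamma b"
      using pochhammer_Gamma[OF a, of "Suc m"] pochhammer_Gamma[OF b, of "Suc m"] by simp_all
    have nz: "Gamma (a + real (Suc m)) \<noteq> 0"
      using alpha2s_arg_notin[of "Suc m"] by (simp add: a_def Gamma_eq_zero_iff algebra_simps)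
    have nzb: "Gamma (b + real (Suc m)) > 0" "Gamma b > 0" using b0 by auto
    have nza: "Gamma a \<noteq> 0" using a by (simp add: Gamma_eq_zero_iff)
    have ex: "exp (b * ln (real m)) = exp (a * ln (real m)) * exp (2 * s * ln (real m))"
      by (simp add: a_def b_def algebra_simps flip: exp_add)
    have "alpha2s TYPE('a) s (Suc m) = Gamma (b + real (Suc m)) / Gamma (a + real (Suc m))"
      unfolding alpha2s_eq a_def b_def by (simp add: algebra_simps)
    then show ?thesis
      unfolding X_def Gamma_series_def Suc_eq_plus1[symmetric] pa pb using nz nzb nza
      by (simp add: ex divide_simps)
  qed
  define K where "K = max (\<bar>alpha2s TYPE('a) s 0\<bar>) (G * B)"
  show ?thesis
  proof (intro exI[of _ K] allI)
    fix l
    show "\<bar>alpha2s TYPE('a) s l\<bar> \<le> K * (1 + real l) powr (2 * s)"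
    proof (cases l)
      case (Suc m)
      have "exp (2 * s * ln (real m)) \<le> (1 + real l) powr (2 * s)"
      \<comment> \<open>As ln 0 = 0, the exponential is 1 at m = 0, whereas 0 \<open>powr\<close>
        (2s) would be 0.\<close>
      proof (cases "m = 0")
        case False
        have "exp (2 * s * ln (real m)) = real m powr (2 * s)" using False by (simp add: powr_def)
        also have "\<dots> \<le> (1 + real l) powr (2 * s)" using s0 Suc by (intro powr_mono2) auto
        finally show ?thesis .
      qed (use s0 in \<open>auto intro!: ge_one_powr_ge_zero\<close>)
      moreover have "\<bar>alpha2s TYPE('a) s l\<bar> = G * \<bar>X m\<bar> * exp (2 * s * ln (real m))"
        unfolding Suc alpha G_def by (simp add: abs_mult)
      moreover have "G * \<bar>X m\<bar> \<le> K"
      proof -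
        have "G * \<bar>X m\<bar> \<le> G * B" using B(2)[of m] by (intro mult_left_mono) (auto simp: G_def)
        then show ?thesis by (simp add: K_def)
      qed
      moreover have "0 \<le> K" by (simp add: K_def)
      ultimately show ?thesis by (simp add: mult_mono)
    qed (simp add: K_def)
  qed
qed

lemma sph_area: "sph_int (\<lambda>_::'a. 1) = real DIM('a) * unit_ball_vol (real DIM('a))"
proof -
  have "(LINT x|lborel. indicat_real (ball (0::'a) 1 - {0}) x) = (LINT x|lborel. indicat_real (ball (0::'a) 1) x)"
    by (intro integral_cong_AE eventually_mono[OF AE_lborel_singleton[of 0]]) (auto simp: indicator_def)
  then show ?thesis by (simp add: sph_int_eq content_ball)
qed

lemma sph_area_pos: "sph_int (\<lambda>_::'a. 1) > 0"
  unfolding sph_area using dim by (intro mult_pos_pos) auto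

text \<open>The sharp constant is the quotient of a[u] and the squared p-norm at u = 1. Legendre
  duplication identifies (4 pi)^(n/2) Gamma(n/2) / Gamma(n) with the area of the sphere.\<close>

lemma Sconst_eq: "Sconst TYPE('a) s = alpha2s TYPE('a) s 0 * sph_int (\<lambda>_::'a. 1) powr (2 * s / sph_dim TYPE('a))"
proof -
  define n where "n = sph_dim TYPE('a)"
  have n: "n \<ge> 2" unfolding n_def by (rule sph_dim_ge_2)
  have d: "real DIM('a) = n + 1" by (simp add: n_def sph_dim_def)
  have pos: "Gamma (n / 2) > 0" "Gamma n > 0" "Gamma ((n + 1) / 2) > 0" using n by auto
  have dup: "Gamma (n / 2) * Gamma ((n + 1) / 2) = exp ((1 - n) * ln 2) * sqrt pi * Gamma n"
  proof -
    have "complex_of_real (n / 2) \<notin> \<int>\<^sub>\<le>\<^sub>0" "complex_of_real (n / 2) + 1 / 2 \<notin> \<int>\<^sub>\<le>\<^sub>0"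
      using n by (auto elim!: nonpos_Ints_cases simp: complex_eq_iff)
    from Gamma_legendre_duplication[OF this]
    have "complex_of_real (Gamma (n / 2) * Gamma ((n + 1) / 2)) = complex_of_real (exp ((1 - n) * ln 2) * sqrt pi * Gamma n)"
      by (simp add: Gamma_complex_of_real[symmetric] exp_of_real[symmetric] add_divide_distrib)
    then show ?thesis unfolding of_real_eq_iff .
  qed
  have A: "sph_int (\<lambda>_::'a. 1) = 2 * pi powr ((n + 1) / 2) / Gamma ((n + 1) / 2)"
  proof -
    have G: "Gamma ((n + 1) / 2 + 1) = (n + 1) / 2 * Gamma ((n + 1) / 2)"
      using n by (intro Gamma_plus1) (auto dest!: nonpos_Ints_nonpos)
    then show ?thesis unfolding sph_area unit_ball_vol_def d G using n by simp
  qed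
  have "(4 * pi) powr (n / 2) * (Gamma (n / 2) / Gamma n) = sph_int (\<lambda>_::'a. 1)"
  proof -
    have "(4 * pi) powr (n / 2) = 2 powr n * pi powr (n / 2)"
    proof -
      have "(4::real) powr (n / 2) = (2 powr 2) powr (n / 2)" by simp
      also have "\<dots> = 2 powr n" by (simp only: powr_powr) simp
      finally show ?thesis by (simp add: powr_mult)
    qed
    then have "(4 * pi) powr (n / 2) * (Gamma (n / 2) / Gamma n) =
        (2 powr n * exp ((1 - n) * ln 2)) * (pi powr (n / 2) * sqrt pi) / Gamma ((n + 1) / 2)"
      using dup pos by (simp add: field_simps)
    also have "2 powr n * exp ((1 - n) * ln 2) = (2::real)"
      by (simp add: powr_def algebra_simps flip: exp_add)
    also have "pi powr (n / 2) * sqrt pi = pi powr ((n + 1) / 2)"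
      by (simp add: powr_half_sqrt[symmetric] add_divide_distrib flip: powr_add)
    finally show ?thesis unfolding A .
  qed
  then have "sph_int (\<lambda>_::'a. 1) powr (2 * s / n) = ((4 * pi) powr (n / 2)) powr (2 * s / n) * (Gamma (n / 2) / Gamma n) powr (2 * s / n)"
    by (metis powr_mult powr_ge_zero)
  also have "((4 * pi) powr (n / 2)) powr (2 * s / n) = (4 * pi) powr s"
    using n by (simp add: powr_powr)
  finally show ?thesis
    unfolding alpha2s_eq Sconst_def Let_def n_def[symmetric] by (simp add: add_divide_distrib diff_divide_distrib)
qed

end

section \<open>The test function and the bubbles\<close>

lemma sph_int_even:
  fixes f :: "'a::euclidean_space \<Rightarrow> real"
  assumes [measurable]: "f \<in> borel_measurable borel"
  shows "sph_int (\<lambda>x. f (- x)) = sph_int f"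
proof -
  have e: "lborel = distr lborel borel (\<lambda>x::'a. - x)"
    using lborel_affine[of "-1" "0::'a"] by (simp add: density_1)
  have "(LINT x|lborel. indicator (ball 0 1 - {0}) x * f (x /\<^sub>R norm x)) =
      (LINT x|distr lborel borel (\<lambda>x::'a. - x). indicator (ball 0 1 - {0}) x * f (x /\<^sub>R norm x))"
    by (subst e[symmetric]) (rule refl)
  also have "\<dots> = (LINT x|lborel. indicator (ball 0 1 - {0}) (- x) * f (- x /\<^sub>R norm (- x)))"
    by (subst integral_distr) simp_all
  also have "\<dots> = (LINT x|lborel. indicator (ball 0 1 - {0}) x * f (- (x /\<^sub>R norm x)))"
    by (simp add: indicator_def)
  finally show ?thesis by (subst (1 2) sph_int_eq) simp_all
qed

definition unit_exp :: "'a \<Rightarrow> 'a \<Rightarrow> nat" where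
  "unit_exp b = (\<lambda>b'. if b' = b then 1 else 0)"

lemma mon_unit_exp: "b \<in> Basis \<Longrightarrow> mon (unit_exp b) x = x \<bullet> b"
  by (simp add: mon_split[of b] unit_exp_def)

lemma sum_unit_exp: "b \<in> Basis \<Longrightarrow> (\<Sum>b'\<in>Basis. unit_exp b b') = (1::nat)"
  by (simp add: unit_exp_def)

lemma hom_harm_poly_const: "hom_harm_poly 0 (\<lambda>_::'a::euclidean_space. c)"
proof -
  have "hom_harm_poly 0 (mon (\<lambda>_. 0) :: 'a \<Rightarrow> real)"
    using hom_harm_poly_mon[of "\<lambda>_::'a. 0"] by simp
  from hom_harm_poly_cmult[OF this, of c] show ?thesis by (simp add: mon_def)
qed

lemma hom_harm_poly_0D: "hom_harm_poly 0 f \<Longrightarrow> f x = f 0"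
  by (drule hom_harm_poly_scale[of 0 f 0 x]) simp

lemma hom_harm_poly_linear: "hom_harm_poly 1 (\<lambda>x::'a::euclidean_space. \<zeta> \<bullet> x)"
proof -
  have "hom_harm_poly 1 (\<lambda>x::'a. x \<bullet> b)" if "b \<in> Basis" for b
  proof -
    have "hom_harm_poly (\<Sum>b'\<in>Basis. unit_exp b b') (mon (unit_exp b) :: 'a \<Rightarrow> real)"
      by (rule hom_harm_poly_mon) (simp add: unit_exp_def)
    moreover have "mon (unit_exp b) = (\<lambda>x::'a. x \<bullet> b)" using mon_unit_exp[OF that] by (intro ext)
    ultimately show ?thesis using sum_unit_exp[OF that] by simp
  qed
  then have "hom_harm_poly 1 (\<lambda>x::'a. \<Sum>b\<in>Basis. (\<zeta> \<bullet> b) * (x \<bullet> b))"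
    by (intro hom_harm_poly_sum hom_harm_poly_cmult) auto
  then show ?thesis by (subst euclidean_inner)
qed

lemma sph_int_hom_harm_poly_eq_0: "hom_harm_poly l f \<Longrightarrow> l \<noteq> 0 \<Longrightarrow> sph_int f = 0"
  using hom_harm_poly_orth_mon[of l f "\<lambda>_. 0"] by (simp add: mon_def)

text \<open>A mixed product of two coordinates contains the vanishing first Gaussian moment, so the
  matrix of second moments is a multiple of the identity. The bound of M by the area, from |b
  \<bullet> x| \<le> 1, feeds \<open>distance_arith\<close>.\<close>

lemma sph_int_linear_sq:
  "\<exists>M>0. M \<le> sph_int (\<lambda>_::'a::euclidean_space. 1) \<and> (\<forall>\<zeta>::'a. sph_int (\<lambda>x. (\<zeta> \<bullet> x)\<^sup>2) = (norm \<zeta>)\<^sup>2 * M)"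
proof -
  obtain C where C: "C > 0" "\<And>\<alpha>::'a \<Rightarrow> nat. (\<Sum>b\<in>Basis. \<alpha> b) = 2 \<Longrightarrow> sph_int (mon \<alpha>) = C * (\<Prod>b\<in>Basis. gmom (\<alpha> b))"
    using sph_int_mon by blast
  have e: "sph_int (\<lambda>x. (x \<bullet> b) * (x \<bullet> b')) = (if b = b' then C else 0)" if b: "b \<in> Basis" "b' \<in> Basis" for b b' :: 'a
  proof -
    define \<alpha> where "\<alpha> = (\<lambda>c. unit_exp b c + unit_exp b' c)"
    have "(\<Sum>c\<in>Basis. \<alpha> c) = 2" unfolding \<alpha>_def using b by (simp add: sum.distrib sum_unit_exp)
    then have "sph_int (mon \<alpha>) = C * (\<Prod>c\<in>Basis. gmom (\<alpha> c))" by (rule C)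
    moreover have "mon \<alpha> = (\<lambda>x. (x \<bullet> b) * (x \<bullet> b'))"
      using b by (simp add: \<alpha>_def mon_mult[symmetric] mon_unit_exp fun_eq_iff)
    moreover have "(\<Prod>c\<in>Basis. gmom (\<alpha> c)) = (if b = b' then 1 else 0)"
    proof (cases "b = b'")
      case True
      then have "gmom (\<alpha> c) = 1" for c by (simp add: \<alpha>_def unit_exp_def gmom_0 gmom_2[unfolded numeral_2_eq_2])
      then show ?thesis using True by simp
    next
      case False
      then have "gmom (\<alpha> b) = 0" by (simp add: \<alpha>_def unit_exp_def gmom_1)
      then show ?thesis using False b by (auto intro!: prod_zero)
    qed
    ultimately show ?thesis by simp
  qed
  have sq: "sph_int (\<lambda>x. (\<zeta> \<bullet> x)\<^sup>2) = (norm \<zeta>)\<^sup>2 * C" for \<zeta> :: 'a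
  proof -
    have "(\<zeta> \<bullet> x)\<^sup>2 = (\<Sum>b\<in>Basis. \<Sum>b'\<in>Basis. ((\<zeta> \<bullet> b) * (\<zeta> \<bullet> b')) * ((x \<bullet> b) * (x \<bullet> b')))" for x
      by (subst euclidean_inner) (simp add: power2_eq_square sum_product mult_ac)
    then have "sph_int (\<lambda>x. (\<zeta> \<bullet> x)\<^sup>2) = (\<Sum>b\<in>Basis. \<Sum>b'\<in>Basis. ((\<zeta> \<bullet> b) * (\<zeta> \<bullet> b')) * sph_int (\<lambda>x. (x \<bullet> b) * (x \<bullet> b')))"
      by (simp add: sph_int_sum sph_bdd_sum sph_bdd_mult sph_int_cmult)
    also have "\<dots> = (\<Sum>b\<in>Basis. (\<zeta> \<bullet> b) * (\<zeta> \<bullet> b) * C)"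
      by (intro sum.cong refl) (simp add: e if_distrib cong: if_cong)
    also have "\<dots> = (norm \<zeta>)\<^sup>2 * C"
      by (simp add: power2_norm_eq_inner euclidean_inner[of \<zeta> \<zeta>] sum_distrib_right)
    finally show ?thesis .
  qed
  obtain b :: 'a where b: "b \<in> Basis" using SOME_Basis by blast
  have "C = sph_int (\<lambda>x. (b \<bullet> x)\<^sup>2)" using sq[of b] b by simp
  also have "\<dots> \<le> sph_int (\<lambda>_::'a. 1)"
  proof (rule sph_int_mono)
    fix x :: 'a assume "norm x = 1"
    then have "\<bar>b \<bullet> x\<bar> \<le> 1" using Cauchy_Schwarz_ineq2[of b x] b by simp
    then show "(b \<bullet> x)\<^sup>2 \<le> 1" by (simp add: abs_square_le_1)
  qed (auto intro: sph_bdd_power)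
  finally show ?thesis by (intro exI[of _ C] conjI allI C(1) sq)
qed

text \<open>The cubic moment of this degree-two harmonic is nonzero: in its cube only the monomial
  \<open>(x\<^sub>i x\<^sub>j x\<^sub>k)\<^sup>2\<close> has a nonvanishing integral.\<close>
definition tri_harm :: "'a \<Rightarrow> 'a \<Rightarrow> 'a \<Rightarrow> 'a::euclidean_space \<Rightarrow> real" where
  "tri_harm i j k x = (x \<bullet> i) * (x \<bullet> j) + (x \<bullet> j) * (x \<bullet> k) + (x \<bullet> k) * (x \<bullet> i)"

context
  fixes i j k :: "'a::euclidean_space"
  assumes ijk: "i \<in> Basis" "j \<in> Basis" "k \<in> Basis" "i \<noteq> j" "j \<noteq> k" "i \<noteq> k"
begin

definition tri_exp :: "nat \<Rightarrow> nat \<Rightarrow> nat \<Rightarrow> 'a \<Rightarrow> nat" where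
  "tri_exp p q r = (\<lambda>b. if b = i then p else if b = j then q else if b = k then r else 0)"

lemma Basis_ijk: "(Basis :: 'a set) = insert i (insert j (insert k (Basis - {i, j, k})))"
  using ijk by auto

lemma prod_tri_exp: assumes "g 0 = 1" shows "(\<Prod>b\<in>Basis. g (tri_exp p q r b)) = g p * g q * g r"
proof -
  have "(\<Prod>b\<in>Basis - {i, j, k}. g (tri_exp p q r b)) = 1"
    using assms by (intro prod.neutral) (auto simp: tri_exp_def)
  then show ?thesis using ijk by (subst Basis_ijk) (simp add: tri_exp_def mult_ac)
qed

lemma mon_tri_exp: "mon (tri_exp p q r) x = (x \<bullet> i) ^ p * (x \<bullet> j) ^ q * (x \<bullet> k) ^ r"
proof -
  have "(\<Prod>b\<in>Basis - {i, j, k}. (x \<bullet> b) ^ tri_exp p q r b) = 1"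
    by (intro prod.neutral) (auto simp: tri_exp_def)
  then show ?thesis using ijk unfolding mon_def by (subst Basis_ijk) (simp add: tri_exp_def mult_ac)
qed

lemma sum_tri_exp: "(\<Sum>b\<in>Basis. tri_exp p q r b) = p + q + r"
proof -
  have "(\<Sum>b\<in>Basis - {i, j, k}. tri_exp p q r b) = 0"
    by (intro sum.neutral) (auto simp: tri_exp_def)
  then show ?thesis using ijk by (subst Basis_ijk) (simp add: tri_exp_def)
qed

lemma tri_harm_eq: "tri_harm i j k x = mon (tri_exp 1 1 0) x + mon (tri_exp 0 1 1) x + mon (tri_exp 1 0 1) x"
  by (simp add: tri_harm_def mon_tri_exp mult_ac)

lemma hom_harm_tri: "hom_harm_poly 2 (tri_harm i j k)"
proof -
  have "hom_harm_poly 2 (mon (tri_exp p q r) :: 'a \<Rightarrow> real)" if "p \<le> 1" "q \<le> 1" "r \<le> 1" "p + q + r = 2" for p q r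
    using hom_harm_poly_mon[of "tri_exp p q r"] that by (simp add: sum_tri_exp) (simp add: tri_exp_def)
  then have "hom_harm_poly 2 (\<lambda>x. mon (tri_exp 1 1 0) x + mon (tri_exp 0 1 1) x + mon (tri_exp 1 0 1) x)"
    by (intro hom_harm_poly_add) auto
  then show ?thesis by (simp add: tri_harm_eq[abs_def])
qed

lemma sph_bdd_tri [simp, intro]: "sph_bdd (tri_harm i j k)"
  by (rule sph_bdd_hom_harm_poly[OF hom_harm_tri])

text \<open>The test function is a sum of multilinear monomials, so
  \<open>hom_harm_poly_orth_mon\<close> applies to each of its terms.\<close>

lemma tri_harm_orth:
  assumes f: "hom_harm_poly l f" and l: "l \<noteq> 2"
  shows "sph_int (\<lambda>x. f x * tri_harm i j k x) = 0"
proof -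
  have *: "sph_int (\<lambda>x. f x * mon (tri_exp p q r) x) = 0" if "p \<le> 1" "q \<le> 1" "r \<le> 1" "p + q + r = 2" for p q r
  proof (rule hom_harm_poly_orth_mon[OF f])
    show "tri_exp p q r b \<le> 1" for b using that by (simp add: tri_exp_def)
    show "(\<Sum>b\<in>Basis. tri_exp p q r b) \<noteq> l" using that l by (simp add: sum_tri_exp)
  qed
  have b: "sph_bdd f" by (rule sph_bdd_hom_harm_poly[OF f])
  have "sph_int (\<lambda>x. f x * tri_harm i j k x) =
     sph_int (\<lambda>x. f x * mon (tri_exp 1 1 0) x + f x * mon (tri_exp 0 1 1) x + f x * mon (tri_exp 1 0 1) x)"
    by (simp add: tri_harm_eq algebra_simps)
  also have "\<dots> = 0"
    using b *[of 1 1 0] *[of 0 1 1] *[of 1 0 1] by (simp add: sph_int_add sph_bdd_add sph_bdd_mult)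
  finally show ?thesis .
qed

lemma tri_harm_ij: "tri_harm i j k (i + j) = 1"
  using ijk by (simp add: tri_harm_def inner_simps inner_Basis)

lemma tri_harm_sq_pos: "0 < sph_int (\<lambda>x. (tri_harm i j k x)\<^sup>2)"
proof -
  have "sph_int (\<lambda>x. (tri_harm i j k x)\<^sup>2) \<noteq> 0"
    using hom_harm_poly_eq_zeroI[OF hom_harm_tri] tri_harm_ij by (auto simp: power2_eq_square)
  moreover have "0 \<le> sph_int (\<lambda>x. (tri_harm i j k x)\<^sup>2)"
    by (rule sph_int_nonneg) (auto intro: sph_bdd_power)
  ultimately show ?thesis by simp
qed

lemma tri_harm_cube_pos: "0 < sph_int (\<lambda>x. (tri_harm i j k x) ^ 3)"
proof -
  obtain C where C: "C > 0" "\<And>\<alpha>::'a \<Rightarrow> nat. (\<Sum>b\<in>Basis. \<alpha> b) = 6 \<Longrightarrow> sph_int (mon \<alpha>) = C * (\<Prod>b\<in>Basis. gmom (\<alpha> b))"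
    using sph_int_mon by blast
  have m: "sph_int (mon (tri_exp p q r)) = C * (gmom p * gmom q * gmom r)" if "p + q + r = 6" for p q r
    using that C(2)[of "tri_exp p q r"] by (simp add: sum_tri_exp prod_tri_exp gmom_0)
  have "(tri_harm i j k x) ^ 3 =
      (mon (tri_exp 3 3 0) x + mon (tri_exp 0 3 3) x + mon (tri_exp 3 0 3) x)
    + 3 * (mon (tri_exp 2 3 1) x + mon (tri_exp 3 2 1) x + mon (tri_exp 1 3 2) x
      + mon (tri_exp 1 2 3) x + mon (tri_exp 3 1 2) x + mon (tri_exp 2 1 3) x)
    + 6 * mon (tri_exp 2 2 2) x" for x
    unfolding tri_harm_def mon_tri_exp by algebra
  then have "sph_int (\<lambda>x. (tri_harm i j k x) ^ 3) = 6 * C"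
    using gmom_odd[of 3] by (simp add: sph_int_add sph_bdd_add sph_bdd_mult sph_int_cmult m gmom_1 gmom_2)
  then show ?thesis using C by simp
qed

lemma abs_tri_harm_le: assumes "norm x = 1" shows "\<bar>tri_harm i j k x\<bar> \<le> 3"
proof -
  have "\<bar>mon \<alpha> x\<bar> \<le> 1" for \<alpha> using assms by (intro abs_mon_le) simp
  then have "\<bar>mon (tri_exp 1 1 0) x\<bar> \<le> 1" "\<bar>mon (tri_exp 0 1 1) x\<bar> \<le> 1" "\<bar>mon (tri_exp 1 0 1) x\<bar> \<le> 1" by blast+
  then show ?thesis unfolding tri_harm_eq by linarith
qed

end

section \<open>Moments of the bubble kernel against degrees zero, one and two\<close>

context
  fixes \<delta> :: real and \<zeta> :: "'a::euclidean_space"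
  assumes \<delta>: "0 < \<delta>" "\<delta> < 1" and \<zeta>: "norm \<zeta> < 1"
begin

lemma inner_zeta_less: "norm x = 1 \<Longrightarrow> \<bar>\<zeta> \<bullet> x\<bar> < 1"
  using Cauchy_Schwarz_ineq2[of \<zeta> x] \<zeta> by simp

lemma kernel_le_2: assumes "norm x = 1" shows "(1 - \<zeta> \<bullet> x) powr \<delta> \<le> 2"
proof -
  have "(1 - \<zeta> \<bullet> x) powr \<delta> \<le> 2 powr \<delta>"
    using inner_zeta_less[OF assms] \<delta> by (intro powr_mono2) auto
  also have "\<dots> \<le> 2 powr 1" using \<delta> by (intro powr_mono) auto
  finally show ?thesis by simp
qed

lemma sph_bdd_kernel [simp]: "sph_bdd (\<lambda>x. (1 - \<zeta> \<bullet> x) powr \<delta>)" "sph_bdd (\<lambda>x. (1 + \<zeta> \<bullet> x) powr \<delta>)"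
proof -
  show "sph_bdd (\<lambda>x. (1 - \<zeta> \<bullet> x) powr \<delta>)"
    unfolding sph_bdd_def using kernel_le_2 by (auto intro!: exI[of _ 2])
  have "(1 + \<zeta> \<bullet> x) powr \<delta> \<le> 2" if "norm x = 1" for x
    using kernel_le_2[of "-x"] that by simp
  then show "sph_bdd (\<lambda>x. (1 + \<zeta> \<bullet> x) powr \<delta>)"
    unfolding sph_bdd_def by (auto intro!: exI[of _ 2])
qed

lemma sph_int_kernel_reflect:
  "sph_int (\<lambda>x. (1 + \<zeta> \<bullet> x) powr \<delta>) = sph_int (\<lambda>x. (1 - \<zeta> \<bullet> x) powr \<delta>)"
  "sph_int (\<lambda>x. (\<zeta> \<bullet> x) * (1 + \<zeta> \<bullet> x) powr \<delta>) = - sph_int (\<lambda>x. (\<zeta> \<bullet> x) * (1 - \<zeta> \<bullet> x) powr \<delta>)"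
  using sph_int_even[of "\<lambda>x. (1 - \<zeta> \<bullet> x) powr \<delta>"] sph_int_even[of "\<lambda>x. (\<zeta> \<bullet> x) * (1 - \<zeta> \<bullet> x) powr \<delta>"]
  by (auto simp: sph_int_uminus)

lemma sph_int_kernel_le: "sph_int (\<lambda>x. (1 - \<zeta> \<bullet> x) powr \<delta>) \<le> 2 * sph_int (\<lambda>_::'a. 1)"
  using sph_int_mono[of "\<lambda>x. (1 - \<zeta> \<bullet> x) powr \<delta>" "\<lambda>_. 2 * 1"] kernel_le_2
  unfolding sph_int_cmult by simp

text \<open>Averaging over x and -x replaces the kernel by its even part, which is at least 1/2
  pointwise.\<close>

lemma sph_int_kernel_ge: "sph_int (\<lambda>_::'a. 1) / 2 \<le> sph_int (\<lambda>x. (1 - \<zeta> \<bullet> x) powr \<delta>)"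
proof -
  have "sph_int (\<lambda>_::'a. 1) \<le> sph_int (\<lambda>x. (1 + \<zeta> \<bullet> x) powr \<delta> + (1 - \<zeta> \<bullet> x) powr \<delta>)"
    by (rule sph_int_mono) (use powr_even_part \<delta> inner_zeta_less in \<open>auto intro: sph_bdd_add\<close>)
  also have "\<dots> = 2 * sph_int (\<lambda>x. (1 - \<zeta> \<bullet> x) powr \<delta>)"
    by (subst sph_int_add) (auto simp: sph_int_kernel_reflect)
  finally show ?thesis by simp
qed

text \<open>Antipodal averaging leaves the odd part of the kernel, which
  \<open>powr_odd_part\<close> bounds. This makes the degree-one part of a bubble quantitatively
  nonzero.\<close>

lemma sph_int_linear_kernel:
  "sph_int (\<lambda>x. (\<zeta> \<bullet> x) * (1 - \<zeta> \<bullet> x) powr \<delta>) \<le> - (\<delta> / 2) * sph_int (\<lambda>x. (\<zeta> \<bullet> x)\<^sup>2)"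
proof -
  have "\<delta> * sph_int (\<lambda>x. (\<zeta> \<bullet> x)\<^sup>2) \<le> sph_int (\<lambda>x. (\<zeta> \<bullet> x) * (1 + \<zeta> \<bullet> x) powr \<delta> - (\<zeta> \<bullet> x) * (1 - \<zeta> \<bullet> x) powr \<delta>)"
    unfolding sph_int_cmult[symmetric]
    by (rule sph_int_mono)
      (use powr_odd_part[OF \<delta> inner_zeta_less] in \<open>auto intro!: sph_bdd_mult sph_bdd_diff sph_bdd_power simp: algebra_simps\<close>)
  also have "\<dots> = - 2 * sph_int (\<lambda>x. (\<zeta> \<bullet> x) * (1 - \<zeta> \<bullet> x) powr \<delta>)"
    by (subst sph_int_diff) (auto simp: sph_int_kernel_reflect)
  finally show ?thesis by simp
qed

text \<open>\<phi> is orthogonal to degrees 0 and 1, so the kernel may be replaced by its remainder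
  q after the affine Taylor polynomial, and |q| \<le> (\<zeta> \<bullet> x)^2.\<close>

lemma sph_int_deg2_kernel:
  assumes \<phi>: "hom_harm_poly 2 \<phi>" and orth: "\<And>f l. hom_harm_poly l f \<Longrightarrow> l \<noteq> 2 \<Longrightarrow> sph_int (\<lambda>x. f x * \<phi> x) = 0"
    and B: "\<And>x. norm x = 1 \<Longrightarrow> \<bar>\<phi> x\<bar> \<le> B"
  shows "\<bar>sph_int (\<lambda>x. \<phi> x * (1 - \<zeta> \<bullet> x) powr \<delta>)\<bar> \<le> B * sph_int (\<lambda>x. (\<zeta> \<bullet> x)\<^sup>2)"
proof -
  define q where "q x = (1 - \<zeta> \<bullet> x) powr \<delta> - 1 + \<delta> * (\<zeta> \<bullet> x)" for x
  have bq: "sph_bdd q" unfolding q_def by (intro sph_bdd_add sph_bdd_diff sph_bdd_mult) auto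
  note b\<phi> = sph_bdd_hom_harm_poly[OF \<phi>]
  have "sph_int (\<lambda>x. \<phi> x * (1 - \<zeta> \<bullet> x) powr \<delta>) = sph_int (\<lambda>x. \<phi> x * q x + (1 * \<phi> x - \<delta> * ((\<zeta> \<bullet> x) * \<phi> x)))"
    by (simp add: q_def algebra_simps)
  also have "\<dots> = sph_int (\<lambda>x. \<phi> x * q x) + (sph_int (\<lambda>x. 1 * \<phi> x) - \<delta> * sph_int (\<lambda>x. (\<zeta> \<bullet> x) * \<phi> x))"
  proof -
    have b: "sph_bdd (\<lambda>x. 1 * \<phi> x)" "sph_bdd (\<lambda>x. \<delta> * ((\<zeta> \<bullet> x) * \<phi> x))" "sph_bdd (\<lambda>x. \<phi> x * q x)"
      using bq b\<phi> by (auto intro!: sph_bdd_mult)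
    show ?thesis
      unfolding sph_int_cmult[of \<delta>, symmetric] sph_int_add[OF b(3) sph_bdd_diff[OF b(1,2)]] sph_int_diff[OF b(1,2)] ..
  qed
  also have "\<dots> = sph_int (\<lambda>x. \<phi> x * q x)"
    using orth[OF hom_harm_poly_const[of 1]] orth[OF hom_harm_poly_linear[of \<zeta>]] by simp
  finally have e: "sph_int (\<lambda>x. \<phi> x * (1 - \<zeta> \<bullet> x) powr \<delta>) = sph_int (\<lambda>x. \<phi> x * q x)" .
  have bound: "\<bar>\<phi> x * q x\<bar> \<le> B * (\<zeta> \<bullet> x)\<^sup>2" if "norm x = 1" for x
  proof -
    have "\<bar>q x\<bar> \<le> (\<zeta> \<bullet> x)\<^sup>2" unfolding q_def by (rule powr_linear_approx[OF \<delta> inner_zeta_less[OF that]])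
    moreover have "0 \<le> B" using B[OF that] by linarith
    ultimately show ?thesis unfolding abs_mult by (intro mult_mono B[OF that]) auto
  qed
  have "sph_int (\<lambda>x. \<phi> x * q x) \<le> sph_int (\<lambda>x. B * (\<zeta> \<bullet> x)\<^sup>2)"
    by (rule sph_int_mono) (use bound bq b\<phi> in \<open>auto intro!: sph_bdd_mult sph_bdd_power simp: abs_le_iff\<close>)
  moreover have "sph_int (\<lambda>x. - (\<phi> x * q x)) \<le> sph_int (\<lambda>x. B * (\<zeta> \<bullet> x)\<^sup>2)"
    by (rule sph_int_mono) (use bound bq b\<phi> in \<open>auto intro!: sph_bdd_mult sph_bdd_minus sph_bdd_power simp: abs_le_iff\<close>)
  ultimately show ?thesis unfolding e by (simp add: sph_int_cmult sph_int_uminus)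
qed

end

section \<open>The distance of the test function to the bubbles\<close>

text \<open>Arithmetic core of the lower bound for the distance: \<open>I = \<integral> h\<close>, \<open>J = \<integral> \<phi> h\<close> and \<open>H\<close> is the squared
  norm of the degree-one part of \<open>h = c (1 - \<zeta> \<bullet> x)\<^sup>\<delta>\<close>, with \<open>z = |\<zeta>|\<^sup>2\<close>.\<close>
lemma distance_arith:
  fixes \<alpha> \<beta> \<gamma> A I J H c K \<delta> z M e :: real
  assumes a: "\<alpha> < 0" "\<beta> > 0" "\<gamma> > 0" and c: "c > 0" and M: "0 < M" "M \<le> A" and z: "0 \<le> z" "z \<le> 1"
    and I: "I = c * K" "A / 2 \<le> K" "K \<le> 2 * A"
    and J: "\<bar>J\<bar> \<le> 3 * (c * (z * M))" and H: "(c * \<delta> / 2)\<^sup>2 * (z * M) \<le> H"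
    and e: "0 < e" "12 * \<gamma> * e \<le> - \<alpha>" "72 * \<gamma> * e \<le> \<beta> * \<delta>\<^sup>2"
    and main: "\<beta> * H + \<gamma> * e * J \<le> \<alpha> * (A - I) * (I / A)"
  shows "0 \<le> \<alpha> * (A - I) + \<gamma> * e * J"
proof -
  have A: "A > 0" using M by linarith
  \<comment> \<open>The mean of h, comparable to c. The goal is proved after multiplication by q >
    0, because \<open>main\<close> bounds \<alpha> (A - I) q.\<close>
  define q where "q = I / A"
  have q: "c / 2 \<le> q" "q \<le> 2 * c"
    using I A c mult_left_mono[OF I(2), of c] mult_left_mono[OF I(3), of c] by (auto simp: q_def field_simps)
  have q0: "q > 0" using q c by linarith
  have zM: "0 \<le> z * M" "z * M \<le> A"
    using z M mult_mono[of z 1 M A] by auto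
  have H0: "0 \<le> H" using H zM by (meson order_trans mult_nonneg_nonneg zero_le_power2)
  have \<gamma>e: "0 < \<gamma> * e" using a e by simp
  have J1: "- (3 * (c * (z * M))) \<le> J" using J by linarith
  have aJ: "- (\<gamma> * e * (3 * (c * (z * M)))) \<le> \<gamma> * e * J"
    using mult_left_mono[OF J1 less_imp_le[OF \<gamma>e]] by simp
  \<comment> \<open>Bubbles of small height are excluded. Dropping \<beta> H from
    \<open>main\<close> and using |J| \<le> 3 c A \<le> 6 q A gives -6 \<gamma> e A \<le> \<alpha>
    (A - I); the condition with factor 12 then yields I \<ge> A / 2, so q \<ge> 1/2 and c \<ge>
    1/4.\<close>
  have "c \<ge> 1 / 4"
  proof -
    have "\<gamma> * e * (3 * (c * (z * M))) \<le> \<gamma> * e * (3 * (c * A))"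
      using \<gamma>e c zM by (intro mult_left_mono) auto
    also have "\<dots> \<le> \<gamma> * e * (3 * (2 * q * A))"
      using \<gamma>e q A by (intro mult_left_mono mult_right_mono) auto
    finally have "- (\<gamma> * e * 6 * A) * q \<le> \<gamma> * e * J" using aJ by (simp add: mult_ac)
    also have "\<dots> \<le> \<alpha> * (A - I) * q" using main mult_nonneg_nonneg[OF less_imp_le[OF a(2)] H0] unfolding q_def[symmetric]
      by linarith
    finally have "- (\<gamma> * e * 6 * A) \<le> \<alpha> * (A - I)" by (rule mult_right_le_imp_le[OF _ q0])
    moreover have "(12 * \<gamma> * e) * A \<le> - \<alpha> * A" using e A by (intro mult_right_mono) auto
    ultimately have "\<alpha> * (A / 2) \<le> \<alpha> * (A - I)" by (simp add: algebra_simps)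
    then have "A - I \<le> A / 2" using a by simp
    moreover have "I = q * A" using A by (simp add: q_def)
    ultimately have "A * (1 / 2) \<le> A * q" by (simp add: algebra_simps)
    then have "1 / 2 \<le> q" using A by simp
    then show ?thesis using q by linarith
  qed
  \<comment> \<open>By \<open>main\<close> the product is at least \<beta> H + \<gamma> e J (1 + q).
    Since 1 \<le> 4 c and q \<le> 2 c, the second term is at least -18 \<gamma> e c^2 z M, against
    \<beta> c^2 \<delta>^2 z M / 4 from H; hence the factor 72 in the last condition on e.\<close>
  have "0 \<le> (\<alpha> * (A - I) + \<gamma> * e * J) * q"
  proof -
    have "(\<alpha> * (A - I) + \<gamma> * e * J) * q \<ge> \<beta> * H + \<gamma> * e * J * (1 + q)"
      using main unfolding q_def[symmetric] by (simp add: algebra_simps)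
    moreover have "\<beta> * ((c * \<delta> / 2)\<^sup>2 * (z * M)) \<le> \<beta> * H" using H a by simp
    moreover have "- (\<gamma> * e * (3 * (c * (z * M)))) * (6 * c) \<le> \<gamma> * e * J * (1 + q)"
    proof -
      have "\<gamma> * e * (3 * (c * (z * M))) * (1 + q) \<le> \<gamma> * e * (3 * (c * (z * M))) * (6 * c)"
        using a e(1) c z M q \<open>c \<ge> 1 / 4\<close> by (intro mult_left_mono mult_nonneg_nonneg) auto
      moreover have "- (\<gamma> * e * (3 * (c * (z * M)))) * (1 + q) \<le> \<gamma> * e * J * (1 + q)"
        using aJ q0 by (intro mult_right_mono) auto
      ultimately show ?thesis unfolding mult_minus_left by (meson le_imp_neg_le order_trans)
    qed
    moreover have "0 \<le> (c\<^sup>2 * (z * M)) * (\<beta> * \<delta>\<^sup>2 - 72 * \<gamma> * e) / 4"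
      using z M e(3) by (intro divide_nonneg_pos mult_nonneg_nonneg) auto
    moreover have "(c\<^sup>2 * (z * M)) * (\<beta> * \<delta>\<^sup>2 - 72 * \<gamma> * e) / 4 =
        \<beta> * ((c * \<delta> / 2)\<^sup>2 * (z * M)) + - (\<gamma> * e * (3 * (c * (z * M)))) * (6 * c)"
      by (simp add: power2_eq_square field_simps)
    ultimately show ?thesis by linarith
  qed
  then show ?thesis using q0 by (simp add: zero_le_mult_iff)
qed

section \<open>Tangent vectors to the family of bubbles and the distance to it\<close>

lemma deriv_bubble_scale: "deriv (\<lambda>t. bubble s (c + t) (\<zeta>::'a::euclidean_space) x) 0 =
    (1 - \<zeta> \<bullet> x) powr ((2 * s - sph_dim TYPE('a)) / 2)"
  unfolding bubble_def by (rule DERIV_imp_deriv) (auto intro!: derivative_eq_intros)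

text \<open>At the constant bubble the tangent space thus consists of functions of degree at most
  one, to which degree two is orthogonal.\<close>

lemma deriv_bubble_centre: "deriv (\<lambda>t. bubble s 1 (0 + t *\<^sub>R b) (x::'a::euclidean_space)) 0 =
    - ((2 * s - sph_dim TYPE('a)) / 2) * (b \<bullet> x)"
proof -
  have "((\<lambda>t. (1 - (0 + t *\<^sub>R b) \<bullet> x) powr ((2 * s - sph_dim TYPE('a)) / 2)) has_real_derivative
     (2 * s - sph_dim TYPE('a)) / 2 * (1 - (0 + 0 *\<^sub>R b) \<bullet> x) powr ((2 * s - sph_dim TYPE('a)) / 2 - of_nat 1) * (- (b \<bullet> x))) (at 0)"
    by (intro DERIV_fun_powr) (auto intro!: derivative_eq_intros)
  then show ?thesis unfolding bubble_def by (intro DERIV_imp_deriv) simp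
qed

abbreviation area :: "'a::euclidean_space itself \<Rightarrow> real" where
  "area _ \<equiv> sph_int (\<lambda>_::'a. 1)"

abbreviation bub_exp :: "'a::euclidean_space itself \<Rightarrow> real \<Rightarrow> real" where
  "bub_exp T s \<equiv> (2 * s - sph_dim T) / 2"

context
  fixes s :: real and i j k :: "'a::euclidean_space"
  assumes dim: "DIM('a) \<ge> 3" and s: "s - sph_dim TYPE('a) / 2 \<in> {0<..<1}"
    and ijk: "i \<in> Basis" "j \<in> Basis" "k \<in> Basis" "i \<noteq> j" "j \<noteq> k" "i \<noteq> k"
begin

lemma delta_bounds: "0 < bub_exp TYPE('a) s" "bub_exp TYPE('a) s < 1"
  using s by auto

lemma proj_cmult_tri:
  "sph_harm_proj l (\<lambda>x. e * tri_harm i j k x) = (if l = 2 then (\<lambda>x. e * tri_harm i j k x) else (\<lambda>_. 0))"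
proof (rule sph_harm_proj_eqI)
  show "sph_bdd (\<lambda>x. e * tri_harm i j k x)" using sph_bdd_tri[OF ijk] by auto
  show "hom_harm_poly l (if l = 2 then (\<lambda>x. e * tri_harm i j k x) else (\<lambda>_. 0))"
    using hom_harm_tri[OF ijk] by (auto intro: hom_harm_poly_cmult hom_harm_poly_zero)
  fix g :: "'a \<Rightarrow> real" assume g: "hom_harm_poly l g"
  show "sph_int (\<lambda>x. (e * tri_harm i j k x - (if l = 2 then (\<lambda>x. e * tri_harm i j k x) else (\<lambda>_. 0)) x) * g x) = 0"
  proof (cases "l = 2")
    case False
    have "sph_int (\<lambda>x. e * (g x * tri_harm i j k x)) = 0"
      unfolding sph_int_cmult using tri_harm_orth[OF ijk g False] by simp
    then show ?thesis using False by (simp add: mult_ac)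
  qed (simp add: sph_int_def)
qed

lemma proj_const: "sph_harm_proj l (\<lambda>_::'a. c) = (if l = 0 then (\<lambda>_. c) else (\<lambda>_. 0))"
proof (rule sph_harm_proj_eqI)
  show "hom_harm_poly l (if l = 0 then (\<lambda>_::'a. c) else (\<lambda>_. 0))"
    using hom_harm_poly_const by (auto intro: hom_harm_poly_zero)
  fix g :: "'a \<Rightarrow> real" assume g: "hom_harm_poly l g"
  show "sph_int (\<lambda>x. (c - (if l = 0 then (\<lambda>_. c) else (\<lambda>_. 0)) x) * g x) = 0"
    using sph_int_hom_harm_poly_eq_0[OF g] by (cases "l = 0") (auto simp: sph_int_cmult sph_int_def)
qed simp

lemma proj_test:
  "sph_harm_proj l (\<lambda>x. 1 - e * tri_harm i j k x) = (if l = 0 then (\<lambda>_. 1) else if l = 2 then (\<lambda>x. - e * tri_harm i j k x) else (\<lambda>_. 0))"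
proof -
  have "sph_harm_proj l (\<lambda>x. 1 - e * tri_harm i j k x) = (\<lambda>x. sph_harm_proj l (\<lambda>_. 1) x - sph_harm_proj l (\<lambda>x. e * tri_harm i j k x) x)"
    using sph_bdd_tri[OF ijk] by (intro sph_harm_proj_diff sph_bdd_diff sph_bdd_mult sph_bdd_const refl)
  then show ?thesis by (auto simp: proj_const proj_cmult_tri)
qed

lemma proj_0: assumes "sph_bdd (v :: 'a \<Rightarrow> real)" shows "sph_harm_proj 0 v = (\<lambda>_. sph_int v / area TYPE('a))"
proof (rule sph_harm_proj_eqI[OF assms hom_harm_poly_const])
  fix g :: "'a \<Rightarrow> real" assume g: "hom_harm_poly 0 g"
  have "sph_int (\<lambda>x. (v x - sph_int v / area TYPE('a)) * g x) = sph_int (\<lambda>x. g 0 * (v x - sph_int v / area TYPE('a) * 1))"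
  proof -
    have "(v x - sph_int v / area TYPE('a)) * g x = g 0 * (v x - sph_int v / area TYPE('a) * 1)" for x
      by (subst hom_harm_poly_0D[OF g, of x]) simp
    then show ?thesis by (rule arg_cong[where f = sph_int, OF ext])
  qed
  also have "\<dots> = g 0 * (sph_int v - sph_int v / area TYPE('a) * area TYPE('a))"
    unfolding sph_int_cmult sph_int_diff[OF assms sph_bdd_mult[OF sph_bdd_const sph_bdd_const]] ..
  finally show "sph_int (\<lambda>x. (v x - sph_int v / area TYPE('a)) * g x) = 0"
    using sph_area_pos[OF dim s] by simp
qed

text \<open>Cauchy-Schwarz as positivity of the integral of (H + m \<zeta> \<bullet> x)^2 with m = c
  \<delta> / 2: the kernel moment makes the integral of H (\<zeta> \<bullet> x) at most - m T, and
  expanding leaves m^2 T as a lower bound. No division by T occurs, so \<zeta> = 0 is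
  included.\<close>

lemma linear_part_lower:
  assumes c: "c > 0" and \<zeta>: "norm \<zeta> < 1"
  defines "h \<equiv> (\<lambda>x. c * (1 - \<zeta> \<bullet> x) powr bub_exp TYPE('a) s)"
  shows "(c * bub_exp TYPE('a) s / 2)\<^sup>2 * sph_int (\<lambda>x. (\<zeta> \<bullet> x)\<^sup>2) \<le> sph_int (\<lambda>x. (sph_harm_proj 1 h x)\<^sup>2)"
proof -
  have bh: "sph_bdd h" unfolding h_def using sph_bdd_kernel(1)[OF delta_bounds \<zeta>] by auto
  define H where "H = sph_harm_proj 1 h"
  define T where "T = sph_int (\<lambda>x. (\<zeta> \<bullet> x)\<^sup>2)"
  have bH: "sph_bdd H" unfolding H_def by (rule sph_bdd_hom_harm_poly[OF sph_harm_proj(1)[OF bh]])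
  define m where "m = c * bub_exp TYPE('a) s / 2"
  have m: "m > 0" using c delta_bounds by (simp add: m_def)
  have "sph_int (\<lambda>x. H x * (\<zeta> \<bullet> x)) = sph_int (\<lambda>x. h x * (\<zeta> \<bullet> x))"
    unfolding H_def by (rule sph_harm_proj(2)[OF bh hom_harm_poly_linear])
  also have "\<dots> = c * sph_int (\<lambda>x. (\<zeta> \<bullet> x) * (1 - \<zeta> \<bullet> x) powr bub_exp TYPE('a) s)"
    unfolding h_def by (subst sph_int_cmult[symmetric]) (simp only: mult_ac)
  also have "\<dots> \<le> c * (- (bub_exp TYPE('a) s / 2) * T)"
    using sph_int_linear_kernel[OF delta_bounds \<zeta>] c unfolding T_def by (intro mult_left_mono) auto
  finally have L: "sph_int (\<lambda>x. H x * (\<zeta> \<bullet> x)) \<le> - m * T" by (simp add: m_def mult_ac)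
  have "0 \<le> sph_int (\<lambda>x. (H x + m * (\<zeta> \<bullet> x))\<^sup>2)"
    by (intro sph_int_nonneg zero_le_power2 sph_bdd_power sph_bdd_add sph_bdd_mult sph_bdd_const sph_bdd_inner bH)
  also have "\<dots> = sph_int (\<lambda>x. (H x)\<^sup>2 + ((2 * m) * (H x * (\<zeta> \<bullet> x)) + m\<^sup>2 * (\<zeta> \<bullet> x)\<^sup>2))"
    by (simp add: power2_eq_square algebra_simps)
  also have "\<dots> = sph_int (\<lambda>x. (H x)\<^sup>2) + (2 * m * sph_int (\<lambda>x. H x * (\<zeta> \<bullet> x)) + m\<^sup>2 * T)"
  proof -
    have b: "sph_bdd (\<lambda>x. (H x)\<^sup>2)" "sph_bdd (\<lambda>x. (2 * m) * (H x * (\<zeta> \<bullet> x)))" "sph_bdd (\<lambda>x. m\<^sup>2 * (\<zeta> \<bullet> x)\<^sup>2)"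
      by (intro sph_bdd_power sph_bdd_mult sph_bdd_const sph_bdd_inner bH)+
    show ?thesis
      unfolding T_def sph_int_add[OF b(1) sph_bdd_add[OF b(2,3)]] sph_int_add[OF b(2,3)] sph_int_cmult ..
  qed
  also have "\<dots> \<le> sph_int (\<lambda>x. (H x)\<^sup>2) + (2 * m * (- m * T) + m\<^sup>2 * T)"
    using L m by (intro add_left_mono add_right_mono mult_left_mono) auto
  finally show ?thesis unfolding H_def[symmetric] T_def[symmetric] m_def[symmetric]
    by (simp add: power2_eq_square algebra_simps)
qed

text \<open>Orthogonality to h gives a[\<rho>] = a[\<rho>, u], which involves only the degrees 0 and
  2 because u does. In a[\<rho>, h] = 0 every other degree contributes minus the symbol times the
  squared norm of the part of h, which is nonpositive; so the degrees 0, 1, 2 together are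
  nonnegative, and this yields the hypothesis \<open>main\<close> of
  \<open>distance_arith\<close>.\<close>

lemma distance_lower:
  assumes e: "e > 0" "12 * alpha2s TYPE('a) s 2 * e \<le> - alpha2s TYPE('a) s 0" "72 * alpha2s TYPE('a) s 2 * e \<le> alpha2s TYPE('a) s 1 * (bub_exp TYPE('a) s)\<^sup>2"
    and c: "c > 0" and \<zeta>: "norm \<zeta> < 1" and orth: "tangent_orth s c \<zeta> \<rho>"
    and u: "\<forall>x\<in>sphere 0 1. 1 - e * tri_harm i j k x = bubble s c \<zeta> x + \<rho> x"
  shows "e\<^sup>2 * alpha2s TYPE('a) s 2 * sph_int (\<lambda>x. (tri_harm i j k x)\<^sup>2) \<le> a2s s \<rho> \<rho>"
proof -
  define h where "h x = c * (1 - \<zeta> \<bullet> x) powr bub_exp TYPE('a) s" for x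
  have hb: "bubble s c \<zeta> = h" by (simp add: fun_eq_iff bubble_def h_def)
  have bk: "sph_bdd (\<lambda>x. (1 - \<zeta> \<bullet> x) powr bub_exp TYPE('a) s)" using sph_bdd_kernel(1)[OF delta_bounds \<zeta>] .
  have bh: "sph_bdd h" unfolding h_def using bk by auto
  define u where "u x = 1 - e * tri_harm i j k x" for x
  have bt: "sph_bdd (tri_harm i j k)" by (rule sph_bdd_tri[OF ijk])
  have bu: "sph_bdd u" unfolding u_def[abs_def] by (intro sph_bdd_diff sph_bdd_mult sph_bdd_const bt)
  have \<rho>Hs: "\<rho> \<in> Hs s" using orth by (simp add: tangent_orth_def)
  have [measurable]: "\<rho> \<in> borel_measurable borel" using \<rho>Hs by (simp add: Hs_def cong: measurable_cong_sets)
  have \<rho>eq: "\<rho> x = u x - h x" if "norm x = 1" for x using u that by (simp add: hb u_def)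
  have b\<rho>: "sph_bdd \<rho>"
    using sph_bdd_diff[OF bu bh] \<rho>eq unfolding sph_bdd_def by auto
  define R where "R l = sph_harm_proj l \<rho>" for l
  define H where "H l = sph_harm_proj l h" for l
  define U where "U l = sph_harm_proj l u" for l
  have R: "R l = (\<lambda>x. U l x - H l x)" for l
    unfolding R_def U_def H_def by (rule sph_harm_proj_diff[OF bu bh b\<rho> \<rho>eq])
  have bb: "sph_bdd (H l)" "sph_bdd (U l)" "sph_bdd (R l)" for l
    unfolding H_def U_def R_def using sph_harm_proj(1) bh bu b\<rho> sph_bdd_hom_harm_poly by blast+
  have U: "U l = (if l = 0 then (\<lambda>_. 1) else if l = 2 then (\<lambda>x. - e * tri_harm i j k x) else (\<lambda>_. 0))" for l
    unfolding U_def u_def by (rule proj_test)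
  define J where "J = sph_int (\<lambda>x. tri_harm i j k x * h x)"
  define I where "I = sph_int h"
  have HH: "sph_int (\<lambda>x. H 2 x * tri_harm i j k x) = J"
    unfolding H_def J_def sph_harm_proj(2)[OF bh hom_harm_tri[OF ijk]] by (simp add: mult.commute)
  have H0: "H 0 = (\<lambda>_. I / area TYPE('a))" unfolding H_def I_def by (rule proj_0[OF bh])
  have area: "area TYPE('a) > 0" by (rule sph_area_pos[OF dim s])
  \<comment> \<open>\<open>x\<close>, \<open>y\<close> and \<open>r\<close> are the degree-wise
    terms of a[\<rho>, h], a[\<rho>, u] and a[\<rho>].\<close>
  define x where "x l = alpha2s TYPE('a) s l * sph_int (\<lambda>x. R l x * H l x)" for l
  define y where "y l = alpha2s TYPE('a) s l * sph_int (\<lambda>x. R l x * U l x)" for l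
  define r where "r l = alpha2s TYPE('a) s l * sph_int (\<lambda>x. R l x * R l x)" for l
  have ryx: "r l = y l - x l" for l
  proof -
    have "sph_int (\<lambda>x. R l x * R l x) = sph_int (\<lambda>x. R l x * U l x - R l x * H l x)"
      by (subst (2) R) (simp add: algebra_simps)
    also have "\<dots> = sph_int (\<lambda>x. R l x * U l x) - sph_int (\<lambda>x. R l x * H l x)"
      by (intro sph_int_diff sph_bdd_mult bb)
    finally show ?thesis unfolding r_def x_def y_def by (simp only: right_diff_distrib)
  qed
  have y0: "y l = 0" if "l \<notin> {0, 2}" for l using that by (simp add: y_def U sph_int_def)
  have ysums: "y sums (y 0 + y 2)" using sums_finite[of "{0, 2}" y] y0 by simp
  have rsum: "summable r"
  proof -
    obtain B where B: "\<And>l. \<bar>alpha2s TYPE('a) s l\<bar> \<le> B * (1 + real l) powr (2 * s)" using alpha2s_bound[OF dim s] by blast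
    have "summable (\<lambda>l. B * ((1 + real l) powr (2 * s) * sph_int (\<lambda>x. (R l x)\<^sup>2)))"
      using \<rho>Hs unfolding R_def by (intro summable_mult) (simp add: Hs_def)
    then show ?thesis
    proof (rule summable_comparison_test'[where N = 0])
      fix l
      have "0 \<le> sph_int (\<lambda>x. (R l x)\<^sup>2)" using bb by (intro sph_int_nonneg) (auto intro: sph_bdd_power)
      then show "norm (r l) \<le> B * ((1 + real l) powr (2 * s) * sph_int (\<lambda>x. (R l x)\<^sup>2))"
        using mult_right_mono[OF B[of l]] by (simp add: r_def abs_mult power2_eq_square mult.assoc)
    qed
  qed
  have a\<rho>: "a2s s \<rho> \<rho> = suminf r" by (simp add: a2s_def r_def[abs_def] R_def)
  have "a2s s \<rho> h = 0"
  proof -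
    \<comment> \<open>The derivative in c is h / c, so the coefficient c makes h itself a tangent
      vector.\<close>
    have "a2s s \<rho> (\<lambda>x. c * deriv (\<lambda>t. bubble s (c + t) \<zeta> x) 0 +
        (\<Sum>b\<in>Basis. 0 * deriv (\<lambda>t. bubble s c (\<zeta> + t *\<^sub>R b) x) 0)) = 0"
      using orth unfolding tangent_orth_def by (elim conjE allE[of _ c] allE[of _ "\<lambda>_. 0"])
    then show ?thesis by (simp add: deriv_bubble_scale h_def[abs_def])
  qed
  then have x0: "suminf x = 0" by (simp add: a2s_def x_def[abs_def] R_def H_def)
  have xyr: "x l = y l - r l" for l using ryx by simp
  \<comment> \<open>\<open>suminf x = 0\<close> alone says nothing about convergence. That comes
    from x = y - r: y has at most two nonzero terms, and r is summable because \<rho> lies in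
    \<open>Hs\<close>.\<close>
  have xsums: "x sums (y 0 + y 2 - suminf r)"
    unfolding xyr[abs_def] by (intro sums_diff ysums summable_sums rsum)
  then have xsum: "summable x" by (rule sums_summable)
  have r_eq: "suminf r = y 0 + y 2" using sums_unique[OF xsums] x0 by simp
  have al_pos: "l \<ge> 1 \<Longrightarrow> alpha2s TYPE('a) s l > 0" for l by (rule alpha2s_pos[OF dim s])
  have sq_nonneg: "0 \<le> sph_int (\<lambda>x. (H l x)\<^sup>2)" for l
    using bb by (intro sph_int_nonneg) (auto intro: sph_bdd_power)
  have x_neg: "x l = - (alpha2s TYPE('a) s l * sph_int (\<lambda>x. (H l x)\<^sup>2))" if "l \<notin> {0, 2}" for l
    using that by (simp add: x_def R U power2_eq_square sph_int_uminus)
  have "suminf x \<le> (\<Sum>l<3. x l)"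
  proof -
    have "(\<Sum>l<3. - x l) \<le> (\<Sum>l. - x l)"
      using x_neg sq_nonneg al_pos less_imp_le
      by (intro sum_le_suminf summable_minus xsum) (auto simp: less_imp_le)
    then show ?thesis using suminf_minus[OF xsum] by (simp add: sum_negf)
  qed
  then have x012: "0 \<le> x 0 + x 1 + x 2" using x0 by (simp add: eval_nat_numeral)
  have X0: "x 0 = alpha2s TYPE('a) s 0 * (area TYPE('a) - I) * (I / area TYPE('a))"
  proof -
    have "sph_int (\<lambda>x. R 0 x * H 0 x) = sph_int (\<lambda>_::'a. (1 - I / area TYPE('a)) * (I / area TYPE('a)) * 1)"
      by (simp add: R U H0)
    also have "\<dots> = (1 - I / area TYPE('a)) * (I / area TYPE('a)) * area TYPE('a)" by (rule sph_int_cmult)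
    also have "\<dots> = (area TYPE('a) - I) * (I / area TYPE('a))" using area by (simp add: field_simps)
    finally show ?thesis by (simp add: x_def)
  qed
  have X2: "x 2 \<le> - (alpha2s TYPE('a) s 2 * e * J)"
  proof -
    have "sph_int (\<lambda>x. R 2 x * H 2 x) = sph_int (\<lambda>x. - e * (H 2 x * tri_harm i j k x) - (H 2 x)\<^sup>2)"
      by (simp add: R U power2_eq_square algebra_simps)
    also have "\<dots> = - e * J - sph_int (\<lambda>x. (H 2 x)\<^sup>2)"
    proof -
      have b: "sph_bdd (\<lambda>x. - e * (H 2 x * tri_harm i j k x))" "sph_bdd (\<lambda>x. (H 2 x)\<^sup>2)"
        using bb bt by (auto intro!: sph_bdd_mult sph_bdd_power)
      show ?thesis unfolding sph_int_diff[OF b] sph_int_cmult HH ..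
    qed
    also have "\<dots> \<le> - e * J" using sq_nonneg[of 2] by simp
    finally have "x 2 \<le> alpha2s TYPE('a) s 2 * (- e * J)" unfolding x_def using al_pos[of 2] by (intro mult_left_mono) auto
    then show ?thesis by simp
  qed
  have Y0: "y 0 = alpha2s TYPE('a) s 0 * (area TYPE('a) - I)"
  proof -
    have "sph_int (\<lambda>x. R 0 x * U 0 x) = sph_int (\<lambda>_::'a. (1 - I / area TYPE('a)) * 1)" by (simp add: R U H0)
    also have "\<dots> = (1 - I / area TYPE('a)) * area TYPE('a)" by (rule sph_int_cmult)
    also have "\<dots> = area TYPE('a) - I" using area by (simp add: field_simps)
    finally show ?thesis by (simp add: y_def)
  qed
  have Y2: "y 2 = alpha2s TYPE('a) s 2 * e * J + e\<^sup>2 * alpha2s TYPE('a) s 2 * sph_int (\<lambda>x. (tri_harm i j k x)\<^sup>2)"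
  proof -
    have "sph_int (\<lambda>x. R 2 x * U 2 x) = sph_int (\<lambda>x. e * (H 2 x * tri_harm i j k x) + e\<^sup>2 * (tri_harm i j k x)\<^sup>2)"
      by (simp add: R U power2_eq_square algebra_simps)
    also have "\<dots> = e * J + e\<^sup>2 * sph_int (\<lambda>x. (tri_harm i j k x)\<^sup>2)"
    proof -
      have b: "sph_bdd (\<lambda>x. e * (H 2 x * tri_harm i j k x))" "sph_bdd (\<lambda>x. e\<^sup>2 * (tri_harm i j k x)\<^sup>2)"
        using bb bt by (auto intro!: sph_bdd_mult sph_bdd_power)
      show ?thesis unfolding sph_int_add[OF b] sph_int_cmult HH ..
    qed
    finally show ?thesis by (simp add: y_def algebra_simps)
  qed
  obtain M where M': "M > 0 \<and> M \<le> area TYPE('a) \<and> (\<forall>\<zeta>::'a. sph_int (\<lambda>x. (\<zeta> \<bullet> x)\<^sup>2) = (norm \<zeta>)\<^sup>2 * M)"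
    using sph_int_linear_sq[where ?'a = 'a] by (rule exE)
  note M = M'[THEN conjunct1] M'[THEN conjunct2, THEN conjunct1] M'[THEN conjunct2, THEN conjunct2, rule_format]
  define K where "K = sph_int (\<lambda>x. (1 - \<zeta> \<bullet> x) powr bub_exp TYPE('a) s)"
  have "0 \<le> alpha2s TYPE('a) s 0 * (area TYPE('a) - I) + alpha2s TYPE('a) s 2 * e * J"
  proof (rule distance_arith[where z = "(norm \<zeta>)\<^sup>2" and K = K and \<delta> = "bub_exp TYPE('a) s" and c = c and M = M
        and \<beta> = "alpha2s TYPE('a) s 1" and H = "sph_int (\<lambda>x. (H 1 x)\<^sup>2)"])
    show "alpha2s TYPE('a) s 0 < 0" by (rule alpha2s_0_neg[OF dim s])
    show "I = c * K" unfolding I_def K_def h_def[abs_def] by (rule sph_int_cmult)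
    show "area TYPE('a) / 2 \<le> K" "K \<le> 2 * area TYPE('a)"
      unfolding K_def using sph_int_kernel_ge[OF delta_bounds \<zeta>] sph_int_kernel_le[OF delta_bounds \<zeta>] by auto
    have "\<bar>sph_int (\<lambda>x. tri_harm i j k x * (1 - \<zeta> \<bullet> x) powr bub_exp TYPE('a) s)\<bar> \<le> 3 * sph_int (\<lambda>x. (\<zeta> \<bullet> x)\<^sup>2)"
      by (rule sph_int_deg2_kernel[OF delta_bounds \<zeta> hom_harm_tri[OF ijk] tri_harm_orth[OF ijk] abs_tri_harm_le[OF ijk]])
    moreover have "J = c * sph_int (\<lambda>x. tri_harm i j k x * (1 - \<zeta> \<bullet> x) powr bub_exp TYPE('a) s)"
      unfolding J_def h_def by (subst sph_int_cmult[symmetric]) (simp only: mult_ac)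
    ultimately show "\<bar>J\<bar> \<le> 3 * (c * ((norm \<zeta>)\<^sup>2 * M))"
      using c by (simp add: M(3) abs_mult)
    show "(c * bub_exp TYPE('a) s / 2)\<^sup>2 * ((norm \<zeta>)\<^sup>2 * M) \<le> sph_int (\<lambda>x. (H 1 x)\<^sup>2)"
      using linear_part_lower[OF c \<zeta>] unfolding H_def h_def[abs_def] M(3) .
    show "alpha2s TYPE('a) s 1 * sph_int (\<lambda>x. (H 1 x)\<^sup>2) + alpha2s TYPE('a) s 2 * e * J \<le> alpha2s TYPE('a) s 0 * (area TYPE('a) - I) * (I / area TYPE('a))"
      using x012 x_neg[of 1] X2 unfolding X0 by simp
    show "(norm \<zeta>)\<^sup>2 \<le> 1" using \<zeta> by (simp add: abs_square_le_1)
  qed (rule al_pos[OF order_refl] al_pos[OF one_le_numeral] c M(1) M(2) e(1) e(2) e(3) zero_le_power2)+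
  then show ?thesis unfolding a\<rho> r_eq Y0 Y2 by linarith
qed

text \<open>Makes the set under the infimum in \<open>dist_M\<close> nonempty, with c = 1 and
  \<zeta> = 0; without that a real \<open>Inf\<close> has no lower bound from its elements.\<close>

lemma tangent_orth_test: "tangent_orth s 1 (0::'a) (\<lambda>x. - e * tri_harm i j k x)"
  unfolding tangent_orth_def
proof (intro conjI allI)
  have bt: "sph_bdd (tri_harm i j k)" by (rule sph_bdd_tri[OF ijk])
  have b: "sph_bdd (\<lambda>x. - e * tri_harm i j k x)" using bt by (intro sph_bdd_mult sph_bdd_const)
  have b2: "sph_bdd (\<lambda>x. (- e * tri_harm i j k x)\<^sup>2)" using b by (rule sph_bdd_power)
  have [measurable]: "tri_harm i j k \<in> borel_measurable borel" using sph_bdd_measurable[OF bt] .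
  show "(\<lambda>x. - e * tri_harm i j k x) \<in> Hs s"
    unfolding Hs_def mem_Collect_eq
  proof (intro conjI)
    show "integrable sph_measure (\<lambda>x. (- e * tri_harm i j k x)\<^sup>2)" by (rule sph_bdd_integrable[OF b2])
    show "summable (\<lambda>l. (1 + real l) powr (2 * s) * sph_int (\<lambda>x. (sph_harm_proj l (\<lambda>x. - e * tri_harm i j k x) x)\<^sup>2))"
      unfolding proj_cmult_tri by (rule summable_finite[of "{2}"]) (auto simp: sph_int_def)
  qed measurable
  fix k0 and kb :: "'a \<Rightarrow> real"
  define v where "v = (\<lambda>x. k0 * deriv (\<lambda>t. bubble s (1 + t) 0 x) 0 +
          (\<Sum>b\<in>Basis. kb b * deriv (\<lambda>t. bubble s 1 (0 + t *\<^sub>R b) (x::'a)) 0))"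
  define w where "w = (\<Sum>b\<in>Basis. (- bub_exp TYPE('a) s * kb b) *\<^sub>R b)"
  have v: "v = (\<lambda>x. k0 + w \<bullet> x)"
    unfolding v_def deriv_bubble_scale deriv_bubble_centre w_def
    by (auto simp: inner_sum_left fun_eq_iff mult_ac intro!: sum.cong)
  have bv: "sph_bdd v" unfolding v by (intro sph_bdd_add sph_bdd_const sph_bdd_inner)
  have "sph_int (\<lambda>x. v x * tri_harm i j k x) = sph_int (\<lambda>x. k0 * tri_harm i j k x + (w \<bullet> x) * tri_harm i j k x)"
    by (simp add: v algebra_simps)
  also have "\<dots> = 0"
  proof -
    have "sph_bdd (\<lambda>x. k0 * tri_harm i j k x)" "sph_bdd (\<lambda>x. (w \<bullet> x) * tri_harm i j k x)" using bt by auto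
    from sph_int_add[OF this] show ?thesis
      using tri_harm_orth[OF ijk hom_harm_poly_const[of k0]] tri_harm_orth[OF ijk hom_harm_poly_linear[of w]] by simp
  qed
  finally have vt: "sph_int (\<lambda>x. v x * tri_harm i j k x) = 0" .
  have "sph_int (\<lambda>x. sph_harm_proj l (\<lambda>x. - e * tri_harm i j k x) x * sph_harm_proj l v x) = 0" for l
  proof (cases "l = 2")
    case True
    have "sph_int (\<lambda>x. - e * (sph_harm_proj 2 v x * tri_harm i j k x)) = 0"
      unfolding sph_int_cmult sph_harm_proj(2)[OF bv hom_harm_tri[OF ijk]] vt by simp
    then show ?thesis unfolding True proj_cmult_tri by (simp add: mult_ac)
  next
    case False
    then have "sph_harm_proj l (\<lambda>x. - e * tri_harm i j k x) = (\<lambda>_. 0)" unfolding proj_cmult_tri by simp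
    then show ?thesis by (simp only: mult_zero_left) (simp add: sph_int_def)
  qed
  then show "a2s s (\<lambda>x. - e * tri_harm i j k x) (\<lambda>x. k0 * deriv (\<lambda>t. bubble s (1 + t) 0 x) 0 +
          (\<Sum>b\<in>Basis. kb b * deriv (\<lambda>t. bubble s 1 (0 + t *\<^sub>R b) x) 0)) = 0"
    unfolding v_def[symmetric] a2s_def by simp
qed

lemma dist_M_lower:
  assumes e: "e > 0" "12 * alpha2s TYPE('a) s 2 * e \<le> - alpha2s TYPE('a) s 0" "72 * alpha2s TYPE('a) s 2 * e \<le> alpha2s TYPE('a) s 1 * (bub_exp TYPE('a) s)\<^sup>2"
  shows "e\<^sup>2 * alpha2s TYPE('a) s 2 * sph_int (\<lambda>x. (tri_harm i j k x)\<^sup>2) \<le> dist_M s (\<lambda>x. 1 - e * tri_harm i j k x)"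
  unfolding dist_M_def
proof (rule cInf_greatest)
  have "1 - e * tri_harm i j k x = bubble s 1 0 x + (- e * tri_harm i j k x)" for x by (simp add: bubble_def)
  then have "a2s s (\<lambda>x. - e * tri_harm i j k x) (\<lambda>x. - e * tri_harm i j k x) \<in>
      {a2s s \<rho> \<rho> |\<rho> c \<zeta>. 0 < c \<and> norm \<zeta> < 1 \<and> tangent_orth s c \<zeta> \<rho> \<and>
      (\<forall>x\<in>sphere 0 1. 1 - e * tri_harm i j k x = bubble s c \<zeta> x + \<rho> x)}"
    unfolding mem_Collect_eq
    by (intro exI[of _ "\<lambda>x. - e * tri_harm i j k x"] exI[of _ 1] exI[of _ 0] conjI refl ballI tangent_orth_test) auto
  then show "{a2s s \<rho> \<rho> |\<rho> c \<zeta>. 0 < c \<and> norm \<zeta> < 1 \<and> tangent_orth s c \<zeta> \<rho> \<and>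
      (\<forall>x\<in>sphere 0 1. 1 - e * tri_harm i j k x = bubble s c \<zeta> x + \<rho> x)} \<noteq> {}"
    by (intro notI) (simp only: empty_iff)
next
  fix d assume "d \<in> {a2s s \<rho> \<rho> |\<rho> c \<zeta>. 0 < c \<and> norm \<zeta> < 1 \<and> tangent_orth s c \<zeta> \<rho> \<and>
      (\<forall>x\<in>sphere 0 1. 1 - e * tri_harm i j k x = bubble s c \<zeta> x + \<rho> x)}"
  then show "e\<^sup>2 * alpha2s TYPE('a) s 2 * sph_int (\<lambda>x. (tri_harm i j k x)\<^sup>2) \<le> d" using distance_lower[OF e] by blast
qed

lemma a2s_test: "a2s s (\<lambda>x. 1 - e * tri_harm i j k x) (\<lambda>x. 1 - e * tri_harm i j k x) = alpha2s TYPE('a) s 0 * area TYPE('a) + e\<^sup>2 * alpha2s TYPE('a) s 2 * sph_int (\<lambda>x. (tri_harm i j k x)\<^sup>2)"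
proof -
  define f where "f l = alpha2s TYPE('a) s l * sph_int (\<lambda>x. sph_harm_proj l (\<lambda>x. 1 - e * tri_harm i j k x) x * sph_harm_proj l (\<lambda>x. 1 - e * tri_harm i j k x) x)" for l
  have "f l = 0" if "l \<notin> {0, 2}" for l using that by (simp add: f_def proj_test sph_int_def)
  then have "f sums (f 0 + f 2)" using sums_finite[of "{0, 2}" f] by simp
  moreover have "f 0 = alpha2s TYPE('a) s 0 * area TYPE('a)" by (simp add: f_def proj_test)
  moreover have "f 2 = e\<^sup>2 * alpha2s TYPE('a) s 2 * sph_int (\<lambda>x. (tri_harm i j k x)\<^sup>2)"
  proof -
    have "sph_int (\<lambda>x. (- e * tri_harm i j k x) * (- e * tri_harm i j k x)) = sph_int (\<lambda>x. e\<^sup>2 * (tri_harm i j k x)\<^sup>2)"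
      by (simp add: power2_eq_square mult_ac)
    then show ?thesis by (simp add: f_def proj_test sph_int_cmult)
  qed
  ultimately show ?thesis unfolding a2s_def f_def[symmetric] by (simp add: sums_iff)
qed

lemma admissible_test:
  assumes e: "0 < e" "e < 1 / 3"
  shows "admissible_BE s (\<lambda>x. 1 - e * tri_harm i j k x)"
  unfolding admissible_BE_def
proof (intro conjI ballI)
  have bt: "sph_bdd (tri_harm i j k)" by (rule sph_bdd_tri[OF ijk])
  have [measurable]: "tri_harm i j k \<in> borel_measurable borel" using sph_bdd_measurable[OF bt] .
  have cont: "continuous_on S (tri_harm i j k)" for S
    using continuous_hom_harm_poly[OF hom_harm_tri[OF ijk]] continuous_on_subset by blast
  have b2: "sph_bdd (\<lambda>x. (1 - e * tri_harm i j k x)\<^sup>2)" using bt by (intro sph_bdd_power sph_bdd_diff) auto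
  show "(\<lambda>x. 1 - e * tri_harm i j k x) \<in> Hs s"
    unfolding Hs_def mem_Collect_eq
  proof (intro conjI)
    show "integrable sph_measure (\<lambda>x. (1 - e * tri_harm i j k x)\<^sup>2)" by (rule sph_bdd_integrable[OF b2])
    show "summable (\<lambda>l. (1 + real l) powr (2 * s) * sph_int (\<lambda>x. (sph_harm_proj l (\<lambda>x. 1 - e * tri_harm i j k x) x)\<^sup>2))"
      by (rule summable_finite[of "{0, 2}"]) (auto simp: proj_test sph_int_def)
  qed measurable
  show "continuous_on (sphere 0 1) (\<lambda>x. 1 - e * tri_harm i j k x)"
    by (intro continuous_intros cont)
  show "0 < 1 - e * tri_harm i j k x" if "x \<in> sphere 0 1" for x
  proof -
    have "tri_harm i j k x \<le> 3" using abs_tri_harm_le[OF ijk, of x] that by simp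
    then have "e * tri_harm i j k x \<le> e * 3" using e by simp
    then show ?thesis using e by linarith
  qed
  show "\<not> in_M s (\<lambda>x. 1 - e * tri_harm i j k x)"
  proof
    assume "in_M s (\<lambda>x. 1 - e * tri_harm i j k x)"
    then obtain c \<zeta> where c: "c > 0" and \<zeta>: "norm \<zeta> < 1"
      and eq: "\<And>x. norm x = 1 \<Longrightarrow> 1 - e * tri_harm i j k x = c * (1 - \<zeta> \<bullet> x) powr bub_exp TYPE('a) s"
      unfolding in_M_def bubble_def by (auto simp: dist_norm)
    \<comment> \<open>The test function is even, while a bubble with \<zeta> \<noteq> 0 takes
      different values at the antipodes \<zeta> / |\<zeta>| and - \<zeta> / |\<zeta>|.\<close>
    have "\<zeta> = 0"
    proof (rule ccontr)
      assume "\<zeta> \<noteq> 0"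
      define x where "x = \<zeta> /\<^sub>R norm \<zeta>"
      have x: "norm x = 1" "norm (- x) = 1" using \<open>\<zeta> \<noteq> 0\<close> by (auto simp: x_def)
      have "tri_harm i j k (- x) = tri_harm i j k x" by (simp add: tri_harm_def)
      with eq[OF x(1)] eq[OF x(2)] c have "(1 - \<zeta> \<bullet> x) powr bub_exp TYPE('a) s = (1 + \<zeta> \<bullet> x) powr bub_exp TYPE('a) s" by simp
      moreover have "\<zeta> \<bullet> x = norm \<zeta>" using \<open>\<zeta> \<noteq> 0\<close> by (simp add: x_def power2_norm_eq_inner[symmetric] power2_eq_square)
      moreover have "(1 - norm \<zeta>) powr bub_exp TYPE('a) s < (1 + norm \<zeta>) powr bub_exp TYPE('a) s"
        using \<open>\<zeta> \<noteq> 0\<close> \<zeta> delta_bounds by (intro powr_less_mono2) auto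
      ultimately show False by simp
    qed
    \<comment> \<open>With \<zeta> = 0 the harmonic would be constant on the sphere, but it vanishes
      at i and is positive in the direction i + j.\<close>
    then have const: "tri_harm i j k x = (1 - c) / e" if "norm x = 1" for x
      using eq[OF that] e by (simp add: field_simps)
    have "tri_harm i j k i = 0" using ijk by (simp add: tri_harm_def inner_Basis)
    then have "tri_harm i j k x = 0" if "norm x = 1" for x
      using const[OF that] const[of i] ijk by simp
    moreover have ne: "i + j \<noteq> 0"
    proof
      assume "i + j = 0"
      with tri_harm_ij[OF ijk] show False by (simp add: tri_harm_def)
    qed
    then have "norm ((i + j) /\<^sub>R norm (i + j)) = 1" by simp
    moreover have "tri_harm i j k (norm (i + j) *\<^sub>R ((i + j) /\<^sub>R norm (i + j))) = norm (i + j) ^ 2 * tri_harm i j k ((i + j) /\<^sub>R norm (i + j))"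
      by (rule hom_harm_poly_scale[OF hom_harm_tri[OF ijk]])
    moreover have "norm (i + j) *\<^sub>R ((i + j) /\<^sub>R norm (i + j)) = i + j" using ne by simp
    ultimately show False using tri_harm_ij[OF ijk] by simp
  qed
qed

end

section \<open>The deficit of the test function\<close>

text \<open>Equivalently, the deficit of u is strictly below e^2 (alpha(2) - alpha(1)) times the
  integral of \<phi>^2. With V the mean of u^p, the right side is alpha(0) A V^(2/p), and Y is the
  expansion of V^(2/p) to second order. Instead of expanding V^(2/p) further, V is compared with
  Y^(p/2): the latter has no cubic term in e, the lower bound for V has \<kappa> e^3.\<close>

lemma deficit_test_less:
  fixes s :: real and i j k :: "'a::euclidean_space"
  assumes dim: "DIM('a) \<ge> 3" and s: "s - sph_dim TYPE('a) / 2 \<in> {0<..<1}"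
    and ijk: "i \<in> Basis" "j \<in> Basis" "k \<in> Basis" "i \<noteq> j" "j \<noteq> k" "i \<noteq> k"
  defines "p \<equiv> crit_exp TYPE('a) s"
  shows "\<forall>\<^sub>F e in at_right 0.
    alpha2s TYPE('a) s 0 * area TYPE('a) + e\<^sup>2 * alpha2s TYPE('a) s 1 * sph_int (\<lambda>x. (tri_harm i j k x)\<^sup>2)
      < Sconst TYPE('a) s * (sph_qnorm p (\<lambda>x. 1 - e * tri_harm i j k x))\<^sup>2"
proof -
  define n where "n = sph_dim TYPE('a)"
  have n: "n \<ge> 2" unfolding n_def by (rule sph_dim_ge_2[OF dim s])
  have ns: "n - 2 * s < 0" using s by (simp add: n_def)
  have p: "p = 2 * n / (n - 2 * s)" by (simp add: p_def crit_exp_def n_def)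
  have p0: "p < 0" unfolding p using n ns by (intro divide_pos_neg) auto
  have p1: "p - 1 = (n + 2 * s) / (n - 2 * s)" unfolding p using ns by (simp add: field_simps)
  define A where "A = area TYPE('a)"
  have A: "A > 0" unfolding A_def by (rule sph_area_pos[OF dim s])
  define al where "al = alpha2s TYPE('a) s"
  have al0: "al 0 < 0" unfolding al_def by (rule alpha2s_0_neg[OF dim s])
  \<comment> \<open>The recursion at l = 0, with p - 1 = (n + 2s) / (n - 2s): the second-order term
    of the norm produces exactly the symbol at degree 1.\<close>
  have al1: "al 1 = (p - 1) * al 0"
    using alpha2s_Suc[OF dim s, of 0] ns unfolding p1 al_def n_def[symmetric] by (simp add: field_simps)
  define \<phi> where "\<phi> = tri_harm i j k"
  have b\<phi>: "sph_bdd \<phi>" unfolding \<phi>_def by (rule sph_bdd_tri[OF ijk])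
  have [measurable]: "\<phi> \<in> borel_measurable borel" by (rule sph_bdd_measurable[OF b\<phi>])
  define m2 where "m2 = sph_int (\<lambda>x. (\<phi> x)\<^sup>2) / A"
  define m3 where "m3 = sph_int (\<lambda>x. (\<phi> x) ^ 3) / A"
  have m: "m2 > 0" "m3 > 0"
    using tri_harm_sq_pos[OF ijk] tri_harm_cube_pos[OF ijk] A by (auto simp: m2_def m3_def \<phi>_def)
  \<comment> \<open>Cubic coefficient of the mean of (1 - e \<phi>)^p. The minus sign before e
    \<phi> compensates p(p-1)(p-2) < 0; with a plus sign the cubic term would go the wrong
    way.\<close>
  define \<kappa> where "\<kappa> = - (p * (p - 1) * (p - 2) / 6 * m3)"
  have \<kappa>: "\<kappa> > 0"
  proof -
    have "p * (p - 1) * (p - 2) < 0" using p0 by (intro mult_pos_neg mult_neg_neg) auto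
    then show ?thesis using m by (simp add: \<kappa>_def mult_neg_pos)
  qed
  have "\<forall>\<^sub>F e in at_right 0. (1 + ((p - 1) * m2) * e\<^sup>2) powr (p / 2) < 1 + (p / 2) * ((p - 1) * m2) * e\<^sup>2 + \<kappa> * e ^ 3"
    by (rule eventually_powr_less_cubic[OF \<kappa>])
  moreover have "\<forall>\<^sub>F e in at_right 0. 0 < 1 + ((p - 1) * m2) * e\<^sup>2"
    by real_asymp
  moreover have "\<forall>\<^sub>F e in at_right 0. 0 < e \<and> e < (1 / 3 :: real)"
    by (auto simp: eventually_at_right_field intro!: exI[of _ "1 / 3"])
  ultimately show ?thesis
  proof eventually_elim
    case (elim e)
    define Y where "Y = 1 + ((p - 1) * m2) * e\<^sup>2"
    have Y: "Y > 0" using elim by (simp add: Y_def)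
    define V where "V = sph_int (\<lambda>x. (1 - e * \<phi> x) powr p) / A"
    have small: "e * \<phi> x < 1" "0 < 1 - e * \<phi> x" "\<bar>e * \<phi> x\<bar> \<le> 3 * e" if "norm x = 1" for x
    proof -
      have "\<bar>\<phi> x\<bar> \<le> 3" unfolding \<phi>_def by (rule abs_tri_harm_le[OF ijk that])
      then show "\<bar>e * \<phi> x\<bar> \<le> 3 * e" using elim by (simp add: abs_mult)
      then show "e * \<phi> x < 1" using elim by linarith
      then show "0 < 1 - e * \<phi> x" by simp
    qed
    \<comment> \<open>For p < 0 the power stays bounded because its base is at least 1 - 3 e >
      0.\<close>
    have bV: "sph_bdd (\<lambda>x. (1 - e * \<phi> x) powr p)"
      unfolding sph_bdd_def
    proof (intro conjI exI[of _ "(1 - 3 * e) powr p"] allI impI)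
      fix x :: 'a assume x: "norm x = 1"
      have "(1 - e * \<phi> x) powr p \<le> (1 - 3 * e) powr p"
        using abs_le_D1[OF small(3)[OF x]] elim p0 by (intro powr_mono2') linarith+
      then show "\<bar>(1 - e * \<phi> x) powr p\<bar> \<le> (1 - 3 * e) powr p" by simp
    qed measurable
    have "A * (1 + p * (p - 1) / 2 * m2 * e\<^sup>2 + \<kappa> * e ^ 3) \<le> sph_int (\<lambda>x. (1 - e * \<phi> x) powr p)"
    proof -
      define a b c where "a = - (p * e)" and "b = p * (p - 1) / 2 * e\<^sup>2" and "c = - (p * (p - 1) * (p - 2) / 6 * e ^ 3)"
      have bd: "sph_bdd (\<lambda>x. a * \<phi> x)" "sph_bdd (\<lambda>x. b * (\<phi> x)\<^sup>2)" "sph_bdd (\<lambda>x. c * (\<phi> x) ^ 3)"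
        by (intro sph_bdd_mult sph_bdd_const sph_bdd_power b\<phi>)+
      have "sph_int (\<lambda>x. 1 + (a * \<phi> x + (b * (\<phi> x)\<^sup>2 + c * (\<phi> x) ^ 3))) \<le> sph_int (\<lambda>x. (1 - e * \<phi> x) powr p)"
      proof (rule sph_int_mono[OF _ bV])
        show "sph_bdd (\<lambda>x. 1 + (a * \<phi> x + (b * (\<phi> x)\<^sup>2 + c * (\<phi> x) ^ 3)))"
          by (intro sph_bdd_add sph_bdd_const bd)
        fix x :: 'a assume x: "norm x = 1"
        show "1 + (a * \<phi> x + (b * (\<phi> x)\<^sup>2 + c * (\<phi> x) ^ 3)) \<le> (1 - e * \<phi> x) powr p"
          using powr_ge_cubic_Taylor[OF p0, of "- (e * \<phi> x)"] small[OF x]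
          by (simp add: a_def b_def c_def power_mult_distrib mult_ac)
      qed
      also have "sph_int (\<lambda>x. 1 + (a * \<phi> x + (b * (\<phi> x)\<^sup>2 + c * (\<phi> x) ^ 3))) =
          A + (a * sph_int \<phi> + (b * sph_int (\<lambda>x. (\<phi> x)\<^sup>2) + c * sph_int (\<lambda>x. (\<phi> x) ^ 3)))"
        unfolding sph_int_add[OF sph_bdd_const sph_bdd_add[OF bd(1) sph_bdd_add[OF bd(2,3)]]]
          sph_int_add[OF bd(1) sph_bdd_add[OF bd(2,3)]] sph_int_add[OF bd(2,3)] sph_int_cmult A_def ..
      also have "sph_int \<phi> = 0"
        unfolding \<phi>_def using sph_int_hom_harm_poly_eq_0[OF hom_harm_tri[OF ijk]] by simp
      also have "sph_int (\<lambda>x. (\<phi> x)\<^sup>2) = A * m2" using A by (simp add: m2_def)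
      also have "sph_int (\<lambda>x. (\<phi> x) ^ 3) = A * m3" using A by (simp add: m3_def)
      finally show ?thesis by (simp add: b_def c_def \<kappa>_def algebra_simps)
    qed
    then have "1 + p * (p - 1) / 2 * m2 * e\<^sup>2 + \<kappa> * e ^ 3 \<le> V"
      using A by (simp add: V_def field_simps)
    moreover have "Y powr (p / 2) < 1 + p * (p - 1) / 2 * m2 * e\<^sup>2 + \<kappa> * e ^ 3"
      using elim(1) by (simp add: Y_def mult_ac)
    ultimately have YV: "Y powr (p / 2) < V" by linarith
    \<comment> \<open>The exponent 2 / p is negative, so the inequality turns round; it turns again
      on multiplication by \<open>al 0\<close> < 0.\<close>
    have "V powr (2 / p) < (Y powr (p / 2)) powr (2 / p)"
      by (rule powr_less_mono2_neg[OF _ _ YV]) (use p0 Y in \<open>auto simp: divide_pos_neg\<close>)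
    also have "\<dots> = Y" using p0 Y by (simp add: powr_powr)
    finally have VY: "V powr (2 / p) < Y" .
    have V0: "V > 0" using YV by (meson le_less_trans powr_ge_zero)
    have q: "(sph_qnorm p (\<lambda>x. 1 - e * \<phi> x))\<^sup>2 = A powr (2 / p) * V powr (2 / p)"
    proof -
      have "sph_int (\<lambda>x. (1 - e * \<phi> x) powr p) = A * V" using A by (simp add: V_def)
      then have "sph_qnorm p (\<lambda>x. 1 - e * \<phi> x) = (A * V) powr (1 / p)" by (simp add: sph_qnorm_def)
      then have "(sph_qnorm p (\<lambda>x. 1 - e * \<phi> x))\<^sup>2 = (A * V) powr (1 / p) * (A * V) powr (1 / p)"
        by (simp add: power2_eq_square)
      also have "\<dots> = (A * V) powr (2 / p)" by (simp flip: powr_add)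
      finally show ?thesis using A V0 by (simp add: powr_mult)
    qed
    \<comment> \<open>The powers of the area from \<open>Sconst\<close> and from the norm thus
      combine to A itself.\<close>
    have "2 * s / n + 2 / p = 1" unfolding p using n ns by (simp add: field_simps)
    then have "A powr (2 * s / n) * A powr (2 / p) = A" using A by (simp flip: powr_add)
    then have S: "Sconst TYPE('a) s * (sph_qnorm p (\<lambda>x. 1 - e * \<phi> x))\<^sup>2 = al 0 * A * V powr (2 / p)"
      unfolding q Sconst_eq[OF dim s] A_def[symmetric] al_def[symmetric] n_def[symmetric]
      by (metis (no_types, opaque_lifting) mult.assoc)
    have "al 0 * A * Y < al 0 * A * V powr (2 / p)"
      using VY al0 A by (intro mult_strict_left_mono_neg) (auto simp: mult_neg_pos)
    moreover have "al 0 * A * Y = al 0 * A + e\<^sup>2 * al 1 * (A * m2)"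
      unfolding Y_def al1 by (simp add: algebra_simps)
    ultimately show ?case
      unfolding S[unfolded \<phi>_def] using A by (simp add: m2_def A_def al_def \<phi>_def)
  qed
qed

theorem theorem1p2:
  fixes s :: real
  assumes "DIM('a::euclidean_space) \<ge> 3"
    and "s > 0"
    and "s - sph_dim TYPE('a) / 2 \<in> {0<..<1}"
  shows "cBE TYPE('a) s < ereal (4 * s / (sph_dim TYPE('a) + 2 * s + 2))"
proof -
  note dim = assms(1) and s = assms(3)
  obtain B where B: "B \<subseteq> (Basis :: 'a set)" "card B = 3"
    using obtain_subset_with_card_n[OF dim] by blast
  then obtain i j k :: 'a where "B = {i, j, k}" "i \<noteq> j" "j \<noteq> k" "i \<noteq> k"
    by (auto simp: card_3_iff)
  with B have ijk: "i \<in> Basis" "j \<in> Basis" "k \<in> Basis" "i \<noteq> j" "j \<noteq> k" "i \<noteq> k" by auto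
  define al where "al = alpha2s TYPE('a) s"
  define n where "n = sph_dim TYPE('a)"
  define Q where "Q = sph_int (\<lambda>x. (tri_harm i j k x)\<^sup>2)"
  have n: "n \<ge> 2" unfolding n_def by (rule sph_dim_ge_2[OF dim s])
  have al0: "al 0 < 0" unfolding al_def by (rule alpha2s_0_neg[OF dim s])
  have al_pos: "al 1 > 0" "al 2 > 0" unfolding al_def by (rule alpha2s_pos[OF dim s]; simp)+
  have \<delta>: "bub_exp TYPE('a) s > 0" by (rule delta_bounds[OF dim s ijk])
  have Q: "Q > 0" unfolding Q_def by (rule tri_harm_sq_pos[OF ijk])
  have small: "\<forall>\<^sub>F e in at_right 0. C * e \<le> D" if "D > 0" for C D :: real
  proof -
    have "((\<lambda>e. C * e) \<longlongrightarrow> C * 0) (at_right 0)" by (intro tendsto_intros)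
    then have "\<forall>\<^sub>F e in at_right 0. C * e < D" using that by (intro order_tendstoD) auto
    then show ?thesis by eventually_elim simp
  qed
  have "\<forall>\<^sub>F e in at_right 0. 0 < e \<and> e < (1 / 3 :: real)"
    by (auto simp: eventually_at_right_field intro!: exI[of _ "1 / 3"])
  moreover have "\<forall>\<^sub>F e in at_right 0. (12 * al 2) * e \<le> - al 0" using al0 by (intro small) simp
  moreover have "\<forall>\<^sub>F e in at_right 0. (72 * al 2) * e \<le> al 1 * (bub_exp TYPE('a) s)\<^sup>2"
    using al_pos \<delta> by (intro small mult_pos_pos zero_less_power)
  moreover note deficit_test_less[OF dim s ijk]
  ultimately have "\<forall>\<^sub>F e in at_right 0. (0 < e \<and> e < (1 / 3 :: real)) \<and> (12 * al 2) * e \<le> - al 0 \<and>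
      (72 * al 2) * e \<le> al 1 * (bub_exp TYPE('a) s)\<^sup>2 \<and>
      al 0 * area TYPE('a) + e\<^sup>2 * al 1 * Q
      < Sconst TYPE('a) s * (sph_qnorm (crit_exp TYPE('a) s) (\<lambda>x. 1 - e * tri_harm i j k x))\<^sup>2"
    by eventually_elim (auto simp: al_def Q_def)
  then obtain e where e: "0 < e" "e < 1 / 3" "12 * al 2 * e \<le> - al 0"
      "72 * al 2 * e \<le> al 1 * (bub_exp TYPE('a) s)\<^sup>2"
      and def: "al 0 * area TYPE('a) + e\<^sup>2 * al 1 * Q
      < Sconst TYPE('a) s * (sph_qnorm (crit_exp TYPE('a) s) (\<lambda>x. 1 - e * tri_harm i j k x))\<^sup>2"
    using eventually_happens'[of "at_right (0::real)"] trivial_limit_at_right_real by blast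
  define u where "u = (\<lambda>x. 1 - e * tri_harm i j k x)"
  define t where "t = 4 * s / (n + 2 * s + 2)"
  have t: "t > 0" using n assms(2) by (simp add: t_def)
  have "al 2 * (1 + n / 2 - s) = al 1 * (1 + n / 2 + s)"
    using alpha2s_Suc[OF dim s, of 1] unfolding al_def n_def by (simp add: numeral_2_eq_2)
  then have tal: "t * al 2 = al 2 - al 1"
    using n assms(2) by (simp add: t_def field_simps)
  define d where "d = e\<^sup>2 * al 2 * Q"
  have d: "d > 0" using e al_pos Q by (simp add: d_def)
  have dist: "d \<le> dist_M s u"
    using dist_M_lower[OF dim s ijk e(1)] e(3,4) unfolding d_def u_def al_def Q_def by blast
  define N where "N = a2s s u u - Sconst TYPE('a) s * (sph_qnorm (crit_exp TYPE('a) s) u)\<^sup>2"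
  have "N < e\<^sup>2 * (al 2 - al 1) * Q"
    using def a2s_test[OF dim s ijk, of e] unfolding N_def u_def al_def Q_def by (simp add: algebra_simps)
  also have "\<dots> = t * d" unfolding tal[symmetric] d_def by simp
  \<comment> \<open>Here the lower bound for the distance enters. As d > 0, it also makes the
    denominator of the energy positive, which permits the division.\<close>
  also have "\<dots> \<le> t * dist_M s u" using dist t by simp
  finally have "energy_BE s u < t"
    unfolding energy_BE_def N_def[symmetric] using dist d by (simp add: divide_less_eq)
  moreover have "cBE TYPE('a) s \<le> ereal (energy_BE s u)"
    unfolding cBE_def by (rule INF_lower) (use admissible_test[OF dim s ijk e(1,2)] in \<open>simp add: u_def\<close>)
  ultimately have "cBE TYPE('a) s < ereal t" by (metis ereal_less_ereal_Ex le_less_trans less_ereal.simps(1))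
  then show ?thesis by (simp add: t_def n_def)
qed

end
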